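(* Let $n\ge1$, $0<\alpha<2$, $H_{\alpha,0}=-\Delta-\langle x\rangle^\alpha$ on $L^2(\mathbb{R}^n)$, and let $V_\alpha$ be a real-valued $H_{\alpha,0}$-compact potential. Then the operator $H_\alpha=H_{\alpha,0}+V_\alpha(x)$ satisfies $\sigma(H_\alpha)=\mathbb{R}$.
   Context: $\langle x\rangle=(1+|x|^2)^{1/2}$. $H_{\alpha,0}$ is essentially self-adjoint on $\{u\in H^2(\mathbb{R}^n):\langle x\rangle^2u\in L^2\}$ and denotes its self-adjoint extension. A potential $V$ is $H_{\alpha,0}$-compact if $V(H_{\alpha,0}+i)^{-1}$ is a compact operator on $L^2(\mathbb{R}^n)$; $H_\alpha$ is then self-adjoint on $D(H_{\alpha,0})$. *)

theory Defs
  imports "HOL-Analysis.Analysis"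
begin

definition square_integrable :: "('a::euclidean_space \<Rightarrow> complex) \<Rightarrow> bool" where
  "square_integrable f \<longleftrightarrow>
     f \<in> borel_measurable lebesgue \<and> integrable lebesgue (\<lambda>x. (norm (f x))\<^sup>2)"

definition L2_rel :: "('a::euclidean_space \<Rightarrow> complex) \<Rightarrow> ('a \<Rightarrow> complex) \<Rightarrow> bool" where
  "L2_rel f g \<longleftrightarrow> square_integrable f \<and> square_integrable g \<and> (AE x in lebesgue. f x = g x)"

lemma square_integrable_zero: "square_integrable (\<lambda>x. 0)"
  by (simp add: square_integrable_def)

lemma square_integrable_add:
  assumes "square_integrable f" "square_integrable g"
  shows "square_integrable (\<lambda>x. f x + g x)"
proof -
  have m: "f \<in> borel_measurable lebesgue" "g \<in> borel_measurable lebesgue"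
    using assms by (auto simp: square_integrable_def)
  have "integrable lebesgue (\<lambda>x. (norm (f x + g x))\<^sup>2)"
  proof (rule Bochner_Integration.integrable_bound)
    show "integrable lebesgue (\<lambda>x. 2 * (norm (f x))\<^sup>2 + 2 * (norm (g x))\<^sup>2)"
      using assms by (auto simp: square_integrable_def)
    have "(norm (f x + g x))\<^sup>2 \<le> 2 * (norm (f x))\<^sup>2 + 2 * (norm (g x))\<^sup>2" for x
    proof -
      have "(norm (f x + g x))\<^sup>2 \<le> (norm (f x) + norm (g x))\<^sup>2"
        by (intro power_mono norm_triangle_ineq) auto
      also have "\<dots> \<le> 2 * (norm (f x))\<^sup>2 + 2 * (norm (g x))\<^sup>2"
        using sum_squares_bound[of "norm (f x)" "norm (g x)"] by (simp add: power2_sum)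
      finally show ?thesis .
    qed
    then show "AE x in lebesgue. norm ((norm (f x + g x))\<^sup>2)
        \<le> norm (2 * (norm (f x))\<^sup>2 + 2 * (norm (g x))\<^sup>2)"
      by simp
  qed (use m in measurable)
  with m show ?thesis by (auto simp: square_integrable_def)
qed

lemma square_integrable_mult:
  "square_integrable f \<Longrightarrow> square_integrable (\<lambda>x. c * f x)"
  by (auto simp: square_integrable_def norm_mult power_mult_distrib)

lemma square_integrable_scaleR:
  "square_integrable f \<Longrightarrow> square_integrable (\<lambda>x. r *\<^sub>R f x)"
  using square_integrable_mult[of f "of_real r"] by (simp add: scaleR_conv_of_real)

lemma square_integrable_uminus:
  "square_integrable f \<Longrightarrow> square_integrable (\<lambda>x. - f x)"
  by (auto simp: square_integrable_def)

lemma square_integrable_diff: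
  "square_integrable f \<Longrightarrow> square_integrable g \<Longrightarrow> square_integrable (\<lambda>x. f x - g x)"
  using square_integrable_add[of f "\<lambda>x. - g x"] square_integrable_uminus[of g] by simp

lemma square_integrable_inner:
  assumes "square_integrable f" "square_integrable g"
  shows "integrable lebesgue (\<lambda>x. f x \<bullet> g x)"
proof (rule Bochner_Integration.integrable_bound)
  show "integrable lebesgue (\<lambda>x. (norm (f x))\<^sup>2 + (norm (g x))\<^sup>2)"
    using assms by (auto simp: square_integrable_def)
  show "(\<lambda>x. f x \<bullet> g x) \<in> borel_measurable lebesgue"
    using assms by (auto simp: square_integrable_def)
  have "norm (f x \<bullet> g x) \<le> (norm (f x))\<^sup>2 + (norm (g x))\<^sup>2" for x
    using Cauchy_Schwarz_ineq2[of "f x" "g x"] sum_squares_bound[of "norm (f x)" "norm (g x)"]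
      zero_le_mult_iff[of "norm (f x)" "norm (g x)"] by auto
  then show "AE x in lebesgue. norm (f x \<bullet> g x)
      \<le> norm ((norm (f x))\<^sup>2 + (norm (g x))\<^sup>2)"
    by simp
qed

quotient_type (overloaded) 'a L2 = "'a::euclidean_space \<Rightarrow> complex" / partial: L2_rel
proof (rule part_equivpI)
  show "\<exists>f. L2_rel f (f :: 'a \<Rightarrow> complex)"
    using square_integrable_zero by (auto simp: L2_rel_def)
  show "symp (L2_rel :: ('a \<Rightarrow> complex) \<Rightarrow> _)"
    by (rule sympI) (auto simp: L2_rel_def eq_commute)
  show "transp (L2_rel :: ('a \<Rightarrow> complex) \<Rightarrow> _)"
    by (rule transpI) (auto simp: L2_rel_def elim: eventually_elim2)
qed

lift_definition scaleC_L2 :: "complex \<Rightarrow> 'a::euclidean_space L2 \<Rightarrow> 'a L2"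
  is "\<lambda>c f x. c * f x"
  by (auto simp: L2_rel_def intro: square_integrable_mult)

instantiation L2 :: (euclidean_space) real_vector
begin

lift_definition zero_L2 :: "'a L2" is "\<lambda>x. 0"
  by (simp add: L2_rel_def square_integrable_zero)

lift_definition plus_L2 :: "'a L2 \<Rightarrow> 'a L2 \<Rightarrow> 'a L2" is "\<lambda>f g x. f x + g x"
  by (auto simp: L2_rel_def intro: square_integrable_add elim: eventually_elim2)

lift_definition minus_L2 :: "'a L2 \<Rightarrow> 'a L2 \<Rightarrow> 'a L2" is "\<lambda>f g x. f x - g x"
  by (auto simp: L2_rel_def intro: square_integrable_diff elim: eventually_elim2)

lift_definition uminus_L2 :: "'a L2 \<Rightarrow> 'a L2" is "\<lambda>f x. - f x"
  by (auto simp: L2_rel_def intro: square_integrable_uminus)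

lift_definition scaleR_L2 :: "real \<Rightarrow> 'a L2 \<Rightarrow> 'a L2" is "\<lambda>r f x. r *\<^sub>R f x"
  by (auto simp: L2_rel_def intro: square_integrable_scaleR)

instance
proof
  fix u v w :: "'a L2" and a b :: real
  show "u + v + w = u + (v + w)"
    by transfer (auto simp: L2_rel_def add.assoc intro: square_integrable_add)
  show "u + v = v + u"
    by transfer (auto simp: L2_rel_def add.commute intro: square_integrable_add)
  show "0 + u = u"
    by transfer (auto simp: L2_rel_def)
  show "- u + u = 0"
    by transfer (auto simp: L2_rel_def square_integrable_zero)
  show "u - v = u + - v"
    by transfer (auto simp: L2_rel_def intro: square_integrable_diff)
  show "a *\<^sub>R (u + v) = a *\<^sub>R u + a *\<^sub>R v"
    by transfer (auto simp: L2_rel_def scaleR_add_right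
        intro!: square_integrable_add square_integrable_scaleR)
  show "(a + b) *\<^sub>R u = a *\<^sub>R u + b *\<^sub>R u"
    by transfer (auto simp: L2_rel_def scaleR_add_left
        intro!: square_integrable_add square_integrable_scaleR)
  show "a *\<^sub>R b *\<^sub>R u = (a * b) *\<^sub>R u"
    by transfer (auto simp: L2_rel_def mult.assoc intro: square_integrable_mult square_integrable_scaleR)
  show "1 *\<^sub>R u = u"
    by transfer (auto simp: L2_rel_def)
qed

end

instantiation L2 :: (euclidean_space) real_inner
begin

text \<open>The real inner product is the real part of the usual sesquilinear one, since
  \<open>z \<bullet> w = Re (z * cnj w)\<close> for complex numbers; it induces the same norm.\<close>

lift_definition inner_L2 :: "'a L2 \<Rightarrow> 'a L2 \<Rightarrow> real"
  is "\<lambda>f g. integral\<^sup>L lebesgue (\<lambda>x. f x \<bullet> g x)"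
proof -
  fix f f' g g' :: "'a \<Rightarrow> complex"
  assume "L2_rel f f'" "L2_rel g g'"
  then have m: "f \<in> borel_measurable lebesgue" "f' \<in> borel_measurable lebesgue"
      "g \<in> borel_measurable lebesgue" "g' \<in> borel_measurable lebesgue"
    and ae: "AE x in lebesgue. f x = f' x" "AE x in lebesgue. g x = g' x"
    by (auto simp: L2_rel_def square_integrable_def)
  show "integral\<^sup>L lebesgue (\<lambda>x. f x \<bullet> g x) = integral\<^sup>L lebesgue (\<lambda>x. f' x \<bullet> g' x)"
  proof (rule integral_cong_AE)
    show "AE x in lebesgue. f x \<bullet> g x = f' x \<bullet> g' x"
      using ae by eventually_elim simp
  qed (use m in measurable)
qed

definition norm_L2 :: "'a L2 \<Rightarrow> real" where
  "norm_L2 u = sqrt (u \<bullet> u)"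

definition dist_L2 :: "'a L2 \<Rightarrow> 'a L2 \<Rightarrow> real" where
  "dist_L2 u v = norm (u - v)"

definition sgn_L2 :: "'a L2 \<Rightarrow> 'a L2" where
  "sgn_L2 u = u /\<^sub>R norm u"

definition uniformity_L2 :: "('a L2 \<times> 'a L2) filter" where
  "uniformity_L2 = (INF e\<in>{0<..}. principal {(u, v). dist u v < e})"

definition open_L2 :: "'a L2 set \<Rightarrow> bool" where
  "open_L2 U \<longleftrightarrow> (\<forall>u\<in>U. \<forall>\<^sub>F (u', v) in uniformity. u' = u \<longrightarrow> v \<in> U)"

instance
proof
  fix u v w :: "'a L2" and r :: real
  show "dist u v = norm (u - v)"
    by (rule dist_L2_def)
  show "sgn u = u /\<^sub>R norm u"
    by (rule sgn_L2_def)
  show "uniformity = (INF e\<in>{0<..}. principal {(u :: 'a L2, v). dist u v < e})"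
    by (rule uniformity_L2_def)
  show "open U \<longleftrightarrow> (\<forall>u\<in>U. \<forall>\<^sub>F (u', v) in uniformity. u' = u \<longrightarrow> v \<in> U)" for U :: "'a L2 set"
    by (rule open_L2_def)
  show "u \<bullet> v = v \<bullet> u"
    by transfer (simp add: inner_commute)
  show "(u + v) \<bullet> w = u \<bullet> w + v \<bullet> w"
    by transfer (auto simp: L2_rel_def inner_add_left square_integrable_inner)
  show "r *\<^sub>R u \<bullet> v = r * (u \<bullet> v)"
    by transfer (auto simp: L2_rel_def)
  show "0 \<le> u \<bullet> u"
    by transfer simp
  show "(u \<bullet> u = 0) = (u = 0)"
  proof transfer
    fix f :: "'a \<Rightarrow> complex"
    assume "L2_rel f f"
    then have f: "square_integrable f" by (simp add: L2_rel_def)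
    have "integral\<^sup>L lebesgue (\<lambda>x. f x \<bullet> f x) = 0 \<longleftrightarrow> (AE x in lebesgue. f x \<bullet> f x = 0)"
      by (rule integral_nonneg_eq_0_iff_AE) (auto intro: square_integrable_inner f)
    then show "integral\<^sup>L lebesgue (\<lambda>x. f x \<bullet> f x) = 0 \<longleftrightarrow> L2_rel f (\<lambda>x. 0)"
      using f by (simp add: L2_rel_def square_integrable_zero)
  qed
  show "norm u = sqrt (u \<bullet> u)"
    by (rule norm_L2_def)
qed

end

text \<open>A possibly unbounded operator \<open>T\<close> is represented by its graph, the set of pairs
  \<open>(u, T u)\<close> with \<open>u\<close> in the domain of \<open>T\<close>. Thus \<^const>\<open>Domain\<close> is the domain,
  \<^const>\<open>converse\<close> the inverse, \<open>R O S\<close> the composition \<open>S \<circ> R\<close>, and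
  \<^const>\<open>closure\<close> the closure of an operator.\<close>

type_synonym 'a operator = "('a L2 \<times> 'a L2) set"

definition op_plus :: "'a::euclidean_space operator \<Rightarrow> 'a operator \<Rightarrow> 'a operator" where
  "op_plus S T = {(u, v + w) | u v w. (u, v) \<in> S \<and> (u, w) \<in> T}"

definition op_shift :: "'a::euclidean_space operator \<Rightarrow> complex \<Rightarrow> 'a operator" where
  "op_shift T z = {(u, v + scaleC_L2 z u) | u v. (u, v) \<in> T}"

definition graph_of :: "('a::euclidean_space L2 \<Rightarrow> 'a L2) \<Rightarrow> 'a operator" where
  "graph_of A = {(u, A u) | u. True}"

definition bounded_clinear :: "('a::euclidean_space L2 \<Rightarrow> 'a L2) \<Rightarrow> bool" where
  "bounded_clinear A \<longleftrightarrow>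
     bounded_linear A \<and> (\<forall>c u. A (scaleC_L2 c u) = scaleC_L2 c (A u))"

definition compact_operator :: "'a::euclidean_space operator \<Rightarrow> bool" where
  "compact_operator T \<longleftrightarrow>
     (\<exists>A. T = graph_of A \<and> bounded_clinear A \<and> compact (closure (A ` cball 0 1)))"

definition resolvent_set :: "'a::euclidean_space operator \<Rightarrow> complex set" where
  "resolvent_set T = {z. \<exists>R. bounded_clinear R \<and> converse (op_shift T (- z)) = graph_of R}"

definition spectrum :: "'a::euclidean_space operator \<Rightarrow> complex set" where
  "spectrum T = - resolvent_set T"

text \<open>The domain is maximal: all \<open>u\<close> in \<open>L\<^sup>2\<close> with \<open>V u\<close> in \<open>L\<^sup>2\<close>. The choice of
  representatives is immaterial because equality is required only almost everywhere.\<close>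

definition mult_operator :: "('a::euclidean_space \<Rightarrow> real) \<Rightarrow> 'a operator" where
  "mult_operator V =
     {(u, w). AE x in lebesgue. rep_L2 w x = of_real (V x) * rep_L2 u x}"

fun C_k :: "nat \<Rightarrow> ('a::euclidean_space \<Rightarrow> complex) \<Rightarrow> bool" where
  "C_k 0 f \<longleftrightarrow> continuous_on UNIV f"
| "C_k (Suc k) f \<longleftrightarrow> (\<forall>x. f differentiable (at x)) \<and>
     (\<forall>b\<in>Basis. C_k k (\<lambda>x. frechet_derivative f (at x) b))"

definition test_function :: "('a::euclidean_space \<Rightarrow> complex) \<Rightarrow> bool" where
  "test_function \<phi> \<longleftrightarrow> (\<forall>k. C_k k \<phi>) \<and> compact (closure {x. \<phi> x \<noteq> 0})"

definition has_weak_partial :: "'a::euclidean_space \<Rightarrow> 'a L2 \<Rightarrow> 'a L2 \<Rightarrow> bool" where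
  "has_weak_partial b u v \<longleftrightarrow> (\<forall>\<phi>. test_function \<phi> \<longrightarrow>
     integral\<^sup>L lebesgue (\<lambda>x. rep_L2 u x * frechet_derivative \<phi> (at x) b) =
     - integral\<^sup>L lebesgue (\<lambda>x. rep_L2 v x * \<phi> x))"

text \<open>Weak derivatives are unique in \<open>L\<^sup>2\<close> when they exist; \<open>weak_partial\<close> is only used
  on \<open>sobolev_H2\<close>, where they do.\<close>

definition weak_partial :: "'a::euclidean_space \<Rightarrow> 'a L2 \<Rightarrow> 'a L2" where
  "weak_partial b u = (THE v. has_weak_partial b u v)"

definition sobolev_H2 :: "'a::euclidean_space L2 set" where
  "sobolev_H2 = {u. \<forall>b\<in>Basis. \<exists>v. has_weak_partial b u v \<and>
     (\<forall>c\<in>Basis. \<exists>w. has_weak_partial c v w)}"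

definition laplacian :: "'a::euclidean_space L2 \<Rightarrow> 'a L2" where
  "laplacian u = (\<Sum>b\<in>Basis. weak_partial b (weak_partial b u))"

definition jbracket :: "'a::euclidean_space \<Rightarrow> real" where
  "jbracket x = (1 + (norm x)\<^sup>2) powr (1/2)"

definition H_pre :: "real \<Rightarrow> 'a::euclidean_space operator" where
  "H_pre \<alpha> = {(u, - laplacian u - w) | u w.
     u \<in> sobolev_H2 \<and> u \<in> Domain (mult_operator (\<lambda>x. (jbracket x)\<^sup>2)) \<and>
     (u, w) \<in> mult_operator (\<lambda>x. jbracket x powr \<alpha>)}"

text \<open>\<open>H_pre \<alpha>\<close> is essentially self-adjoint for \<open>0 < \<alpha> < 2\<close>, so its
  self-adjoint extension is its closure.\<close>

definition H_free :: "real \<Rightarrow> 'a::euclidean_space operator" where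
  "H_free \<alpha> = closure (H_pre \<alpha>)"

definition H_free_compact :: "real \<Rightarrow> ('a::euclidean_space \<Rightarrow> real) \<Rightarrow> bool" where
  "H_free_compact \<alpha> V \<longleftrightarrow>
     compact_operator (converse (op_shift (H_free \<alpha>) \<i>) O mult_operator V)"

definition H_full :: "real \<Rightarrow> ('a::euclidean_space \<Rightarrow> real) \<Rightarrow> 'a operator" where
  "H_full \<alpha> V = op_plus (H_free \<alpha>) (mult_operator V)"

end

theory Submission
  imports Defs
begin

text \<open>
  The graph \<open>T\<close> of the free operator is symmetric, and the compactness hypothesis already forces
  \<open>T + \<i>\<close> to be onto, because \<open>V (T + \<i>)\<^sup>-\<^sup>1\<close> is total; hence essential self-adjointness need not be
  proved separately. With \<open>K = V (T + \<i>)\<^sup>-\<^sup>1\<close> one has \<open>T + V + \<i> = (1 + K) (T + \<i>)\<close>, so \<open>1 + K\<close> is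
  injective by symmetry and onto by the Fredholm alternative; complex conjugation gives the same for
  \<open>T + V - \<i>\<close>, and a contraction argument extends this to all nonreal spectral parameters.

  For a real number \<open>lam\<close>, the functions
  \<open>\<chi> (\<langle>x\<rangle>\<^sup>2 / \<rho>) exp (i \<Phi> (\<langle>x\<rangle>\<^sup>2))\<close> with
  \<open>\<bar>\<nabla>\<Phi>\<bar>\<^sup>2 = \<langle>x\<rangle>\<^sup>\<alpha> + lam + o(1)\<close> are approximate eigenfunctions as \<open>\<rho> \<rightarrow> \<infinity>\<close>. Those on disjoint shells are
  orthogonal, and a compact operator tends to \<open>0\<close> along a subsequence of any orthonormal sequence, so \<open>V\<close>
  does not destroy the singular sequence.

  Symmetry on the whole of \<open>H\<^sup>2\<close> rests on the fact that weak derivatives are the weak limits of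
  difference quotients, i.e. generators of the translation groups.
\<close>

section \<open>The space \<open>L\<^sup>2\<close>\<close>

text \<open>Why \<open>\<alpha> < 2\<close> is the threshold: on the shell where
  \<open>s = 1 + |x|^2\<close> lies between \<open>\<rho>\<close> and \<open>4 \<rho>\<close>, the
  phase has gradient of size \<open>\<rho>^(\<alpha>/4)\<close>, while the cutoff varies over a
  length of order \<open>\<rho>^(1/2)\<close>. The cross term in the Laplacian is thus of order
  \<open>\<rho>^(\<alpha>/4 - 1/2)\<close>, which tends to 0 exactly for
  \<open>\<alpha> < 2\<close>.

  Nothing is known about \<open>V\<close> beyond the total operator \<open>K\<close>, so domain
  questions and the action of \<open>V\<close> are both settled through the identity
  \<open>V u = K ((T + \<i>) u)\<close>.

  The free operator is a closure, whose elements have no explicit form. Only properties that survive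
  closure (linearity, symmetry, invariance under conjugation) are used for it; explicit functions
  enter as members of \<open>H_pre\<close> alone.

  The inner product is the real part of the sesquilinear one. Wherever imaginary parts matter, they
  are recovered by inserting a factor \<open>\<i>\<close>.\<close>

lemma square_integrable_rep [simp]: "square_integrable (rep_L2 u)"
  using Quotient_rep_reflp[OF Quotient_L2, of u] by (simp add: L2_rel_def)

lemma rep_L2_measurable [measurable]: "rep_L2 u \<in> borel_measurable lebesgue"
  using square_integrable_rep[of u] by (simp add: square_integrable_def)

lemma abs_rep_L2 [simp]: "abs_L2 (rep_L2 u) = u"
  by (rule Quotient_abs_rep[OF Quotient_L2])

lemma abs_L2_eq_iff:
  assumes "square_integrable f" "square_integrable g"
  shows "abs_L2 f = abs_L2 g \<longleftrightarrow> (AE x in lebesgue. f x = g x)"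
  using Quotient_rel[OF Quotient_L2, of f g] assms by (auto simp: L2_rel_def)

lemma rep_abs_L2:
  assumes "square_integrable f"
  shows "AE x in lebesgue. rep_L2 (abs_L2 f) x = f x"
  using abs_L2_eq_iff[of "rep_L2 (abs_L2 f)" f] assms by simp

lemma L2_eqI: "(AE x in lebesgue. rep_L2 u x = rep_L2 v x) \<Longrightarrow> u = v"
  using abs_L2_eq_iff[of "rep_L2 u" "rep_L2 v"] by simp

lemma rep_scaleC: "AE x in lebesgue. rep_L2 (scaleC_L2 c u) x = c * rep_L2 u x"
  using rep_abs_L2[OF square_integrable_mult[OF square_integrable_rep, of c u]]
  by (simp add: scaleC_L2_def)

lemma rep_add: "AE x in lebesgue. rep_L2 (u + v) x = rep_L2 u x + rep_L2 v x"
  using rep_abs_L2[OF square_integrable_add[OF square_integrable_rep square_integrable_rep, of u v]]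
  by (simp add: plus_L2_def)

lemma rep_diff: "AE x in lebesgue. rep_L2 (u - v) x = rep_L2 u x - rep_L2 v x"
  using rep_abs_L2[OF square_integrable_diff[OF square_integrable_rep square_integrable_rep, of u v]]
  by (simp add: minus_L2_def)

lemma rep_uminus: "AE x in lebesgue. rep_L2 (- u) x = - rep_L2 u x"
  using rep_abs_L2[OF square_integrable_uminus[OF square_integrable_rep, of u]]
  by (simp add: uminus_L2_def)

lemma rep_zero: "AE x in lebesgue. rep_L2 0 x = 0"
  using rep_abs_L2[OF square_integrable_zero] by (simp add: zero_L2_def)

lemma inner_rep: "u \<bullet> v = (\<integral>x. rep_L2 u x \<bullet> rep_L2 v x \<partial>lebesgue)"
  by (simp add: inner_L2_def)

lemma inner_abs:
  assumes "square_integrable f" "square_integrable g"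
  shows "abs_L2 f \<bullet> abs_L2 g = (\<integral>x. f x \<bullet> g x \<partial>lebesgue)"
  by (rule inner_L2.abs_eq) (use assms in \<open>auto simp: L2_rel_def\<close>)

lemma norm_abs_sq:
  assumes "square_integrable f"
  shows "(norm (abs_L2 f))\<^sup>2 = (\<integral>x. (norm (f x))\<^sup>2 \<partial>lebesgue)"
  using inner_abs[OF assms assms] by (simp add: power2_norm_eq_inner)

lemma abs_add:
  "square_integrable f \<Longrightarrow> square_integrable g \<Longrightarrow> abs_L2 f + abs_L2 g = abs_L2 (\<lambda>x. f x + g x)"
  by (rule plus_L2.abs_eq) (auto simp: L2_rel_def)

lemma abs_diff:
  "square_integrable f \<Longrightarrow> square_integrable g \<Longrightarrow> abs_L2 f - abs_L2 g = abs_L2 (\<lambda>x. f x - g x)"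
  by (rule minus_L2.abs_eq) (auto simp: L2_rel_def)

lemma abs_scaleC:
  "square_integrable f \<Longrightarrow> scaleC_L2 c (abs_L2 f) = abs_L2 (\<lambda>x. c * f x)"
  by (rule scaleC_L2.abs_eq) (auto simp: L2_rel_def)

lemma abs_scaleR:
  "square_integrable f \<Longrightarrow> r *\<^sub>R (abs_L2 f) = abs_L2 (\<lambda>x. r *\<^sub>R f x)"
  by (rule scaleR_L2.abs_eq) (auto simp: L2_rel_def)

lemma scaleC_add_right: "scaleC_L2 c (u + v) = scaleC_L2 c u + scaleC_L2 c v"
  by transfer (auto simp: L2_rel_def distrib_left intro!: square_integrable_add square_integrable_mult)

lemma scaleC_add_left: "scaleC_L2 (c + d) u = scaleC_L2 c u + scaleC_L2 d u"
  by transfer (auto simp: L2_rel_def distrib_right intro!: square_integrable_add square_integrable_mult)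

lemma scaleC_scaleC: "scaleC_L2 c (scaleC_L2 d u) = scaleC_L2 (c * d) u"
  by transfer (auto simp: L2_rel_def mult.assoc intro!: square_integrable_mult)

lemma scaleC_of_real: "scaleC_L2 (of_real r) u = r *\<^sub>R u"
  by transfer (auto simp: L2_rel_def scaleR_conv_of_real intro!: square_integrable_mult)

lemma scaleC_0 [simp]: "scaleC_L2 0 u = 0" and scaleC_1 [simp]: "scaleC_L2 1 u = u"
  and scaleC_minus1: "scaleC_L2 (-1) u = - u"
  using scaleC_of_real[of 0 u] scaleC_of_real[of 1 u] scaleC_of_real[of "-1" u] by auto

lemma scaleC_minus_left: "scaleC_L2 (- c) u = - scaleC_L2 c u"
  using scaleC_scaleC[of "-1" c u] by (simp add: scaleC_minus1)

lemma scaleC_minus_right: "scaleC_L2 c (- u) = - scaleC_L2 c u"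
  using scaleC_scaleC[of c "-1" u] by (simp add: scaleC_minus1 scaleC_minus_left)

lemma scaleC_diff_right: "scaleC_L2 c (u - v) = scaleC_L2 c u - scaleC_L2 c v"
  using scaleC_add_right[of c u "- v"] by (simp add: scaleC_minus_right)

lemma scaleC_diff_left: "scaleC_L2 (c - d) u = scaleC_L2 c u - scaleC_L2 d u"
  using scaleC_add_left[of c "- d" u] by (simp add: scaleC_minus_left)

lemma scaleC_zero_right [simp]: "scaleC_L2 c 0 = 0"
  using scaleC_scaleC[of c 0 0] by simp

text \<open>The real inner product forgets imaginary parts, but this adjoint rule keeps the complex
  structure visible; with \<open>c = \<i>\<close> it says that multiplication by \<open>\<i>\<close>
  is skew.\<close>

lemma inner_scaleC: "scaleC_L2 c u \<bullet> v = u \<bullet> scaleC_L2 (cnj c) v"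
proof transfer
  fix c :: complex and f g :: "'a \<Rightarrow> complex"
  show "(\<integral>x. (c * f x) \<bullet> g x \<partial>lebesgue) = (\<integral>x. f x \<bullet> (cnj c * g x) \<partial>lebesgue)"
    by (rule Bochner_Integration.integral_cong) (auto simp: inner_complex_def algebra_simps)
qed

lemma norm_scaleC: "norm (scaleC_L2 c u) = cmod c * norm u"
proof -
  have "scaleC_L2 c u \<bullet> scaleC_L2 c u = (cmod c)\<^sup>2 * (u \<bullet> u)"
    by (subst inner_commute)
       (simp add: inner_scaleC scaleC_scaleC complex_norm_square[symmetric] mult.commute[of "cnj c"]
         scaleC_of_real inner_commute flip: of_real_power)
  then show ?thesis by (simp add: norm_eq_sqrt_inner real_sqrt_mult)
qed

lemma scaleC_scaleR: "scaleC_L2 c (r *\<^sub>R u) = r *\<^sub>R scaleC_L2 c u"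
  by (simp add: scaleC_of_real[symmetric] scaleC_scaleC mult.commute)

lemma bounded_linear_scaleC: "bounded_linear (scaleC_L2 c)"
  by (rule bounded_linear_intro[where K = "cmod c"])
     (auto simp: scaleC_add_right scaleC_scaleR norm_scaleC mult.commute)

lemma borel_measurable_cnj [measurable]: "f \<in> borel_measurable M \<Longrightarrow> (\<lambda>x. cnj (f x)) \<in> borel_measurable M"
  by (rule borel_measurable_continuous_on[where f = cnj]) (auto intro: continuous_intros)

text \<open>Complex conjugation serves as a time reversal: the coefficients of all operators below
  are real, so it maps their graphs to themselves and carries solvability at \<open>z\<close> to
  solvability at \<open>cnj z\<close>.\<close>

lift_definition cnj_L2 :: "'a::euclidean_space L2 \<Rightarrow> 'a L2" is "\<lambda>f x. cnj (f x)"
  by (auto simp: L2_rel_def square_integrable_def)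

lemma square_integrable_cnj: "square_integrable f \<Longrightarrow> square_integrable (\<lambda>x. cnj (f x))"
  by (auto simp: square_integrable_def)

lemma rep_cnj: "AE x in lebesgue. rep_L2 (cnj_L2 u) x = cnj (rep_L2 u x)"
  using rep_abs_L2[OF square_integrable_cnj[OF square_integrable_rep, of u]]
  by (simp add: cnj_L2_def)

lemma cnj_L2_cnj [simp]: "cnj_L2 (cnj_L2 u) = u"
  by transfer (auto simp: L2_rel_def)

lemma cnj_L2_add: "cnj_L2 (u + v) = cnj_L2 u + cnj_L2 v"
  by transfer (auto simp: L2_rel_def intro!: square_integrable_cnj square_integrable_add)

lemma cnj_L2_diff: "cnj_L2 (u - v) = cnj_L2 u - cnj_L2 v"
  by transfer (auto simp: L2_rel_def intro!: square_integrable_cnj square_integrable_diff)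

lemma cnj_L2_uminus: "cnj_L2 (- u) = - cnj_L2 u"
  by transfer (auto simp: L2_rel_def intro!: square_integrable_cnj square_integrable_uminus)

lemma cnj_L2_zero [simp]: "cnj_L2 0 = 0"
  by transfer (auto simp: L2_rel_def square_integrable_zero)

lemma cnj_L2_sum: "cnj_L2 (sum f S) = (\<Sum>i\<in>S. cnj_L2 (f i))"
  by (induction S rule: infinite_finite_induct) (auto simp: cnj_L2_add)

lemma cnj_L2_scaleC: "cnj_L2 (scaleC_L2 c u) = scaleC_L2 (cnj c) (cnj_L2 u)"
  by transfer (auto simp: L2_rel_def intro!: square_integrable_cnj square_integrable_mult)

lemma cnj_L2_scaleR: "cnj_L2 (r *\<^sub>R u) = r *\<^sub>R cnj_L2 u"
  by (simp add: scaleC_of_real[symmetric] cnj_L2_scaleC)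

lemma norm_cnj_L2: "norm (cnj_L2 u) = norm u"
proof -
  have "cnj_L2 u \<bullet> cnj_L2 u = u \<bullet> u"
    by transfer (simp add: inner_complex_def)
  then show ?thesis by (simp add: norm_eq_sqrt_inner)
qed

lemma bounded_linear_cnj_L2: "bounded_linear (cnj_L2 :: 'a::euclidean_space L2 \<Rightarrow> _)"
  by (rule bounded_linear_intro[where K = 1])
     (auto simp: cnj_L2_add cnj_L2_scaleR norm_cnj_L2)

subsection \<open>Completeness\<close>

lemma L2_norm_rep: "(norm u)\<^sup>2 = (\<integral>x. (norm (rep_L2 u x))\<^sup>2 \<partial>lebesgue)"
  using norm_abs_sq[OF square_integrable_rep, of u] by simp

lemma nn_integral_norm_rep:
  "(\<integral>\<^sup>+x. ennreal ((norm (rep_L2 u x))\<^sup>2) \<partial>lebesgue) = ennreal ((norm u)\<^sup>2)"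
  using square_integrable_rep[of u] unfolding L2_norm_rep square_integrable_def
  by (intro nn_integral_eq_integral) auto

lemma square_integrable_of_nn_integral_le:
  assumes "f \<in> borel_measurable lebesgue" "(\<integral>\<^sup>+x. ennreal ((norm (f x))\<^sup>2) \<partial>lebesgue) \<le> ennreal (C\<^sup>2)" "C \<ge> 0"
  shows "square_integrable f" "norm (abs_L2 f) \<le> C"
proof -
  show 1: "square_integrable f"
    unfolding square_integrable_def
  proof (intro conjI assms(1) integrableI_bounded)
    show "(\<integral>\<^sup>+ x. ennreal (norm ((cmod (f x))\<^sup>2)) \<partial>lebesgue) < \<infinity>"
      using assms(2) by (simp add: order_le_less_trans)
  qed (use assms(1) in measurable)
  have "ennreal ((norm (abs_L2 f))\<^sup>2) = (\<integral>\<^sup>+x. ennreal ((norm (f x))\<^sup>2) \<partial>lebesgue)"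
    unfolding norm_abs_sq[OF 1] using 1 unfolding square_integrable_def
    by (intro nn_integral_eq_integral[symmetric]) auto
  with assms show "norm (abs_L2 f) \<le> C"
    by (metis ennreal_le_iff power2_le_imp_le zero_le_power2)
qed

text \<open>Fatou's lemma for \<open>|v n - v m|^2\<close> as \<open>n\<close> grows: one estimate
  yields both the square integrability of the limit and its distance to \<open>v m\<close>.\<close>

lemma L2_limit_of_AE_limit:
  fixes v :: "nat \<Rightarrow> 'a::euclidean_space L2"
  assumes lim: "AE x in lebesgue. (\<lambda>n. rep_L2 (v n) x) \<longlonglongrightarrow> f x"
    and f: "f \<in> borel_measurable lebesgue"
    and C: "\<And>n. n \<ge> m \<Longrightarrow> norm (v n - v m) \<le> C" "C \<ge> 0"
  shows "square_integrable f" "norm (abs_L2 f - v m) \<le> C"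
proof -
  define g where "g = (\<lambda>x. f x - rep_L2 (v m) x)"
  have g: "g \<in> borel_measurable lebesgue" unfolding g_def using f by measurable
  have "AE x in lebesgue. \<forall>n. rep_L2 (v n - v m) x = rep_L2 (v n) x - rep_L2 (v m) x"
    unfolding AE_all_countable by (auto intro: rep_diff)
  with lim have ae: "AE x in lebesgue. ennreal ((norm (g x))\<^sup>2)
      = liminf (\<lambda>n. ennreal ((norm (rep_L2 (v n - v m) x))\<^sup>2))"
  proof eventually_elim
    case (elim x)
    have "(\<lambda>n. ennreal ((norm (rep_L2 (v n - v m) x))\<^sup>2)) \<longlonglongrightarrow> ennreal ((norm (g x))\<^sup>2)"
      using elim unfolding g_def
      by (auto intro!: tendsto_ennrealI tendsto_power tendsto_norm tendsto_diff)
    from lim_imp_Liminf[OF trivial_limit_sequentially this] show ?case by (rule sym)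
  qed
  have "(\<integral>\<^sup>+x. ennreal ((norm (g x))\<^sup>2) \<partial>lebesgue)
      = (\<integral>\<^sup>+x. liminf (\<lambda>n. ennreal ((norm (rep_L2 (v n - v m) x))\<^sup>2)) \<partial>lebesgue)"
    using ae by (intro nn_integral_cong_AE) auto
  also have "\<dots> \<le> liminf (\<lambda>n. \<integral>\<^sup>+x. ennreal ((norm (rep_L2 (v n - v m) x))\<^sup>2) \<partial>lebesgue)"
    by (rule nn_integral_liminf) measurable
  also have "\<dots> = liminf (\<lambda>n. ennreal ((norm (v n - v m))\<^sup>2))"
    by (simp add: nn_integral_norm_rep)
  also have "\<dots> \<le> ennreal (C\<^sup>2)"
  proof (rule Liminf_le)
    show "\<forall>\<^sub>F n in sequentially. ennreal ((norm (v n - v m))\<^sup>2) \<le> ennreal (C\<^sup>2)"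
      using eventually_ge_at_top[of m] by eventually_elim (intro ennreal_leI power_mono C; simp)
  qed simp
  finally have le: "(\<integral>\<^sup>+x. ennreal ((norm (g x))\<^sup>2) \<partial>lebesgue) \<le> ennreal (C\<^sup>2)" .
  note G = square_integrable_of_nn_integral_le[OF g le C(2)]
  have "f = (\<lambda>x. g x + rep_L2 (v m) x)" by (simp add: g_def)
  with square_integrable_add[OF G(1) square_integrable_rep] show f': "square_integrable f" by simp
  have "abs_L2 f - v m = abs_L2 g"
    using abs_diff[OF f' square_integrable_rep[of "v m"]] by (simp add: g_def)
  with G(2) show "norm (abs_L2 f - v m) \<le> C" by simp
qed

lemma L2_fast_Cauchy_AE:
  fixes v :: "nat \<Rightarrow> 'a::euclidean_space L2"
  assumes fast: "\<And>n. norm (v (Suc n) - v n) \<le> (1/2)^n"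
  shows "AE x in lebesgue. Cauchy (\<lambda>n. rep_L2 (v n) x)"
proof -
  define d where "d = (\<lambda>n x. norm (rep_L2 (v (Suc n) - v n) x))"
  have [measurable]: "d n \<in> borel_measurable lebesgue" for n unfolding d_def by measurable
  have sq: "(\<integral>\<^sup>+x. ennreal ((d n x)\<^sup>2) \<partial>lebesgue) \<le> ennreal ((1/4)^n)" for n
  proof -
    have "(norm (v (Suc n) - v n))\<^sup>2 \<le> ((1/2)^n)\<^sup>2" by (intro power_mono fast) simp
    also have "\<dots> = (1/4)^n" by (simp add: power_mult_distrib power2_eq_square flip: power_mult_distrib)
    finally show ?thesis unfolding d_def nn_integral_norm_rep by (intro ennreal_leI)
  qed
  \<comment> \<open>Summability of \<open>2^n * (d n x)\<^sup>2\<close> gives \<open>d n x \<le> sqrt (1/2) ^ n\<close> for all large \<open>n\<close>.\<close>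
  have "(\<integral>\<^sup>+x. (\<Sum>n. ennreal (2^n * (d n x)\<^sup>2)) \<partial>lebesgue) = (\<Sum>n. \<integral>\<^sup>+x. ennreal (2^n * (d n x)\<^sup>2) \<partial>lebesgue)"
    by (rule nn_integral_suminf) measurable
  also have "\<dots> \<le> (\<Sum>n. ennreal ((1/2)^n))"
  proof (rule suminf_le)
    fix n
    have "(\<integral>\<^sup>+x. ennreal (2^n * (d n x)\<^sup>2) \<partial>lebesgue) = ennreal (2^n) * (\<integral>\<^sup>+x. ennreal ((d n x)\<^sup>2) \<partial>lebesgue)"
      by (simp add: ennreal_mult nn_integral_cmult)
    also have "\<dots> \<le> ennreal (2^n) * ennreal ((1/4)^n)" by (intro mult_left_mono sq) simp
    also have "\<dots> = ennreal ((1/2)^n)"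
      by (simp add: ennreal_mult[symmetric] power_mult_distrib[symmetric])
    finally show "(\<integral>\<^sup>+x. ennreal (2^n * (d n x)\<^sup>2) \<partial>lebesgue) \<le> ennreal ((1/2)^n)" .
  qed auto
  also have "\<dots> = ennreal (\<Sum>n. (1/2)^n)" by (rule suminf_ennreal2) (auto intro: summable_geometric)
  also have "\<dots> < \<infinity>" by simp
  finally have "AE x in lebesgue. (\<Sum>n. ennreal (2^n * (d n x)\<^sup>2)) \<noteq> \<infinity>"
    by (intro nn_integral_PInf_AE) auto
  moreover have "AE x in lebesgue. \<forall>n. rep_L2 (v (Suc n) - v n) x = rep_L2 (v (Suc n)) x - rep_L2 (v n) x"
    unfolding AE_all_countable by (auto intro: rep_diff)
  ultimately show ?thesis
  proof eventually_elim
    case (elim x)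
    have "summable (\<lambda>n. 2^n * (d n x)\<^sup>2)"
      by (rule summable_suminf_not_top) (use elim in auto)
    then have "(\<lambda>n. 2^n * (d n x)\<^sup>2) \<longlonglongrightarrow> 0" by (rule summable_LIMSEQ_zero)
    then have ev: "\<forall>\<^sub>F n in sequentially. 2^n * (d n x)\<^sup>2 < 1"
      by (rule order_tendstoD) simp
    have "summable (\<lambda>n. rep_L2 (v (Suc n)) x - rep_L2 (v n) x)"
    proof (rule summable_comparison_test_ev)
      show "\<forall>\<^sub>F n in sequentially. norm (rep_L2 (v (Suc n)) x - rep_L2 (v n) x) \<le> (sqrt (1/2))^n"
        using ev
      proof eventually_elim
        case (elim n)
        have "(d n x)\<^sup>2 \<le> (1/2)^n" using elim by (simp add: field_simps)
        then have "d n x \<le> sqrt ((1/2)^n)" by (rule real_le_rsqrt)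
        then show ?case using \<open>\<forall>n. rep_L2 (v (Suc n) - v n) x = _ n\<close> by (simp add: d_def real_sqrt_power)
      qed
      show "summable (\<lambda>n. (sqrt (1/2))^n)" by (rule summable_geometric) (simp add: real_sqrt_divide)
    qed
    then have "convergent (\<lambda>n. rep_L2 (v n) x - rep_L2 (v 0) x)"
      by (simp add: summable_iff_convergent sum_lessThan_telescope[of "\<lambda>n. rep_L2 (v n) x"])
    then have "convergent (\<lambda>n. (rep_L2 (v n) x - rep_L2 (v 0) x) + rep_L2 (v 0) x)"
      by (intro convergent_add convergent_const)
    then show ?case by (simp add: convergent_Cauchy)
  qed
qed

text \<open>Riesz-Fischer. A subsequence with geometrically small steps converges almost everywhere,
  the Fatou estimate upgrades this to norm convergence, and the Cauchy sequence follows its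
  subsequence. Completeness supplies orthogonal projections and the Banach fixed point theorem
  later.\<close>

instance L2 :: (euclidean_space) complete_space
proof
  fix X :: "nat \<Rightarrow> 'a L2"
  assume X: "Cauchy X"
  have "\<exists>N. \<forall>m\<ge>N. \<forall>n\<ge>N. norm (X m - X n) < (1/2)^k" for k
    using X unfolding Cauchy_iff by (meson half_gt_zero zero_less_one zero_less_power)
  then obtain N where N: "\<And>k m n. m \<ge> N k \<Longrightarrow> n \<ge> N k \<Longrightarrow> norm (X m - X n) < (1/2)^k" by metis
  \<comment> \<open>A running maximum makes the indices monotone; repetitions do no harm, since
    \<open>v\<close> need not be a strict subsequence.\<close>
  define r where "r k = Max (N ` {..k})" for k
  have r: "r k \<ge> N k" "r (Suc k) \<ge> r k" for k
    unfolding r_def by (auto intro!: Max_mono)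
  have inc: "r m \<ge> r k" if "m \<ge> k" for k m using that r(2) by (rule lift_Suc_mono_le[of r, rotated])
  define v where "v k = X (r k)" for k
  have dv: "norm (v n - v m) \<le> (1/2)^m" if "n \<ge> m" for m n
    unfolding v_def using N[of m "r n" "r m"] r(1)[of m] inc[OF that] by (simp add: less_imp_le)
  have ae: "AE x in lebesgue. Cauchy (\<lambda>n. rep_L2 (v n) x)"
    by (rule L2_fast_Cauchy_AE) (simp add: dv)
  define f where "f x = lim (\<lambda>n. rep_L2 (v n) x)" for x
  have lim: "AE x in lebesgue. (\<lambda>n. rep_L2 (v n) x) \<longlonglongrightarrow> f x"
    using ae by eventually_elim (simp add: f_def Cauchy_convergent_iff convergent_LIMSEQ_iff)
  have f: "f \<in> borel_measurable lebesgue"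
    unfolding f_def by (rule borel_measurable_lim_metric) measurable
  have *: "norm (abs_L2 f - v m) \<le> (1/2)^m" for m
    by (rule L2_limit_of_AE_limit[OF lim f]) (use dv in auto)
  have "v \<longlonglongrightarrow> abs_L2 f"
  proof (rule LIM_zero_cancel, rule Lim_null_comparison)
    show "\<forall>\<^sub>F n in sequentially. norm (v n - abs_L2 f) \<le> (1/2)^n"
      using * by (simp add: norm_minus_commute)
  qed (rule LIMSEQ_realpow_zero, auto)
  have "X \<longlonglongrightarrow> abs_L2 f"
  proof (rule metric_LIMSEQ_I)
    fix e :: real assume "e > 0"
    then obtain k where k: "(1/2)^k < e/2" using real_arch_pow_inv[of "e/2" "1/2"] by auto
    have "dist (X n) (abs_L2 f) < e" if "n \<ge> N k" for n
    proof -
      have "dist (X n) (v k) < e/2" using N[OF that r(1)] k by (simp add: v_def dist_norm)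
      moreover have "dist (v k) (abs_L2 f) < e/2" using *[of k] k by (simp add: dist_norm norm_minus_commute)
      ultimately show ?thesis by (rule dist_triangle_half_r[rotated, OF _ ] | metis dist_commute dist_triangle_half_l)
    qed
    then show "\<exists>no. \<forall>n\<ge>no. dist (X n) (abs_L2 f) < e" by blast
  qed
  then show "convergent X" by (auto simp: convergent_def)
qed

section \<open>Hilbert space preliminaries\<close>

text \<open>A minimizing sequence for the distance to \<open>S\<close> is Cauchy by the
  parallelogram law, because midpoints stay in \<open>S\<close> and so cannot beat the infimum
  \<open>d\<close>. Orthogonality is the first-order condition at the minimizer.\<close>

lemma orthogonal_projection_exists:
  fixes S :: "'a::{real_inner, complete_space} set"
  assumes S: "subspace S" "closed S"
  shows "\<exists>y\<in>S. \<forall>s\<in>S. (z - y) \<bullet> s = 0"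
proof -
  define d where "d = (INF y\<in>S. (norm (z - y))\<^sup>2)"
  have ne: "S \<noteq> {}" using subspace_0[OF S(1)] by auto
  have bdd: "bdd_below ((\<lambda>y. (norm (z - y))\<^sup>2) ` S)" by (rule bdd_belowI2[of _ 0]) simp
  have d: "d \<le> (norm (z - y))\<^sup>2" if "y \<in> S" for y
    unfolding d_def by (rule cINF_lower[OF bdd that])
  have "\<exists>y\<in>S. (norm (z - y))\<^sup>2 < d + inverse (real (Suc n))" for n
    using cINF_less_iff[OF ne bdd, of "d + inverse (real (Suc n))"] unfolding d_def[symmetric] by simp
  then obtain y where y: "\<And>n. y n \<in> S" "\<And>n. (norm (z - y n))\<^sup>2 < d + inverse (real (Suc n))"
    by metis
  have par: "(norm (y n - y m))\<^sup>2 \<le> 2 * inverse (real (Suc n)) + 2 * inverse (real (Suc m))" for n m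
  proof -
    have "d \<le> (norm (z - (1/2) *\<^sub>R (y n + y m)))\<^sup>2"
      by (intro d subspace_scale subspace_add y S)
    moreover have "(norm (y n - y m))\<^sup>2 + 4 * (norm (z - (1/2) *\<^sub>R (y n + y m)))\<^sup>2
        = 2 * (norm (z - y n))\<^sup>2 + 2 * (norm (z - y m))\<^sup>2"
      by (simp add: power2_norm_eq_inner algebra_simps inner_commute)
    ultimately show ?thesis using y(2)[of n] y(2)[of m] by linarith
  qed
  have "Cauchy y"
  proof (rule metric_CauchyI)
    fix e :: real assume "e > 0"
    then obtain N where N: "inverse (real (Suc N)) < e\<^sup>2 / 4"
      using reals_Archimedean[of "e\<^sup>2 / 4"] by auto
    have "dist (y m) (y n) < e" if "m \<ge> N" "n \<ge> N" for m n
    proof -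
      have "inverse (real (Suc n)) \<le> inverse (real (Suc N))" "inverse (real (Suc m)) \<le> inverse (real (Suc N))"
        using that by (auto intro!: le_imp_inverse_le)
      with N par[of m n] have "(norm (y m - y n))\<^sup>2 < e\<^sup>2" by linarith
      with \<open>e > 0\<close> show ?thesis by (simp add: dist_norm power_less_imp_less_base)
    qed
    then show "\<exists>M. \<forall>m\<ge>M. \<forall>n\<ge>M. dist (y m) (y n) < e" by blast
  qed
  then obtain y0 where y0: "y \<longlonglongrightarrow> y0" by (auto simp: Cauchy_convergent_iff convergent_def)
  have y0S: "y0 \<in> S" by (rule closed_sequentially[OF S(2) y(1) y0])
  have "(norm (z - y0))\<^sup>2 \<le> d + 0"
  proof (rule LIMSEQ_le)
    show "(\<lambda>n. (norm (z - y n))\<^sup>2) \<longlonglongrightarrow> (norm (z - y0))\<^sup>2" by (intro tendsto_intros y0)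
    show "(\<lambda>n. d + inverse (real (Suc n))) \<longlonglongrightarrow> d + 0"
      by (intro tendsto_intros LIMSEQ_inverse_real_of_nat)
  qed (use y(2) in \<open>auto intro: less_imp_le\<close>)
  then have min: "(norm (z - y0))\<^sup>2 \<le> (norm (z - y))\<^sup>2" if "y \<in> S" for y
    using order_trans[OF _ d[OF that], of "(norm (z - y0))\<^sup>2"] by simp
  have "(z - y0) \<bullet> s = 0" if s: "s \<in> S" for s
  proof (cases "s = 0")
    case False
    \<comment> \<open>The step length that minimizes the quadratic polynomial
      \<open>|z - y0 - t s|^2\<close> in \<open>t\<close>; minimality of \<open>y0\<close> forces
      the gain to vanish.\<close>
    define t where "t = ((z - y0) \<bullet> s) / (s \<bullet> s)"
    have ss: "s \<bullet> s > 0" using False by simp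
    have "(norm (z - y0))\<^sup>2 \<le> (norm (z - (y0 + t *\<^sub>R s)))\<^sup>2"
      by (intro min subspace_add subspace_scale S(1) y0S s)
    also have "\<dots> = (norm ((z - y0) - t *\<^sub>R s))\<^sup>2" by (simp add: algebra_simps)
    also have "\<dots> = (norm (z - y0))\<^sup>2 - 2 * t * ((z - y0) \<bullet> s) + t * t * (s \<bullet> s)"
      using inner_commute[of s "z - y0"]
      by (simp add: power2_norm_eq_inner inner_diff_left[of "z - y0"]
          inner_diff_right[of _ "z - y0"] right_diff_distrib)
    also have "t * t * (s \<bullet> s) = t * ((z - y0) \<bullet> s)" using ss by (simp add: t_def)
    finally have "t * ((z - y0) \<bullet> s) \<le> 0" by simp
    then have "((z - y0) \<bullet> s) * ((z - y0) \<bullet> s) \<le> 0"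
      using ss unfolding t_def by (simp add: divide_le_0_iff)
    then show ?thesis using not_square_less_zero[of "(z - y0) \<bullet> s"] by (simp add: order_le_less)
  qed simp
  with y0S show ?thesis by blast
qed

lemma closed_subspace_eq_UNIV:
  fixes S :: "'a::{real_inner, complete_space} set"
  assumes "subspace S" "closed S" and perp: "\<And>x. (\<And>s. s \<in> S \<Longrightarrow> x \<bullet> s = 0) \<Longrightarrow> x = 0"
  shows "S = UNIV"
proof -
  have "z \<in> S" for z
  proof -
    obtain y where "y \<in> S" "\<forall>s\<in>S. (z - y) \<bullet> s = 0"
      using orthogonal_projection_exists[OF assms(1,2)] by blast
    with perp[of "z - y"] show ?thesis by simp
  qed
  then show ?thesis by auto
qed

subsection \<open>Compact operators\<close>

lemma compact_image_subseq:
  fixes A :: "'a::real_normed_vector \<Rightarrow> 'b::real_normed_vector"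
  assumes A: "bounded_linear A" "compact (closure (A ` cball 0 1))"
    and x: "\<And>n::nat. norm (x n) \<le> C"
  shows "\<exists>y r. strict_mono (r :: nat \<Rightarrow> nat) \<and> (\<lambda>n. A (x (r n))) \<longlonglongrightarrow> y"
proof -
  interpret A: bounded_linear A by fact
  \<comment> \<open>The maximum keeps the rescaling factor positive when
    \<open>C = 0\<close>.\<close>
  define D where "D = max C 1"
  have D: "D > 0" by (simp add: D_def)
  have "x n /\<^sub>R D \<in> cball 0 1" for n using x[of n] D by (simp add: D_def field_simps)
  then have "\<forall>n. A (x n /\<^sub>R D) \<in> closure (A ` cball 0 1)"
    using closure_subset by blast
  with A(2)[unfolded compact_def, THEN spec, of "\<lambda>n. A (x n /\<^sub>R D)"]
  obtain l r where r: "strict_mono (r::nat\<Rightarrow>nat)" "((\<lambda>n. A (x n /\<^sub>R D)) \<circ> r) \<longlonglongrightarrow> l"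
    by auto
  have "(\<lambda>n. D *\<^sub>R A (x (r n) /\<^sub>R D)) \<longlonglongrightarrow> D *\<^sub>R l"
    using r(2) by (intro tendsto_intros) (simp add: o_def)
  then have "(\<lambda>n. A (x (r n))) \<longlonglongrightarrow> D *\<^sub>R l" using D by (simp add: A.scaleR)
  with r(1) show ?thesis by blast
qed

text \<open>Riesz's form of the Fredholm alternative: injectivity of \<open>1 + A\<close> is put
  into the locale, and the lemmas in it work towards \<open>surj_T\<close>.\<close>

locale compact_perturbation =
  fixes A :: "'a::{real_inner, complete_space} \<Rightarrow> 'a"
  assumes bl: "bounded_linear A" and cpt: "compact (closure (A ` cball 0 1))"
    and inj0: "\<And>x. x + A x = 0 \<Longrightarrow> x = 0"
begin

interpretation A: bounded_linear A by (fact bl)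

definition "T = (\<lambda>x. x + A x)"

lemma bl_T: "bounded_linear T"
  unfolding T_def by (intro bounded_linear_add bounded_linear_ident bl)

interpretation T: bounded_linear T by (fact bl_T)

lemma inj_T: "inj T"
proof (rule injI)
  fix x y assume "T x = T y"
  then have "T (x - y) = 0" by (simp add: T.diff)
  with inj0[of "x - y"] show "x = y" by (simp add: T_def)
qed

text \<open>By contradiction: for unit vectors with \<open>T (x n)\<close> tending to 0, a
  subsequence of \<open>A (x n)\<close> converges, hence so does that of
  \<open>x n = T (x n) - A (x n)\<close>, and its limit is a unit vector in the kernel.\<close>

lemma bounded_below_T: "\<exists>c>0. \<forall>x. c * norm x \<le> norm (T x)"
proof (rule ccontr)
  assume neg: "\<not> ?thesis"
  have "\<exists>x. norm x = 1 \<and> norm (T x) < inverse (real (Suc n))" for n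
  proof -
    obtain x where x: "norm (T x) < inverse (real (Suc n)) * norm x"
      using neg by (metis inverse_positive_iff_positive not_le of_nat_0_less_iff zero_less_Suc)
    then have "x \<noteq> 0" by auto
    then have "norm (x /\<^sub>R norm x) = 1" "norm (T (x /\<^sub>R norm x)) < inverse (real (Suc n))"
      using x by (auto simp: T.scaleR field_simps)
    then show ?thesis by blast
  qed
  then obtain x where x: "\<And>n. norm (x n) = 1" "\<And>n. norm (T (x n)) < inverse (real (Suc n))" by metis
  obtain y r where r: "strict_mono (r :: nat \<Rightarrow> nat)" "(\<lambda>n. A (x (r n))) \<longlonglongrightarrow> y"
    using compact_image_subseq[OF bl cpt, of x 1] x(1) by auto
  have T0: "(\<lambda>n. T (x n)) \<longlonglongrightarrow> 0"
    by (rule Lim_null_comparison[OF _ LIMSEQ_inverse_real_of_nat]) (use x(2) in \<open>auto intro: less_imp_le always_eventually\<close>)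
  have T0r: "(\<lambda>n. T (x (r n))) \<longlonglongrightarrow> 0" using LIMSEQ_subseq_LIMSEQ[OF T0 r(1)] by (simp add: o_def)
  have "(\<lambda>n. T (x (r n)) - A (x (r n))) \<longlonglongrightarrow> 0 - y" by (intro tendsto_diff T0r r(2))
  then have xr: "(\<lambda>n. x (r n)) \<longlonglongrightarrow> - y" by (simp add: T_def)
  have "T (- y) = 0" by (rule LIMSEQ_unique[OF T.tendsto[OF xr] T0r])
  then have "- y = 0" using inj0[of "- y"] unfolding T_def by blast
  moreover have "norm (- y) = 1"
    using tendsto_norm[OF xr] x(1) by (simp add: LIMSEQ_const_iff)
  ultimately show False by simp
qed

text \<open>The lower bound keeps the preimages of a convergent sequence bounded, so compactness of
  \<open>A\<close> again extracts a convergent subsequence of them.\<close>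

lemma closed_image_T:
  assumes S: "closed S"
  shows "closed (T ` S)"
proof (rule closed_sequential_limits[THEN iffD2], intro allI impI, elim conjE)
  fix f l assume f: "\<forall>n. f n \<in> T ` S" "f \<longlonglongrightarrow> l"
  then have "\<exists>s. s \<in> S \<and> f n = T s" for n by blast
  then obtain s where s: "\<And>n. s n \<in> S" "\<And>n. f n = T (s n)" by metis
  obtain c where c: "c > 0" "\<And>x. c * norm x \<le> norm (T x)" using bounded_below_T by blast
  obtain B where B: "\<And>n. norm (f n) \<le> B"
    using convergent_imp_bounded[OF f(2)] by (auto simp: bounded_iff)
  have "norm (s n) \<le> B / c" for n
    using c(2)[of "s n"] B[of n] c(1) by (simp add: s(2) field_simps)
  then obtain y r where r: "strict_mono (r :: nat \<Rightarrow> nat)" "(\<lambda>n. A (s (r n))) \<longlonglongrightarrow> y"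
    using compact_image_subseq[OF bl cpt] by blast
  have fr: "(\<lambda>n. f (r n)) \<longlonglongrightarrow> l" using LIMSEQ_subseq_LIMSEQ[OF f(2) r(1)] by (simp add: o_def)
  have "(\<lambda>n. f (r n) - A (s (r n))) \<longlonglongrightarrow> l - y" by (intro tendsto_diff fr r(2))
  then have sr: "(\<lambda>n. s (r n)) \<longlonglongrightarrow> l - y" by (simp add: T_def s(2))
  have "l - y \<in> S" by (rule closed_sequentially[OF S _ sr]) (rule s(1))
  moreover have "T (l - y) = l"
    by (rule LIMSEQ_unique[OF T.tendsto[OF sr]]) (use fr in \<open>simp add: s(2)\<close>)
  ultimately show "l \<in> T ` S" by force
qed

text \<open>Riesz's argument: if \<open>T\<close> were injective but not onto, the ranges of its
  powers would decrease strictly. Unit vectors in \<open>R n\<close> orthogonal to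
  \<open>R (Suc n)\<close> then have images under \<open>A\<close> at mutual distance at least 1,
  which compactness forbids.\<close>

lemma surj_T: "surj T"
proof (rule ccontr)
  assume ns: "\<not> surj T"
  define R where "R n = (T ^^ n) ` UNIV" for n
  have R0: "R 0 = UNIV" and RS: "R (Suc n) = T ` R n" for n by (auto simp: R_def image_image)
  have sub: "subspace (R n)" for n
    by (induction n) (auto simp: R0 RS intro: linear_subspace_image T.linear_axioms)
  have cl: "closed (R n)" for n
    by (induction n) (auto simp: R0 RS intro: closed_image_T)
  have dec: "R (Suc n) \<subseteq> R n" for n
    by (induction n) (auto simp: R0 RS)
  have dec': "R n \<subseteq> R m" if "m \<le> n" for m n
    using that by (rule lift_Suc_antimono_le[of R, OF dec])
  have strict: "R (Suc n) \<noteq> R n" for n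
  proof (induction n)
    case 0 then show ?case using ns by (simp add: R0 RS)
  next
    case (Suc n) then show ?case using inj_image_eq_iff[OF inj_T] by (simp add: RS)
  qed
  have "\<exists>x\<in>R n. norm x = 1 \<and> (\<forall>s\<in>R (Suc n). x \<bullet> s = 0)" for n
  proof -
    obtain z where z: "z \<in> R n" "z \<notin> R (Suc n)" using strict dec by blast
    obtain y where y: "y \<in> R (Suc n)" "\<forall>s\<in>R (Suc n). (z - y) \<bullet> s = 0"
      using orthogonal_projection_exists[OF sub cl] by blast
    have "z - y \<noteq> 0" using z y by auto
    moreover have "z - y \<in> R n" using z y dec by (intro subspace_diff sub) auto
    ultimately show ?thesis using y
      by (intro bexI[of _ "(z - y) /\<^sub>R norm (z - y)"]) (auto intro: subspace_scale[OF sub])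
  qed
  then obtain x where x: "\<And>n. x n \<in> R n" "\<And>n. norm (x n) = 1" "\<And>n s. s \<in> R (Suc n) \<Longrightarrow> x n \<bullet> s = 0"
    by metis
  have sep: "1 \<le> norm (A (x m) - A (x n))" if "m < n" for m n
  proof -
    \<comment> \<open>Everything in \<open>A (x m) - A (x n)\<close> apart from \<open>- x m\<close>
      lies in \<open>R (Suc m)\<close>, to which \<open>x m\<close> is orthogonal; Pythagoras gives
      the distance.\<close>
    define s where "s = T (x m) - T (x n) + x n"
    have "s \<in> R (Suc m)"
      unfolding s_def using dec'[of "Suc m" n] dec'[of "Suc m" "Suc n"] that x(1)[of n] x(1)[of m]
      by (intro subspace_add subspace_diff sub) (auto simp: RS)
    then have "x m \<bullet> s = 0" by (rule x(3))
    then have "(norm (s - x m))\<^sup>2 = (norm s)\<^sup>2 + (norm (x m))\<^sup>2"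
      by (simp add: power2_norm_eq_inner algebra_simps inner_commute)
    moreover have "s - x m = A (x m) - A (x n)" by (simp add: s_def T_def)
    ultimately have "1 \<le> (norm (A (x m) - A (x n)))\<^sup>2" using x(2)[of m] by simp
    then show ?thesis by (intro power2_le_imp_le[of 1]) simp_all
  qed
  obtain y r where r: "strict_mono (r :: nat \<Rightarrow> nat)" "(\<lambda>n. A (x (r n))) \<longlonglongrightarrow> y"
    using compact_image_subseq[OF bl cpt, of x 1] x(2) by auto
  have "Cauchy (\<lambda>n. A (x (r n)))" using r(2) by (rule LIMSEQ_imp_Cauchy)
  then obtain M where "\<forall>m\<ge>M. \<forall>n\<ge>M. norm (A (x (r m)) - A (x (r n))) < 1"
    unfolding Cauchy_iff using zero_less_one by blast
  then have "norm (A (x (r M)) - A (x (r (Suc M)))) < 1" by simp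
  moreover have "r M < r (Suc M)" using r(1) by (simp add: strict_mono_Suc_iff)
  ultimately show False using sep[of "r M" "r (Suc M)"] by simp
qed

end

section \<open>Compact operators on orthonormal sequences\<close>

lemma norm_orthonormal_sum:
  fixes e :: "nat \<Rightarrow> 'a::real_inner"
  assumes "\<And>n. norm (e n) = 1" "\<And>i j. i \<noteq> j \<Longrightarrow> e i \<bullet> e j = 0"
  shows "(norm (\<Sum>i<N. e i))\<^sup>2 = real N"
proof (induction N)
  case (Suc N)
  have "(\<Sum>i<N. e i) \<bullet> e N = 0" by (simp add: inner_sum_left assms(2))
  with Suc assms(1)[of N] show ?case
    by (simp add: power2_norm_eq_inner inner_add_left inner_add_right inner_commute norm_eq_1)
qed simp

text \<open>A nonzero limit \<open>y\<close> of the images is impossible: the sum of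
  \<open>N\<close> orthonormal vectors has norm \<open>sqrt N\<close>, whereas the inner product of
  its image with \<open>y\<close> would grow linearly in \<open>N\<close>. This avoids weak
  convergence.\<close>

lemma compact_orthonormal_subseq:
  fixes A :: "'a::real_inner \<Rightarrow> 'b::real_inner"
  assumes A: "bounded_linear A" "compact (closure (A ` cball 0 1))"
    and e: "\<And>n::nat. norm (e n) = 1" "\<And>i j. i \<noteq> j \<Longrightarrow> e i \<bullet> e j = 0"
  shows "\<exists>r. strict_mono (r :: nat \<Rightarrow> nat) \<and> (\<lambda>n. A (e (r n))) \<longlonglongrightarrow> 0"
proof -
  interpret A: bounded_linear A by fact
  obtain y r where r: "strict_mono (r :: nat \<Rightarrow> nat)" "(\<lambda>n. A (e (r n))) \<longlonglongrightarrow> y"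
    using compact_image_subseq[OF A, of e 1] e(1) by auto
  have "y = 0"
  proof (rule ccontr)
    assume "y \<noteq> 0"
    then have y: "y \<bullet> y > 0" by simp
    have "(\<lambda>n. A (e (r n)) \<bullet> y) \<longlonglongrightarrow> y \<bullet> y" by (intro tendsto_intros r(2))
    then have "\<forall>\<^sub>F n in sequentially. A (e (r n)) \<bullet> y > (y \<bullet> y) / 2"
      by (rule order_tendstoD) (use y in simp)
    then obtain M where M: "\<And>n. n \<ge> M \<Longrightarrow> A (e (r n)) \<bullet> y > (y \<bullet> y) / 2"
      by (auto simp: eventually_sequentially)
    obtain K where K: "\<And>x. norm (A x) \<le> norm x * K" "K > 0" using A.pos_bounded by blast
    define f where "f i = e (r (M + i))" for i
    have rinj: "r (M + i) \<noteq> r (M + j)" if "i \<noteq> j" for i j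
      using strict_mono_eq[OF r(1), of "M + i" "M + j"] that by simp
    have f: "norm (f i) = 1" "i \<noteq> j \<Longrightarrow> f i \<bullet> f j = 0" for i j
      using e rinj by (auto simp: f_def)
    have bound: "real N * ((y \<bullet> y) / 2) \<le> sqrt (real N) * (K * norm y)" for N
    proof -
      have "real N * ((y \<bullet> y) / 2) \<le> (\<Sum>i<N. A (f i) \<bullet> y)"
        using sum_bounded_below[of "{..<N}" "(y \<bullet> y) / 2" "\<lambda>i. A (f i) \<bullet> y"] M
        by (simp add: f_def less_imp_le)
      also have "\<dots> = A (\<Sum>i<N. f i) \<bullet> y" by (simp add: A.sum inner_sum_left)
      also have "\<dots> \<le> norm (A (\<Sum>i<N. f i)) * norm y" by (rule norm_cauchy_schwarz)
      also have "\<dots> \<le> (norm (\<Sum>i<N. f i) * K) * norm y" by (intro mult_right_mono K(1)) simp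
      also have "norm (\<Sum>i<N. f i) = sqrt (real N)"
        using norm_orthonormal_sum[of f N] f by (metis norm_ge_zero real_sqrt_unique)
      finally show ?thesis by (simp add: mult.assoc)
    qed
    obtain N :: nat where N: "real N > (2 * K * norm y / (y \<bullet> y))\<^sup>2" using reals_Archimedean2 by blast
    then have N0: "real N > 0" by (meson le_less_trans zero_le_power2)
    have "sqrt (real N) * sqrt (real N) * ((y \<bullet> y) / 2) \<le> sqrt (real N) * (K * norm y)" using bound[of N] by simp
    then have "sqrt (real N) * ((y \<bullet> y) / 2) \<le> K * norm y"
      using N0 by (simp only: mult.assoc mult_le_cancel_left_pos real_sqrt_gt_zero)
    then have "sqrt (real N) \<le> 2 * K * norm y / (y \<bullet> y)" using y by (simp add: field_simps)
    then have "real N \<le> (2 * K * norm y / (y \<bullet> y))\<^sup>2" by (rule sqrt_le_D)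
    with N show False by simp
  qed
  with r show ?thesis by blast
qed

section \<open>Symmetric linear relations\<close>

text \<open>Single-valuedness is not built in, so the class is stable under closure without a proof
  of closability.\<close>

definition linear_rel :: "'a::euclidean_space operator \<Rightarrow> bool" where
  "linear_rel T \<longleftrightarrow> (0, 0) \<in> T \<and>
     (\<forall>u v u' v'. (u, v) \<in> T \<longrightarrow> (u', v') \<in> T \<longrightarrow> (u + u', v + v') \<in> T) \<and>
     (\<forall>c u v. (u, v) \<in> T \<longrightarrow> (scaleC_L2 c u, scaleC_L2 c v) \<in> T)"

text \<open>The inner product is real, yet for a linear relation this is the usual sesquilinear
  symmetry: replacing \<open>(u', v')\<close> by its multiple by \<open>\<i>\<close> gives the
  imaginary part.\<close>

definition symmetric_rel :: "'a::euclidean_space operator \<Rightarrow> bool" where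
  "symmetric_rel T \<longleftrightarrow> (\<forall>u v u' v'. (u, v) \<in> T \<longrightarrow> (u', v') \<in> T \<longrightarrow> v \<bullet> u' = u \<bullet> v')"

definition cnj_invariant :: "'a::euclidean_space operator \<Rightarrow> bool" where
  "cnj_invariant T \<longleftrightarrow> (\<forall>u v. (u, v) \<in> T \<longrightarrow> (cnj_L2 u, cnj_L2 v) \<in> T)"

definition onto_at :: "'a::euclidean_space operator \<Rightarrow> complex \<Rightarrow> bool" where
  "onto_at T z \<longleftrightarrow> (\<forall>f. \<exists>u. (u, f) \<in> op_shift T (- z))"

lemma linear_relD:
  assumes "linear_rel T"
  shows "(0, 0) \<in> T" "(u, v) \<in> T \<Longrightarrow> (u', v') \<in> T \<Longrightarrow> (u + u', v + v') \<in> T"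
    "(u, v) \<in> T \<Longrightarrow> (scaleC_L2 c u, scaleC_L2 c v) \<in> T"
    "(u, v) \<in> T \<Longrightarrow> (u', v') \<in> T \<Longrightarrow> (u - u', v - v') \<in> T"
proof -
  show "(0, 0) \<in> T" and a: "(u, v) \<in> T \<Longrightarrow> (u', v') \<in> T \<Longrightarrow> (u + u', v + v') \<in> T"
    and s: "(u, v) \<in> T \<Longrightarrow> (scaleC_L2 c u, scaleC_L2 c v) \<in> T" for u v u' v' c
    using assms unfolding linear_rel_def by auto
  show "(u, v) \<in> T \<Longrightarrow> (u', v') \<in> T \<Longrightarrow> (u - u', v - v') \<in> T"
    using a[of u v "- u'" "- v'"] s[of u' v' "-1"] by (simp add: scaleC_minus1)
qed

lemma op_shift_iff: "(u, w) \<in> op_shift T z \<longleftrightarrow> (u, w - scaleC_L2 z u) \<in> T"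
proof
  show "(u, w) \<in> op_shift T z \<Longrightarrow> (u, w - scaleC_L2 z u) \<in> T" unfolding op_shift_def by auto
  show "(u, w - scaleC_L2 z u) \<in> T \<Longrightarrow> (u, w) \<in> op_shift T z" unfolding op_shift_def
    by (intro CollectI exI[of _ u] exI[of _ "w - scaleC_L2 z u"]) simp
qed

lemma linear_rel_op_shift: "linear_rel T \<Longrightarrow> linear_rel (op_shift T z)"
proof -
  assume T: "linear_rel T"
  note D = linear_relD[OF T]
  show ?thesis
    unfolding linear_rel_def op_shift_iff
  proof (intro conjI allI impI)
    show "(0, 0 - scaleC_L2 z 0) \<in> T" using D(1) by simp
    fix u v u' v' assume "(u, v - scaleC_L2 z u) \<in> T" "(u', v' - scaleC_L2 z u') \<in> T"
    from D(2)[OF this] show "(u + u', v + v' - scaleC_L2 z (u + u')) \<in> T"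
      by (simp add: scaleC_add_right algebra_simps)
  next
    fix c u v assume "(u, v - scaleC_L2 z u) \<in> T"
    from D(3)[OF this, of c] show "(scaleC_L2 c u, scaleC_L2 c v - scaleC_L2 z (scaleC_L2 c u)) \<in> T"
      by (simp add: scaleC_diff_right scaleC_scaleC mult.commute)
  qed
qed

lemma linear_rel_op_plus:
  assumes "linear_rel S" "linear_rel T"
  shows "linear_rel (op_plus S T)"
proof -
  note S = linear_relD[OF assms(1)] and T = linear_relD[OF assms(2)]
  show ?thesis
    unfolding linear_rel_def
  proof (intro conjI allI impI)
    show "(0, 0) \<in> op_plus S T" using S(1) T(1) unfolding op_plus_def by force
    fix u v u' v' assume "(u, v) \<in> op_plus S T" "(u', v') \<in> op_plus S T"
    then obtain a b a' b' where *: "(u, a) \<in> S" "(u, b) \<in> T" "v = a + b"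
      "(u', a') \<in> S" "(u', b') \<in> T" "v' = a' + b'" unfolding op_plus_def by blast
    have "(u + u', a + a') \<in> S" "(u + u', b + b') \<in> T" using * S(2) T(2) by auto
    then show "(u + u', v + v') \<in> op_plus S T" unfolding op_plus_def
      by (intro CollectI exI[of _ "u + u'"] exI[of _ "a + a'"] exI[of _ "b + b'"]) (simp add: * algebra_simps)
  next
    fix c u v assume "(u, v) \<in> op_plus S T"
    then obtain a b where *: "(u, a) \<in> S" "(u, b) \<in> T" "v = a + b" unfolding op_plus_def by blast
    then show "(scaleC_L2 c u, scaleC_L2 c v) \<in> op_plus S T" unfolding op_plus_def
      using S(3)[of u a c] T(3)[of u b c]
      by (intro CollectI exI[of _ "scaleC_L2 c u"] exI[of _ "scaleC_L2 c a"] exI[of _ "scaleC_L2 c b"])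
         (simp add: scaleC_add_right)
  qed
qed

lemma symmetric_rel_op_plus:
  "symmetric_rel S \<Longrightarrow> symmetric_rel T \<Longrightarrow> symmetric_rel (op_plus S T)"
  unfolding symmetric_rel_def
proof (intro allI impI)
  fix u v u' v'
  assume S: "\<forall>u v u' v'. (u, v) \<in> S \<longrightarrow> (u', v') \<in> S \<longrightarrow> v \<bullet> u' = u \<bullet> v'"
    and T: "\<forall>u v u' v'. (u, v) \<in> T \<longrightarrow> (u', v') \<in> T \<longrightarrow> v \<bullet> u' = u \<bullet> v'"
    and "(u, v) \<in> op_plus S T" "(u', v') \<in> op_plus S T"
  then obtain a b a' b' where *: "(u, a) \<in> S" "(u, b) \<in> T" "v = a + b"
    "(u', a') \<in> S" "(u', b') \<in> T" "v' = a' + b'" unfolding op_plus_def by blast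
  then have "a \<bullet> u' = u \<bullet> a'" "b \<bullet> u' = u \<bullet> b'" using S T by blast+
  then show "v \<bullet> u' = u \<bullet> v'" unfolding *(3) *(6) inner_add_left inner_add_right by simp
qed

lemma cnj_invariant_op_plus:
  "cnj_invariant S \<Longrightarrow> cnj_invariant T \<Longrightarrow> cnj_invariant (op_plus S T)"
  unfolding cnj_invariant_def
proof (intro allI impI)
  fix u v
  assume S: "\<forall>u v. (u, v) \<in> S \<longrightarrow> (cnj_L2 u, cnj_L2 v) \<in> S"
    and T: "\<forall>u v. (u, v) \<in> T \<longrightarrow> (cnj_L2 u, cnj_L2 v) \<in> T" and "(u, v) \<in> op_plus S T"
  then obtain a b where *: "(u, a) \<in> S" "(u, b) \<in> T" "v = a + b" unfolding op_plus_def by blast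
  then have "(cnj_L2 u, cnj_L2 a) \<in> S" "(cnj_L2 u, cnj_L2 b) \<in> T" using S T by blast+
  then show "(cnj_L2 u, cnj_L2 v) \<in> op_plus S T" unfolding op_plus_def *(3) cnj_L2_add by blast
qed

lemma closure_relI:
  assumes "(x, y) \<in> closure T" "\<And>u v. (u, v) \<in> T \<Longrightarrow> P u v" "closed {p. P (fst p) (snd p)}"
  shows "P x y"
proof -
  have "closure T \<subseteq> {p. P (fst p) (snd p)}" using assms(2,3) by (intro closure_minimal) auto
  with assms(1) show ?thesis by auto
qed

lemma closure_rel_limit:
  fixes x :: "'a::metric_space" and y :: "'b::metric_space"
  assumes "\<And>n::nat. (u n, v n) \<in> T" "u \<longlonglongrightarrow> x" "v \<longlonglongrightarrow> y"
  shows "(x, y) \<in> closure T"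
proof -
  have "(\<lambda>n. (u n, v n)) \<longlonglongrightarrow> (x, y)" by (intro tendsto_Pair assms)
  with assms(1) show ?thesis unfolding closure_sequential by (intro exI[of _ "\<lambda>n. (u n, v n)"]) simp
qed

lemma closure_relE:
  fixes x :: "'a::metric_space" and y :: "'b::metric_space"
  assumes "(x, y) \<in> closure T"
  obtains u v where "\<And>n::nat. (u n, v n) \<in> T" "u \<longlonglongrightarrow> x" "v \<longlonglongrightarrow> y"
proof -
  from assms obtain p where p: "\<And>n. p n \<in> T" "p \<longlonglongrightarrow> (x, y)"
    by (auto simp: closure_sequential)
  have "(\<lambda>n. fst (p n)) \<longlonglongrightarrow> x" "(\<lambda>n. snd (p n)) \<longlonglongrightarrow> y"
    using tendsto_fst[OF p(2)] tendsto_snd[OF p(2)] by auto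
  with p(1) show thesis by (intro that[of "\<lambda>n. fst (p n)" "\<lambda>n. snd (p n)"]) auto
qed

lemma closure_rel_image:
  assumes "(x, y) \<in> closure T" "bounded_linear f" "bounded_linear g"
    "\<And>u v. (u, v) \<in> T \<Longrightarrow> (f u, g v) \<in> S"
  shows "(f x, g y) \<in> closure S"
proof -
  obtain u v where *: "\<And>n::nat. (u n, v n) \<in> T" "u \<longlonglongrightarrow> x" "v \<longlonglongrightarrow> y"
    using closure_relE[OF assms(1)] by blast
  have S: "(f (u n), g (v n)) \<in> S" for n by (rule assms(4)[OF *(1)])
  show ?thesis
    by (rule closure_rel_limit[where u = "\<lambda>n. f (u n)" and v = "\<lambda>n. g (v n)", OF S])
      (intro bounded_linear.tendsto[OF assms(2)] bounded_linear.tendsto[OF assms(3)] *)+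
qed

lemma linear_rel_closure:
  assumes T: "linear_rel T"
  shows "linear_rel (closure T)"
  unfolding linear_rel_def
proof (intro conjI allI impI)
  note D = linear_relD[OF T]
  show "(0, 0) \<in> closure T" using D(1) closure_subset by blast
  fix u v u' v' assume *: "(u, v) \<in> closure T" "(u', v') \<in> closure T"
  obtain a b where ab: "\<And>n::nat. (a n, b n) \<in> T" "a \<longlonglongrightarrow> u" "b \<longlonglongrightarrow> v" using closure_relE[OF *(1)] by blast
  obtain a' b' where ab': "\<And>n::nat. (a' n, b' n) \<in> T" "a' \<longlonglongrightarrow> u'" "b' \<longlonglongrightarrow> v'" using closure_relE[OF *(2)] by blast
  have "(a n + a' n, b n + b' n) \<in> T" for n by (rule D(2)[OF ab(1) ab'(1)])
  then show "(u + u', v + v') \<in> closure T"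
    by (rule closure_rel_limit[where u = "\<lambda>n. a n + a' n" and v = "\<lambda>n. b n + b' n"]) (intro tendsto_add ab ab')+
next
  fix c u v assume "(u, v) \<in> closure T"
  then show "(scaleC_L2 c u, scaleC_L2 c v) \<in> closure T"
    by (rule closure_rel_image[where T = T]) (rule bounded_linear_scaleC linear_relD(3)[OF T])+
qed

lemma cnj_invariant_closure: "cnj_invariant T \<Longrightarrow> cnj_invariant (closure T)"
  unfolding cnj_invariant_def
proof (intro allI impI)
  fix u v assume *: "\<forall>u v. (u, v) \<in> T \<longrightarrow> (cnj_L2 u, cnj_L2 v) \<in> T" "(u, v) \<in> closure T"
  show "(cnj_L2 u, cnj_L2 v) \<in> closure T"
    by (rule closure_rel_image[OF *(2) bounded_linear_cnj_L2 bounded_linear_cnj_L2]) (use *(1) in blast)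
qed

text \<open>For a fixed second pair the identity is a closed condition on the first, so the closure
  can be taken in one argument after the other.\<close>

lemma symmetric_rel_closure:
  assumes T: "symmetric_rel T"
  shows "symmetric_rel (closure T)"
  unfolding symmetric_rel_def
proof (intro allI impI)
  fix u v u' v' assume *: "(u, v) \<in> closure T" "(u', v') \<in> closure T"
  have "v \<bullet> a = u \<bullet> b" if "(a, b) \<in> T" for a b
    using *(1) by (rule closure_relI)
      (use T that in \<open>auto simp: symmetric_rel_def intro!: closed_Collect_eq continuous_intros\<close>)
  with *(2) show "v \<bullet> u' = u \<bullet> v'"
    by (rule closure_relI) (auto intro!: closed_Collect_eq continuous_intros)
qed

section \<open>Lower bounds and solvability off the real axis\<close>

lemma inner_scaleC_ii: "u \<bullet> scaleC_L2 \<i> u = 0"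
proof -
  have "scaleC_L2 \<i> u \<bullet> u = - (u \<bullet> scaleC_L2 \<i> u)"
    using inner_scaleC[of \<i> u u] by (simp add: scaleC_minus_left)
  then show ?thesis using inner_commute[of u "scaleC_L2 \<i> u"] by linarith
qed

text \<open>Since \<open>(T u, u)\<close> is real, \<open>(T - Re z) u\<close> is orthogonal to
  \<open>\<i> u\<close> for the real inner product, and \<open>w\<close> is the sum of the former
  and a multiple of the latter; Pythagoras does the rest.\<close>

lemma symmetric_rel_lower_bound:
  assumes T: "linear_rel T" "symmetric_rel T" and uw: "(u, w) \<in> op_shift T (- z)"
  shows "\<bar>Im z\<bar> * norm u \<le> norm w"
proof -
  define v where "v = w + scaleC_L2 z u"
  have v: "(u, v) \<in> T" using uw by (simp add: op_shift_iff v_def scaleC_minus_left)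
  \<comment> \<open>Symmetry for the pair \<open>(\<i> u, \<i> v)\<close> and skewness of
    multiplication by \<open>\<i>\<close> give opposite values for the same number.\<close>
  have "v \<bullet> scaleC_L2 \<i> u = u \<bullet> scaleC_L2 \<i> v"
    using T(2) v linear_relD(3)[OF T(1) v, of \<i>] unfolding symmetric_rel_def by blast
  moreover have "v \<bullet> scaleC_L2 \<i> u = - (u \<bullet> scaleC_L2 \<i> v)"
    unfolding inner_commute[of v "scaleC_L2 \<i> u"] inner_scaleC by (simp add: scaleC_minus_left)
  ultimately have vi: "v \<bullet> scaleC_L2 \<i> u = 0" by simp
  define a where "a = v - Re z *\<^sub>R u"
  have ai: "a \<bullet> scaleC_L2 \<i> u = 0" by (simp add: a_def inner_diff_left vi inner_scaleC_ii)
  have "scaleC_L2 z u = Re z *\<^sub>R u + Im z *\<^sub>R scaleC_L2 \<i> u"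
  proof -
    have "z = of_real (Re z) + of_real (Im z) * \<i>" by (simp add: complex_eq_iff)
    then have "scaleC_L2 z u = scaleC_L2 (of_real (Re z) + of_real (Im z) * \<i>) u" by simp
    then show ?thesis by (simp only: scaleC_add_left scaleC_of_real flip: scaleC_scaleC)
  qed
  then have w: "w = a - Im z *\<^sub>R scaleC_L2 \<i> u" by (simp add: v_def a_def)
  have "(norm w)\<^sup>2 = (norm a)\<^sup>2 + (Im z * norm u)\<^sup>2"
  proof -
    have "norm (scaleC_L2 \<i> u) = norm u" by (simp add: norm_scaleC)
    then have "scaleC_L2 \<i> u \<bullet> scaleC_L2 \<i> u = u \<bullet> u" by (simp add: norm_eq)
    then show ?thesis
      unfolding w using ai inner_commute[of "scaleC_L2 \<i> u" a]
      by (simp add: power2_norm_eq_inner power_mult_distrib inner_diff_left[of a]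
          inner_diff_right[of _ a]) (simp add: power2_eq_square)
  qed
  then have "(\<bar>Im z\<bar> * norm u)\<^sup>2 \<le> (norm w)\<^sup>2" by (simp add: power_mult_distrib)
  then show ?thesis by (rule power2_le_imp_le) simp
qed

text \<open>The lower bound makes solutions unique, so the solution map picked by choice is
  automatically linear, and the same bound controls its norm.\<close>

lemma onto_at_inverse:
  assumes T: "linear_rel T" "symmetric_rel T" and z: "Im z \<noteq> 0" "onto_at T z"
  obtains R where "bounded_clinear R" "\<And>u f. (u, f) \<in> op_shift T (- z) \<longleftrightarrow> u = R f"
    "\<And>f. norm (R f) \<le> norm f / \<bar>Im z\<bar>"
proof -
  note L = linear_relD[OF linear_rel_op_shift[OF T(1), of "- z"]]
  note B = symmetric_rel_lower_bound[OF T]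
  obtain R where R: "\<And>f. (R f, f) \<in> op_shift T (- z)" using z(2) unfolding onto_at_def by metis
  have uniq: "u = u'" if "(u, f) \<in> op_shift T (- z)" "(u', f) \<in> op_shift T (- z)" for u u' f
    using B[of "u - u'" 0 z] L(4)[OF that] z(1) by (simp add: mult_le_0_iff)
  have b: "norm (R f) \<le> norm f / \<bar>Im z\<bar>" for f using B[OF R, of f] z(1) by (simp add: field_simps)
  have "bounded_clinear R"
    unfolding bounded_clinear_def
  proof (intro conjI allI)
    show sc: "R (scaleC_L2 c u) = scaleC_L2 c (R u)" for c u
      by (rule uniq[OF R L(3)[OF R]])
    show "bounded_linear R"
    proof (rule bounded_linear_intro[where K = "1 / \<bar>Im z\<bar>"])
      show "R (x + y) = R x + R y" for x y by (rule uniq[OF R L(2)[OF R R]])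
      show "R (r *\<^sub>R x) = r *\<^sub>R R x" for r x using sc[of "of_real r" x] by (simp add: scaleC_of_real)
    qed (use b in simp)
  qed
  moreover have "(u, f) \<in> op_shift T (- z) \<longleftrightarrow> u = R f" for u f using R uniq by metis
  ultimately show thesis using b by (intro that) auto
qed

lemma onto_at_resolvent_set:
  assumes "linear_rel T" "symmetric_rel T" "Im z \<noteq> 0" "onto_at T z"
  shows "z \<in> resolvent_set T"
proof -
  obtain R where R: "bounded_clinear R" "\<And>u f. (u, f) \<in> op_shift T (- z) \<longleftrightarrow> u = R f"
    using onto_at_inverse[OF assms] by metis
  have "converse (op_shift T (- z)) = graph_of R" unfolding graph_of_def using R(2) by auto
  with R(1) show ?thesis unfolding resolvent_set_def by blast
qed

text \<open>With \<open>R\<close> the inverse of \<open>T - z\<close>, solving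
  \<open>(T - w) u = f\<close> means finding a fixed point \<open>u = R (f + (w - z) u)\<close>; the
  norm bound \<open>1 / |Im z|\<close> for \<open>R\<close> makes this a contraction for
  \<open>w\<close> in the disc of radius \<open>|Im z|\<close>.\<close>

lemma onto_at_nearby:
  assumes T: "linear_rel T" "symmetric_rel T" and z: "onto_at T z" "cmod (w - z) < \<bar>Im z\<bar>"
  shows "onto_at T w"
  unfolding onto_at_def
proof
  fix f
  have z0: "Im z \<noteq> 0" using z(2) by (metis abs_zero less_irrefl norm_ge_zero not_less)
  obtain R where R: "bounded_clinear R" "\<And>u f. (u, f) \<in> op_shift T (- z) \<longleftrightarrow> u = R f"
    "\<And>f. norm (R f) \<le> norm f / \<bar>Im z\<bar>"
    using onto_at_inverse[OF T z0 z(1)] by metis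
  interpret R: bounded_linear R using R(1) by (simp add: bounded_clinear_def)
  define F where "F u = R (f + scaleC_L2 (w - z) u)" for u
  have "\<exists>!u. F u = u"
  proof (rule banach_fix_type[where c = "cmod (w - z) / \<bar>Im z\<bar>"])
    show "\<forall>u v. dist (F u) (F v) \<le> cmod (w - z) / \<bar>Im z\<bar> * dist u v"
    proof (intro allI)
      fix u v
      have "F u - F v = R (scaleC_L2 (w - z) (u - v))"
        unfolding F_def R.diff[symmetric] by (simp add: scaleC_diff_right)
      with R(3)[of "scaleC_L2 (w - z) (u - v)"]
      show "dist (F u) (F v) \<le> cmod (w - z) / \<bar>Im z\<bar> * dist u v" by (simp add: dist_norm norm_scaleC)
    qed
  qed (use z z0 in auto)
  then obtain u where "R (f + scaleC_L2 (w - z) u) = u" unfolding F_def by blast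
  then have "(u, f + scaleC_L2 (w - z) u) \<in> op_shift T (- z)" using R(2) by simp
  then have "(u, f) \<in> op_shift T (- w)"
    by (simp add: op_shift_iff scaleC_minus_left scaleC_diff_left)
  then show "\<exists>u. (u, f) \<in> op_shift T (- w)" ..
qed

text \<open>The discs about \<open>\<i> y\<close> of radius \<open>y\<close> exhaust the upper half
  plane as \<open>y\<close> grows, so it is enough to climb the imaginary axis.\<close>

lemma onto_at_upper_half_plane:
  assumes T: "linear_rel T" "symmetric_rel T" and i: "onto_at T \<i>" and w: "Im w > 0"
  shows "onto_at T w"
proof -
  \<comment> \<open>Multiplying the height by 3/2 moves the centre by half the radius, well inside
    the disc; any ratio between 1 and 2 would serve.\<close>
  have pow: "onto_at T (of_real ((3/2)^k) * \<i>)" for k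
  proof (induction k)
    case (Suc k)
    show ?case
    proof (rule onto_at_nearby[OF T Suc])
      have "of_real ((3/2)^Suc k) * \<i> - of_real ((3/2)^k) * \<i> = of_real ((3/2)^k / 2) * \<i>"
        by (simp add: field_simps)
      also have "cmod \<dots> = (3/2)^k / 2" by (simp only: norm_mult norm_of_real) simp
      finally show "cmod (of_real ((3/2)^Suc k) * \<i> - of_real ((3/2)^k) * \<i>) < \<bar>Im (of_real ((3/2)^k) * \<i>)\<bar>"
        by simp
    qed
  qed (use i in simp)
  \<comment> \<open>The condition \<open>|w - \<i> y| < y\<close> is the same as
    \<open>|w|^2 < 2 y Im w\<close>, whence this threshold for the height.\<close>
  obtain k where k: "((Re w)\<^sup>2 + (Im w)\<^sup>2) / (2 * Im w) < (3/2)^k" 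
    using real_arch_pow[of "3/2" "((Re w)\<^sup>2 + (Im w)\<^sup>2) / (2 * Im w)"] by auto
  define y where "y = (3/2 :: real)^k"
  have y: "y > 0" "(Re w)\<^sup>2 + (Im w)\<^sup>2 < 2 * Im w * y" using k w by (auto simp: y_def field_simps)
  show ?thesis
  proof (rule onto_at_nearby[OF T pow[of k]])
    have "(cmod (w - of_real y * \<i>))\<^sup>2 < y\<^sup>2"
      using y by (simp add: cmod_power2 power2_diff algebra_simps)
    then have "cmod (w - of_real y * \<i>) < y" using y(1) by (simp add: power_less_imp_less_base)
    then show "cmod (w - of_real ((3/2)^k) * \<i>) < \<bar>Im (of_real ((3/2)^k) * \<i>)\<bar>"
      using y(1) by (simp add: y_def)
  qed
qed

lemma onto_at_cnj:
  assumes "cnj_invariant T" "onto_at T z"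
  shows "onto_at T (cnj z)"
  unfolding onto_at_def
proof
  fix f
  obtain u where "(u, cnj_L2 f) \<in> op_shift T (- z)" using assms(2) unfolding onto_at_def by blast
  then have "(cnj_L2 u, cnj_L2 (cnj_L2 f - scaleC_L2 (- z) u)) \<in> T"
    using assms(1) by (simp add: op_shift_iff cnj_invariant_def)
  then have "(cnj_L2 u, f) \<in> op_shift T (- cnj z)"
    by (simp add: op_shift_iff cnj_L2_diff cnj_L2_scaleC)
  then show "\<exists>u. (u, f) \<in> op_shift T (- cnj z)" ..
qed

text \<open>One solvable point, \<open>- \<i>\<close>, is all that the compactness argument
  provides; conjugation supplies \<open>\<i>\<close>, the discs supply the upper half plane, and
  conjugation again the lower one.\<close>

lemma nonreal_in_resolvent_set:
  assumes T: "linear_rel T" "symmetric_rel T" "cnj_invariant T" and i: "onto_at T (- \<i>)" and w: "Im w \<noteq> 0"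
  shows "w \<in> resolvent_set T"
proof (rule onto_at_resolvent_set[OF T(1,2) w])
  have up: "onto_at T z" if "Im z > 0" for z
    by (rule onto_at_upper_half_plane[OF T(1,2) _ that]) (use onto_at_cnj[OF T(3) i] in simp)
  show "onto_at T w"
  proof (cases "Im w > 0")
    case False
    with w have "Im (cnj w) > 0" by simp
    from onto_at_cnj[OF T(3) up[OF this]] show ?thesis by simp
  qed (rule up)
qed

section \<open>Multiplication operators\<close>

lemma linear_rel_mult_operator: "linear_rel (mult_operator V)"
  unfolding linear_rel_def mult_operator_def
proof (intro conjI allI impI; unfold mem_Collect_eq prod.case)
  show "AE x in lebesgue. rep_L2 0 x = of_real (V x) * rep_L2 0 x" using rep_zero by eventually_elim simp
next
  fix u v u' v' :: "'a L2"
  assume "AE x in lebesgue. rep_L2 v x = of_real (V x) * rep_L2 u x"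
    "AE x in lebesgue. rep_L2 v' x = of_real (V x) * rep_L2 u' x"
  with rep_add[of v v'] rep_add[of u u']
  show "AE x in lebesgue. rep_L2 (v + v') x = of_real (V x) * rep_L2 (u + u') x"
    by eventually_elim (simp add: algebra_simps)
next
  fix c and u v :: "'a L2"
  assume "AE x in lebesgue. rep_L2 v x = of_real (V x) * rep_L2 u x"
  with rep_scaleC[of c v] rep_scaleC[of c u]
  show "AE x in lebesgue. rep_L2 (scaleC_L2 c v) x = of_real (V x) * rep_L2 (scaleC_L2 c u) x"
    by eventually_elim simp
qed

lemma symmetric_rel_mult_operator: "symmetric_rel (mult_operator V)"
  unfolding symmetric_rel_def mult_operator_def mem_Collect_eq prod.case inner_rep
proof (intro allI impI)
  fix u v u' v' :: "'a L2"
  assume "AE x in lebesgue. rep_L2 v x = of_real (V x) * rep_L2 u x"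
    "AE x in lebesgue. rep_L2 v' x = of_real (V x) * rep_L2 u' x"
  then have "AE x in lebesgue. rep_L2 v x \<bullet> rep_L2 u' x = rep_L2 u x \<bullet> rep_L2 v' x"
    by eventually_elim (simp add: inner_complex_def algebra_simps)
  then show "(\<integral>x. rep_L2 v x \<bullet> rep_L2 u' x \<partial>lebesgue) = (\<integral>x. rep_L2 u x \<bullet> rep_L2 v' x \<partial>lebesgue)"
    by (intro integral_cong_AE) measurable
qed

lemma cnj_invariant_mult_operator: "cnj_invariant (mult_operator V)"
  unfolding cnj_invariant_def mult_operator_def mem_Collect_eq prod.case
proof (intro allI impI)
  fix u v :: "'a L2"
  assume "AE x in lebesgue. rep_L2 v x = of_real (V x) * rep_L2 u x"
  with rep_cnj[of v] rep_cnj[of u]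
  show "AE x in lebesgue. rep_L2 (cnj_L2 v) x = of_real (V x) * rep_L2 (cnj_L2 u) x"
    by eventually_elim simp
qed

lemma mult_operator_unique:
  assumes "(u, v) \<in> mult_operator V" "(u, v') \<in> mult_operator V"
  shows "v = v'"
proof (rule L2_eqI)
  show "AE x in lebesgue. rep_L2 v x = rep_L2 v' x"
    using assms unfolding mult_operator_def mem_Collect_eq prod.case by eventually_elim simp
qed

section \<open>Relatively compact perturbations\<close>

text \<open>Totality of \<open>graph_of K\<close> says that every \<open>g\<close> equals
  \<open>(T + \<i>) u\<close> for some \<open>u\<close> with \<open>V u = K g\<close>, so
  \<open>1 + K\<close> is the operator \<open>T + V + \<i>\<close> written in the variable
  \<open>g\<close>. The point is \<open>- \<i>\<close> because \<open>onto_at\<close> concerns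
  \<open>T - z\<close>.\<close>

lemma onto_at_relatively_compact:
  assumes T: "linear_rel T" "symmetric_rel T"
    and K: "converse (op_shift T \<i>) O mult_operator V = graph_of K" "bounded_clinear K"
      "compact (closure (K ` cball 0 1))"
  shows "onto_at (op_plus T (mult_operator V)) (- \<i>)"
  unfolding onto_at_def
proof
  fix f
  define S where "S = op_plus T (mult_operator V)"
  have S: "linear_rel S" "symmetric_rel S"
    unfolding S_def by (intro linear_rel_op_plus T linear_rel_mult_operator
        symmetric_rel_op_plus symmetric_rel_mult_operator)+
  have ex: "\<exists>u. (u, g) \<in> op_shift T \<i> \<and> (u, K g) \<in> mult_operator V" for g
  proof -
    have "(g, K g) \<in> converse (op_shift T \<i>) O mult_operator V" unfolding K(1) graph_of_def by blast
    then show ?thesis by auto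
  qed
  have toS: "(u, g + K g) \<in> op_shift S \<i>" if "(u, g) \<in> op_shift T \<i>" "(u, K g) \<in> mult_operator V" for u g
  proof -
    have "(u, (g - scaleC_L2 \<i> u) + K g) \<in> S"
      unfolding S_def op_plus_def using that unfolding op_shift_iff by blast
    then show ?thesis by (simp add: op_shift_iff algebra_simps)
  qed
  interpret compact_perturbation K
  proof (rule compact_perturbation.intro)
    fix g assume g: "g + K g = 0"
    obtain u where u: "(u, g) \<in> op_shift T \<i>" "(u, K g) \<in> mult_operator V" using ex by blast
    \<comment> \<open>Here \<open>u\<close> is a null vector of \<open>T + V + \<i>\<close>; the
      double negation only matches the form of \<open>symmetric_rel_lower_bound\<close>. From
      \<open>u = 0\<close> follow \<open>K g = V u = 0\<close> and then
      \<open>g = 0\<close>.\<close>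
    have "(u, 0) \<in> op_shift S (- (- \<i>))" using toS[OF u] g by simp
    from symmetric_rel_lower_bound[OF S this] have "u = 0" by simp
    with u(2) have "K g = 0"
      using mult_operator_unique linear_relD(1)[OF linear_rel_mult_operator] by blast
    with g show "g = 0" by simp
  qed (use K bounded_clinear_def in \<open>blast+\<close>)
  obtain g where g: "f = g + K g" using surj_T unfolding T_def by (metis surjD)
  obtain u where "(u, g) \<in> op_shift T \<i>" "(u, K g) \<in> mult_operator V" using ex by blast
  from toS[OF this] g show "\<exists>u. (u, f) \<in> op_shift (op_plus T (mult_operator V)) (- (- \<i>))"
    by (auto simp: S_def)
qed

text \<open>As \<open>(T + \<i>) (e n) = h n + (lam + \<i>) (e n)\<close>, one has
  \<open>V (e n) = K (h n) + (lam + \<i>) K (e n)\<close>, which tends to 0 along a subsequence. A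
  bounded resolvent would then send a null sequence to unit vectors.\<close>

lemma singular_sequence_in_spectrum:
  fixes V :: "'a::euclidean_space \<Rightarrow> real"
  assumes T: "linear_rel T" "symmetric_rel T"
    and K: "converse (op_shift T \<i>) O mult_operator V = graph_of K" "bounded_clinear K"
      "compact (closure (K ` cball 0 1))"
    and e: "\<And>n. norm (e n) = 1" "\<And>i j. i \<noteq> j \<Longrightarrow> e i \<bullet> e j = 0"
    and h: "\<And>n::nat. (e n, h n) \<in> op_shift T (- of_real lam)" "h \<longlonglongrightarrow> 0"
  shows "of_real lam \<in> spectrum (op_plus T (mult_operator V))"
proof (rule ccontr)
  assume "\<not> ?thesis"
  then obtain R where R: "bounded_clinear R"
    "converse (op_shift (op_plus T (mult_operator V)) (- of_real lam)) = graph_of R"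
    unfolding spectrum_def resolvent_set_def by auto
  interpret R: bounded_linear R using R(1) by (simp add: bounded_clinear_def)
  interpret K: bounded_linear K using K(2) by (simp add: bounded_clinear_def)
  have Kc: "K (scaleC_L2 c u) = scaleC_L2 c (K u)" for c u using K(2) by (simp add: bounded_clinear_def)
  define z where "z = of_real lam + \<i>"
  define w where "w n = K (h n) + scaleC_L2 z (K (e n))" for n
  have w: "(e n, w n) \<in> mult_operator V" for n
  proof -
    define f where "f = h n + scaleC_L2 z (e n)"
    have "w n = K f" by (simp add: w_def f_def K.add Kc)
    moreover have "(f, K f) \<in> converse (op_shift T \<i>) O mult_operator V" unfolding K(1) graph_of_def by blast
    then obtain u where u: "(u, f) \<in> op_shift T \<i>" "(u, K f) \<in> mult_operator V" by auto
    have "(e n, f) \<in> op_shift T \<i>"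
      using h(1)[of n] by (simp add: op_shift_iff f_def z_def scaleC_add_left scaleC_minus_left algebra_simps)
    \<comment> \<open>Uniqueness for \<open>T + \<i>\<close> identifies the intermediate vector
      \<open>u\<close> of the relational composition with \<open>e n\<close>; in particular
      \<open>e n\<close> lies in the domain of \<open>V\<close>.\<close>
    from linear_relD(4)[OF linear_rel_op_shift[OF T(1)] this u(1)] have "(e n - u, 0) \<in> op_shift T (- (- \<i>))" by simp
    from symmetric_rel_lower_bound[OF T this] have "e n = u" by simp
    ultimately show ?thesis using u(2) by simp
  qed
  have "(e n, h n + w n) \<in> op_shift (op_plus T (mult_operator V)) (- of_real lam)" for n
  proof -
    have "(e n, (h n - scaleC_L2 (- of_real lam) (e n)) + w n) \<in> op_plus T (mult_operator V)"
      using h(1)[of n] w[of n] unfolding op_plus_def op_shift_iff by blast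
    then show ?thesis by (simp add: op_shift_iff algebra_simps)
  qed
  then have "(h n + w n, e n) \<in> graph_of R" for n using R(2) by blast
  then have eR: "e n = R (h n + w n)" for n by (simp add: graph_of_def)
  obtain r where r: "strict_mono (r :: nat \<Rightarrow> nat)" "(\<lambda>n. K (e (r n))) \<longlonglongrightarrow> 0"
    using compact_orthonormal_subseq[where e = e, OF K.bounded_linear_axioms K(3) e] by blast
  have hr: "(\<lambda>n. h (r n)) \<longlonglongrightarrow> 0" using LIMSEQ_subseq_LIMSEQ[OF h(2) r(1)] by (simp add: o_def)
  have "(\<lambda>n. R (h (r n) + (K (h (r n)) + scaleC_L2 z (K (e (r n)))))) \<longlonglongrightarrow> R (0 + (K 0 + scaleC_L2 z 0))"
    by (intro R.tendsto tendsto_add K.tendsto hr bounded_linear.tendsto[OF bounded_linear_scaleC] r(2))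
  then have "(\<lambda>n. e (r n)) \<longlonglongrightarrow> 0"
    unfolding w_def[symmetric] eR[symmetric] by (simp add: R.zero K.zero)
  then have "(\<lambda>n. norm (e (r n))) \<longlonglongrightarrow> 0" by (rule tendsto_norm_zero)
  then show False by (simp add: e(1) LIMSEQ_const_iff)
qed

section \<open>Functions of class \<open>C\<^sup>k\<close>\<close>

lemma C_k_SucI:
  assumes "\<And>x. (f has_derivative f' x) (at x)" "\<And>b. b \<in> Basis \<Longrightarrow> C_k k (\<lambda>x. f' x b)"
  shows "C_k (Suc k) f"
proof -
  have "frechet_derivative f (at x) = f' x" for x
    using frechet_derivative_at[OF assms(1)] by simp
  then show ?thesis using assms by (auto simp: differentiable_def)
qed

lemma C_k_SucD:
  assumes "C_k (Suc k) f"
  shows "(f has_derivative frechet_derivative f (at x)) (at x)"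
    "b \<in> Basis \<Longrightarrow> C_k k (\<lambda>x. frechet_derivative f (at x) b)"
  using assms unfolding C_k.simps frechet_derivative_works by blast+

lemma C_k_mono: "C_k (Suc k) f \<Longrightarrow> C_k k f"
proof (induction k arbitrary: f)
  case 0
  then show ?case
    by (auto intro!: continuous_at_imp_continuous_on differentiable_imp_continuous_within)
qed auto

lemma C_k_const: "C_k k (\<lambda>x. c)"
proof (induction k arbitrary: c)
  case (Suc k)
  show ?case by (rule C_k_SucI[where f' = "\<lambda>x b. 0"]) (use Suc in auto)
qed auto

lemma C_k_add: "C_k k f \<Longrightarrow> C_k k g \<Longrightarrow> C_k k (\<lambda>x. f x + g x)"
proof (induction k arbitrary: f g)
  case 0
  then show ?case by (simp add: continuous_on_add)
next
  case (Suc k)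
  note f = C_k_SucD[OF Suc.prems(1)] and g = C_k_SucD[OF Suc.prems(2)]
  show ?case by (rule C_k_SucI[OF has_derivative_add[OF f(1) g(1)]]) (intro Suc.IH f g)
qed

lemma C_k_mult: "C_k k f \<Longrightarrow> C_k k g \<Longrightarrow> C_k k (\<lambda>x. f x * g x)"
proof (induction k arbitrary: f g)
  case 0
  then show ?case by (simp add: continuous_on_mult)
next
  case (Suc k)
  note f = C_k_SucD[OF Suc.prems(1)] and g = C_k_SucD[OF Suc.prems(2)]
  show ?case by (rule C_k_SucI[OF has_derivative_mult[OF f(1) g(1)]])
      (intro C_k_add Suc.IH f g C_k_mono[OF Suc.prems(1)] C_k_mono[OF Suc.prems(2)])
qed

lemma C_k_prod: "(\<And>i. i \<in> I \<Longrightarrow> C_k k (f i)) \<Longrightarrow> C_k k (\<lambda>x. \<Prod>i\<in>I. f i x)"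
proof (induction I rule: infinite_finite_induct)
  case (insert i I)
  then have "C_k k (\<lambda>x. f i x * (\<Prod>i\<in>I. f i x))" by (intro C_k_mult) blast+
  with insert show ?case by simp
qed (use C_k_const[of k 1] in simp_all)

lemma frechet_derivative_cnj:
  assumes "f differentiable (at x)"
  shows "((\<lambda>x. cnj (f x)) has_derivative (\<lambda>b. cnj (frechet_derivative f (at x) b))) (at x)"
  using bounded_linear.has_derivative[OF bounded_linear_cnj assms[unfolded frechet_derivative_works]] .

lemma C_k_cnj: "C_k k f \<Longrightarrow> C_k k (\<lambda>x. cnj (f x))"
proof (induction k arbitrary: f)
  case 0
  then show ?case by (simp add: continuous_on_cnj)
next
  case (Suc k)
  show ?case
    by (rule C_k_SucI[OF frechet_derivative_cnj]) (use Suc in auto)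
qed

lemma frechet_derivative_translate:
  assumes "\<And>x. f differentiable (at x)"
  shows "((\<lambda>x. f (x + a)) has_derivative frechet_derivative f (at (x + a))) (at x)"
proof -
  have "(f has_derivative frechet_derivative f (at (x + a))) (at (x + a))"
    using assms frechet_derivative_works by blast
  moreover have "((\<lambda>x. x + a) has_derivative (\<lambda>x. x)) (at x)" by (auto intro!: derivative_eq_intros)
  ultimately show ?thesis
    using has_derivative_compose[of "\<lambda>x. x + a" "\<lambda>x. x" x UNIV f] by blast
qed

lemma C_k_translate: "C_k k f \<Longrightarrow> C_k k (\<lambda>x. f (x + a))"
proof (induction k arbitrary: f)
  case 0
  then have "continuous_on UNIV f" by simp
  then show ?case by (auto intro!: continuous_on_compose2[of UNIV f] continuous_intros)
next
  case (Suc k)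
  show ?case
    by (rule C_k_SucI[OF frechet_derivative_translate]) (use Suc in auto)
qed

section \<open>A smooth function vanishing on a half-line\<close>

text \<open>\<open>flat 1\<close> is the classical smooth function \<open>exp (- 1 / t)\<close>
  extended by 0. Admitting a polynomial in \<open>1 / t\<close> as a factor makes the family closed
  under differentiation.\<close>

definition flat :: "real poly \<Rightarrow> real \<Rightarrow> real" where
  "flat p t = (if t > 0 then poly p (1 / t) * exp (- (1 / t)) else 0)"

lemma tendsto_poly_exp: "((\<lambda>s. poly p s * exp (- s)) \<longlongrightarrow> 0) (at_top :: real filter)"
proof -
  have "((\<lambda>s. \<Sum>i\<le>degree p. coeff p i * (s ^ i / exp s)) \<longlongrightarrow> (\<Sum>i\<le>degree p. coeff p i * 0)) (at_top :: real filter)"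
    by (intro tendsto_sum tendsto_mult tendsto_const tendsto_power_div_exp_0)
  then show ?thesis by (simp add: poly_altdef sum_distrib_right exp_minus divide_inverse mult.assoc)
qed

lemma tendsto_flat_0: "(flat p \<longlongrightarrow> 0) (at 0)"
proof -
  have "(flat p \<longlongrightarrow> 0) (at_left 0)"
    by (rule Lim_transform_eventually[OF tendsto_const])
       (auto simp: flat_def eventually_at_left_real eventually_at intro!: exI[of _ 1])
  moreover have "(flat p \<longlongrightarrow> 0) (at_right 0)"
  proof (rule Lim_transform_eventually)
    show "((\<lambda>t. poly p (1 / t) * exp (- (1 / t))) \<longlongrightarrow> 0) (at_right 0)"
      using filterlim_compose[OF tendsto_poly_exp filterlim_inverse_at_top_right, of p]
      by (simp add: inverse_eq_divide)
    show "\<forall>\<^sub>F t in at_right 0. poly p (1 / t) * exp (- (1 / t)) = flat p t"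
      by (auto simp: flat_def eventually_at intro!: exI[of _ 1])
  qed
  ultimately show ?thesis by (simp add: filterlim_at_split)
qed

text \<open>Differentiating \<open>p (1 / t) exp (- 1 / t)\<close> produces
  \<open>(1 / t)^2 (p - p') (1 / t) exp (- 1 / t)\<close>; each \<open>pCons 0\<close> multiplies
  the polynomial by its variable.\<close>

lemma flat_deriv: "(flat p has_real_derivative flat (pCons 0 (pCons 0 (p - pderiv p))) t) (at t)"
proof -
  let ?q = "pCons 0 (pCons 0 (p - pderiv p))"
  consider "t > 0" | "t < 0" | "t = 0" by linarith
  then show ?thesis
  proof cases
    case 1
    have "((\<lambda>t. poly p (1 / t) * exp (- (1 / t))) has_real_derivative flat ?q t) (at t)"
      using 1 by (auto intro!: derivative_eq_intros DERIV_chain2[OF poly_DERIV]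
          simp: flat_def field_simps power2_eq_square)
    then show ?thesis
      by (rule has_field_derivative_transform_within_open[where S = "{0<..}"]) (use 1 in \<open>auto simp: flat_def\<close>)
  next
    case 2
    have "((\<lambda>t. 0) has_real_derivative flat ?q t) (at t)" using 2 by (simp add: flat_def)
    then show ?thesis
      by (rule has_field_derivative_transform_within_open[where S = "{..<0}"]) (use 2 in \<open>auto simp: flat_def\<close>)
  next
    case 3
    \<comment> \<open>At the origin the difference quotient is again a member of the family, with
      \<open>p\<close> multiplied by the variable, so the limit already known applies.\<close>
    have "flat (pCons 0 p) s = flat p s / s" if "s \<noteq> 0" for s using that by (simp add: flat_def)
    then have "((\<lambda>s. flat p s / s) \<longlongrightarrow> 0) (at 0)"
      by (intro Lim_transform_eventually[OF tendsto_flat_0[of "pCons 0 p"]]) (auto simp: eventually_at intro!: exI[of _ 1])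
    then show ?thesis using 3 by (simp add: has_field_derivative_iff flat_def)
  qed
qed

lemma flat_1: "flat 1 t = (if t > 0 then exp (- (1 / t)) else 0)"
  by (simp add: flat_def)

lemma flat_1_bounds: "0 \<le> flat 1 t" "flat 1 t \<le> 1" "t \<le> 0 \<Longrightarrow> flat 1 t = 0"
  by (auto simp: flat_1)

lemma flat_scaled_tendsto:
  "(\<lambda>n. flat 1 (real (Suc n) * t)) \<longlonglongrightarrow> (if t > 0 then 1 else 0)"
proof (cases "t > 0")
  case True
  have "(\<lambda>n. exp (- (inverse (real (Suc n)) * (1 / t)))) \<longlonglongrightarrow> exp (- (0 * (1 / t)))"
    by (intro tendsto_intros LIMSEQ_inverse_real_of_nat)
  moreover have "flat 1 (real (Suc n) * t) = exp (- (inverse (real (Suc n)) * (1 / t)))" for n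
    using True by (simp add: flat_1 inverse_eq_divide del: of_nat_Suc)
  ultimately show ?thesis using True by simp
next
  case False
  then have "real (Suc n) * t \<le> 0" for n by (intro mult_nonneg_nonpos) auto
  with False show ?thesis by (simp add: flat_1_bounds(3) del: of_nat_Suc)
qed

text \<open>The polynomial is kept general because each derivative changes it.\<close>

lemma C_k_flat:
  fixes b :: "'a::euclidean_space"
  shows "C_k k (\<lambda>x. complex_of_real (flat p (r * (x \<bullet> b) + s)))"
proof (induction k arbitrary: p)
  case 0
  have "continuous_on UNIV (flat p)"
    using flat_deriv DERIV_isCont by (blast intro: continuous_at_imp_continuous_on)
  then show ?case by (auto intro!: continuous_intros continuous_on_compose2[of UNIV "flat p"])
next
  case (Suc k)
  let ?q = "pCons 0 (pCons 0 (p - pderiv p))"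
  show ?case
  proof (rule C_k_SucI)
    show "((\<lambda>x. complex_of_real (flat p (r * (x \<bullet> b) + s))) has_derivative
        (\<lambda>c. complex_of_real (flat ?q (r * (x \<bullet> b) + s)) * complex_of_real (r * (c \<bullet> b)))) (at x)" for x
      by (rule has_derivative_eq_rhs, rule has_derivative_of_real,
          rule has_derivative_compose[OF _ flat_deriv[unfolded has_field_derivative_def]])
         (auto intro!: derivative_eq_intros)
    show "C_k k (\<lambda>x. complex_of_real (flat ?q (r * (x \<bullet> b) + s)) * complex_of_real (r * (c \<bullet> b)))" for c
      by (intro C_k_mult Suc C_k_const)
  qed
qed

section \<open>Compactly supported functions\<close>

lemma compact_support_iff:
  fixes f :: "'a::euclidean_space \<Rightarrow> 'b::zero"
  shows "compact (closure {x. f x \<noteq> 0}) \<longleftrightarrow> (\<exists>R. \<forall>x. norm x > R \<longrightarrow> f x = 0)"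
proof
  assume "compact (closure {x. f x \<noteq> 0})"
  then obtain R where "\<forall>x\<in>{x. f x \<noteq> 0}. norm x \<le> R" by (auto simp: bounded_iff)
  then show "\<exists>R. \<forall>x. norm x > R \<longrightarrow> f x = 0" by (intro exI[of _ R]) force
next
  assume "\<exists>R. \<forall>x. norm x > R \<longrightarrow> f x = 0"
  then obtain R where "\<forall>x. norm x > R \<longrightarrow> f x = 0" by blast
  then have "{x. f x \<noteq> 0} \<subseteq> cball 0 R" by (auto simp: not_less[symmetric])
  then show "compact (closure {x. f x \<noteq> 0})" using bounded_subset[OF bounded_cball, of _ 0 R] by simp
qed

lemma continuous_borel_lebesgue:
  fixes f :: "'a::euclidean_space \<Rightarrow> 'b::topological_space"
  shows "continuous_on UNIV f \<Longrightarrow> f \<in> borel_measurable lebesgue"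
  using borel_measurable_continuous_onI[of f] by (simp add: measurable_completion)

lemma integrable_compact_support:
  fixes f :: "'a::euclidean_space \<Rightarrow> 'b::euclidean_space"
  assumes "continuous_on UNIV f" "\<And>x. norm x > R \<Longrightarrow> f x = 0"
  shows "integrable lebesgue f"
proof -
  have "integrable lborel (\<lambda>x. indicator (cball 0 R) x *\<^sub>R f x)"
    by (rule borel_integrable_compact) (auto intro: continuous_on_subset[OF assms(1)])
  moreover have "(\<lambda>x. indicator (cball 0 R) x *\<^sub>R f x) = f"
    using assms(2) by (auto simp: fun_eq_iff indicator_def)
  ultimately show ?thesis
    using borel_measurable_continuous_onI[OF assms(1)] by (simp add: integrable_completion)
qed

lemma square_integrable_compact_support:
  assumes "continuous_on UNIV f" "\<And>x. norm x > R \<Longrightarrow> f x = 0"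
  shows "square_integrable f"
  unfolding square_integrable_def
  by (intro conjI continuous_borel_lebesgue integrable_compact_support[of _ R] continuous_intros assms)
     (use assms(2) in auto)

lemma bounded_compact_support:
  fixes f :: "'a::euclidean_space \<Rightarrow> 'b::real_normed_vector"
  assumes "continuous_on UNIV f" "\<And>x. norm x > R \<Longrightarrow> f x = 0"
  obtains M where "M \<ge> 0" "\<And>x. norm (f x) \<le> M"
proof -
  have "compact (f ` cball 0 R)"
    by (intro compact_continuous_image continuous_on_subset[OF assms(1)]) auto
  then obtain M where M: "\<And>y. y \<in> f ` cball 0 R \<Longrightarrow> norm y \<le> M"
    using compact_imp_bounded bounded_iff by metis
  have "norm (f x) \<le> max M 0" for x
  proof (cases "norm x \<le> R")
    case True
    then have "f x \<in> f ` cball 0 R" by simp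
    from M[OF this] show ?thesis by simp
  qed (simp add: assms(2))
  then show thesis by (intro that[of "max M 0"]) auto
qed

subsection \<open>Translations\<close>

lemma lebesgue_translation:
  fixes a :: "'a::euclidean_space"
  shows "(\<lambda>x. x + a) \<in> lebesgue \<rightarrow>\<^sub>M lebesgue" "distr lebesgue lebesgue (\<lambda>x. x + a) = lebesgue"
proof -
  have T: "(\<lambda>x. a + (\<Sum>j\<in>Basis. (1 * (x \<bullet> j)) *\<^sub>R j)) = (\<lambda>x. x + a)"
    by (simp add: euclidean_representation add.commute)
  show "(\<lambda>x. x + a) \<in> lebesgue \<rightarrow>\<^sub>M lebesgue"
    using lebesgue_affine_measurable[of "\<lambda>_. 1" a] unfolding T by simp
  show "distr lebesgue lebesgue (\<lambda>x. x + a) = lebesgue"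
    using lebesgue_affine_euclidean[of "\<lambda>_. 1" a] unfolding T by (simp add: density_1)
qed

lemma measurable_lebesgue_translate:
  fixes a :: "'a::euclidean_space"
  shows "f \<in> borel_measurable lebesgue \<Longrightarrow> (\<lambda>x. f (x + a)) \<in> borel_measurable lebesgue"
  by (rule measurable_compose[OF lebesgue_translation(1)])

lemma integral_lebesgue_translate:
  fixes f :: "'a::euclidean_space \<Rightarrow> 'b::{banach, second_countable_topology}"
  assumes "f \<in> borel_measurable lebesgue"
  shows "(\<integral>x. f (x + a) \<partial>lebesgue) = (\<integral>x. f x \<partial>lebesgue)"
  using integral_distr[OF lebesgue_translation(1) assms, of a] unfolding lebesgue_translation(2) by (rule sym)

lemma integrable_lebesgue_translate:
  fixes f :: "'a::euclidean_space \<Rightarrow> 'b::{banach, second_countable_topology}"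
  assumes "integrable lebesgue f"
  shows "integrable lebesgue (\<lambda>x. f (x + a))"
  using integrable_distr[OF lebesgue_translation(1)[of a], where f = f] assms
  unfolding lebesgue_translation(2) by blast

lemma AE_lebesgue_translate:
  fixes a :: "'a::euclidean_space"
  assumes "AE x in lebesgue. P x"
  shows "AE x in lebesgue. P (x + a)"
proof -
  have "AE x in distr lebesgue lebesgue (\<lambda>x. x + a). P x"
    unfolding lebesgue_translation(2) by (rule assms)
  then show ?thesis by (rule AE_distrD[OF lebesgue_translation(1)])
qed

section \<open>Integrals of directional derivatives\<close>

lemma norm_diff_le_of_line_derivative:
  fixes f :: "'a::euclidean_space \<Rightarrow> 'b::real_normed_vector"
  assumes der: "\<And>x. ((\<lambda>t. f (x + t *\<^sub>R b)) has_vector_derivative f' x) (at 0)"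
    and M: "\<And>x. norm (f' x) \<le> M"
  shows "norm (f (x + t *\<^sub>R b) - f x) \<le> M * \<bar>t\<bar>"
proof -
  \<comment> \<open>The hypothesis gives derivatives only at parameter 0, but for every base point;
    moving the base point to \<open>x + s b\<close> covers the parameter \<open>s\<close>.\<close>
  have der': "((\<lambda>s. f (x + s *\<^sub>R b)) has_vector_derivative f' (x + s *\<^sub>R b)) (at s)" for s
  proof -
    have "((\<lambda>t. t - s) has_vector_derivative 1) (at s)"
      by (auto simp: has_vector_derivative_def intro!: derivative_eq_intros)
    then have "((\<lambda>t. f ((x + s *\<^sub>R b) + (t - s) *\<^sub>R b)) has_vector_derivative 1 *\<^sub>R f' (x + s *\<^sub>R b)) (at s)"
      using vector_diff_chain_at[of "\<lambda>t. t - s" 1 s "\<lambda>t. f ((x + s *\<^sub>R b) + t *\<^sub>R b)" "f' (x + s *\<^sub>R b)"]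
        der[of "x + s *\<^sub>R b"]
      by (simp add: o_def)
    then show ?thesis by (simp add: algebra_simps)
  qed
  have "norm (f (x + t *\<^sub>R b) - f (x + 0 *\<^sub>R b)) \<le> M * norm (t - 0)"
  proof (rule differentiable_bound[where S = UNIV and f' = "\<lambda>s h. h *\<^sub>R f' (x + s *\<^sub>R b)"])
    show "((\<lambda>s. f (x + s *\<^sub>R b)) has_derivative (\<lambda>h. h *\<^sub>R f' (x + s *\<^sub>R b))) (at s within UNIV)" for s
      using der'[of s] by (simp add: has_vector_derivative_def)
    show "onorm (\<lambda>h. h *\<^sub>R f' (x + s *\<^sub>R b)) \<le> M" for s
      using M[of "x + s *\<^sub>R b"] by (intro onorm_le) (simp add: mult.commute[of M] mult_left_mono)
  qed auto
  then show ?thesis by simp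
qed

text \<open>Integration by parts without Fubini: the difference quotients of \<open>f\<close> have
  integral 0 by translation invariance, and they converge to \<open>f'\<close> while bounded by a
  bound of \<open>f'\<close> on a fixed ball.\<close>

lemma integral_line_derivative_eq_0:
  fixes f :: "'a::euclidean_space \<Rightarrow> complex"
  assumes der: "\<And>x. ((\<lambda>t. f (x + t *\<^sub>R b)) has_vector_derivative f' x) (at 0)"
    and cont: "continuous_on UNIV f" "continuous_on UNIV f'"
    and supp: "\<And>x. norm x > R \<Longrightarrow> f x = 0" "\<And>x. norm x > R \<Longrightarrow> f' x = 0"
  shows "(\<integral>x. f' x \<partial>lebesgue) = 0"
proof -
  define q where "q n x = real (Suc n) *\<^sub>R (f (x + inverse (real (Suc n)) *\<^sub>R b) - f x)" for n x
  obtain M where M: "M \<ge> 0" "\<And>x. norm (f' x) \<le> M" using bounded_compact_support[OF cont(2) supp(2)] by blast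
  have int_f: "integrable lebesgue f" by (rule integrable_compact_support[OF cont(1) supp(1)])
  have meas_f: "f \<in> borel_measurable lebesgue" by (rule continuous_borel_lebesgue[OF cont(1)])
  have q0: "(\<integral>x. q n x \<partial>lebesgue) = 0" for n
    unfolding q_def using integrable_lebesgue_translate[OF int_f] int_f
    by (simp add: Bochner_Integration.integral_diff integral_lebesgue_translate[OF meas_f])
  have "(\<lambda>n. \<integral>x. q n x \<partial>lebesgue) \<longlonglongrightarrow> (\<integral>x. f' x \<partial>lebesgue)"
  proof (rule integral_dominated_convergence)
    show "f' \<in> borel_measurable lebesgue" by (rule continuous_borel_lebesgue[OF cont(2)])
    show "q n \<in> borel_measurable lebesgue" for n
      unfolding q_def using meas_f measurable_lebesgue_translate[OF meas_f] by measurable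
    \<comment> \<open>The shifts have length at most \<open>norm b\<close>, so all difference
      quotients vanish outside this enlarged ball.\<close>
    show "integrable lebesgue (\<lambda>x. M * indicator (cball 0 (\<bar>R\<bar> + norm b) :: 'a set) x)"
      using emeasure_lborel_cball_finite[of "0::'a" "\<bar>R\<bar> + norm b"]
      by (intro integrable_mult_right integrable_real_indicator) (auto simp: less_top)
    show "AE x in lebesgue. (\<lambda>n. q n x) \<longlonglongrightarrow> f' x"
    proof (rule AE_I2)
      fix x
      have "((\<lambda>t. f (x + t *\<^sub>R b)) has_derivative (\<lambda>h. h *\<^sub>R f' x)) (at 0)"
        using der[of x] by (simp add: has_vector_derivative_def)
      then have lim: "((\<lambda>h. norm (f (x + (0 + h) *\<^sub>R b) - f (x + 0 *\<^sub>R b) - h *\<^sub>R f' x) / norm h) \<longlongrightarrow> 0) (at 0)"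
        unfolding has_derivative_at by (rule conjunct2)
      have seq: "filterlim (\<lambda>n. inverse (real (Suc n))) (at 0) sequentially"
        unfolding filterlim_at using LIMSEQ_inverse_real_of_nat by auto
      have "norm (q n x - f' x) = norm (f (x + (0 + inverse (real (Suc n))) *\<^sub>R b) - f (x + 0 *\<^sub>R b)
          - inverse (real (Suc n)) *\<^sub>R f' x) / norm (inverse (real (Suc n)))" for n
      proof -
        have "q n x - f' x = real (Suc n) *\<^sub>R (f (x + inverse (real (Suc n)) *\<^sub>R b) - f x
            - inverse (real (Suc n)) *\<^sub>R f' x)"
          by (simp add: q_def scaleR_diff_right del: of_nat_Suc)
        then show ?thesis by (simp add: divide_inverse mult.commute del: of_nat_Suc)
      qed
      with filterlim_compose[OF lim seq] have "(\<lambda>n. norm (q n x - f' x)) \<longlonglongrightarrow> 0" by simp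
      then have "(\<lambda>n. q n x - f' x) \<longlonglongrightarrow> 0" by (rule tendsto_norm_zero_cancel)
      then show "(\<lambda>n. q n x) \<longlonglongrightarrow> f' x" by (rule LIM_zero_cancel)

    qed
    show "AE x in lebesgue. norm (q n x) \<le> M * indicator (cball 0 (\<bar>R\<bar> + norm b) :: 'a set) x" for n
    proof (rule AE_I2)
      fix x
      show "norm (q n x) \<le> M * indicator (cball 0 (\<bar>R\<bar> + norm b) :: 'a set) x"
      proof (cases "norm x \<le> \<bar>R\<bar> + norm b")
        case True
        have "norm (f (x + inverse (real (Suc n)) *\<^sub>R b) - f x) \<le> M * \<bar>inverse (real (Suc n))\<bar>"
          by (rule norm_diff_le_of_line_derivative[OF der M(2)])
        then have "norm (q n x) \<le> real (Suc n) * (M * \<bar>inverse (real (Suc n))\<bar>)"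
          unfolding q_def norm_scaleR abs_of_nat by (rule mult_left_mono) simp
        also have "\<dots> = M" by simp
        finally have "norm (q n x) \<le> M" .
        then show ?thesis using True by (simp add: indicator_def)
      next
        case False
        have "norm (inverse (real (Suc n)) *\<^sub>R b) \<le> norm b"
          unfolding norm_scaleR by (rule mult_left_le_one_le) (simp_all add: inverse_le_1_iff)
        then have "norm (x + inverse (real (Suc n)) *\<^sub>R b) > \<bar>R\<bar>"
          using norm_triangle_ineq4[of "x + inverse (real (Suc n)) *\<^sub>R b" "inverse (real (Suc n)) *\<^sub>R b"] False
          by (simp only: add_diff_cancel_right')
        moreover have "norm x > R" using False norm_ge_zero[of b] by linarith
        ultimately have "q n x = 0" using supp(1) by (simp add: q_def)
        then show ?thesis using M(1) by (simp add: indicator_def)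
      qed
    qed
  qed
  then show ?thesis by (simp add: q0 LIMSEQ_const_iff)
qed

section \<open>Test functions\<close>

abbreviation dir_deriv :: "'a \<Rightarrow> ('a::euclidean_space \<Rightarrow> complex) \<Rightarrow> 'a \<Rightarrow> complex" where
  "dir_deriv b f x \<equiv> frechet_derivative f (at x) b"

lemma test_functionD:
  assumes "test_function \<phi>"
  shows "C_k k \<phi>" "continuous_on UNIV \<phi>" "\<phi> differentiable (at x)"
    "(\<phi> has_derivative frechet_derivative \<phi> (at x)) (at x)"
proof -
  show a: "C_k k \<phi>" for k using assms by (simp add: test_function_def)
  show "continuous_on UNIV \<phi>" using a[of 0] by simp
  show "\<phi> differentiable (at x)" using a[of "Suc 0"] by simp
  then show "(\<phi> has_derivative frechet_derivative \<phi> (at x)) (at x)" by (simp add: frechet_derivative_works)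
qed

lemma test_function_support:
  assumes "test_function \<phi>"
  shows "\<exists>R\<ge>0. \<forall>x. norm x > R \<longrightarrow> \<phi> x = 0 \<and> (\<forall>b. dir_deriv b \<phi> x = 0)"
proof -
  obtain R where R: "\<And>x. norm x > R \<Longrightarrow> \<phi> x = 0"
    using assms unfolding test_function_def compact_support_iff by auto
  have "dir_deriv b \<phi> x = 0" if x: "norm x > R" for x b
  proof -
    have "open {x :: 'a. norm x > R}" by (intro open_Collect_less continuous_intros)
    then have "(\<phi> has_derivative (\<lambda>b. 0)) (at x)"
      using has_derivative_transform_within_open[OF has_derivative_const[of 0 "at x"], of "{x. norm x > R}" \<phi>] x R
      by auto
    from fun_cong[OF frechet_derivative_at[OF this], of b] show ?thesis by (rule sym)
  qed
  with R show ?thesis by (intro exI[of _ "\<bar>R\<bar>"]) auto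
qed

lemma test_functionI:
  assumes "\<And>k. C_k k \<phi>" "\<And>x. norm x > R \<Longrightarrow> \<phi> x = 0"
  shows "test_function \<phi>"
  unfolding test_function_def compact_support_iff
  by (intro conjI allI exI[of _ R] impI assms)

lemma square_integrable_test_function:
  assumes "test_function \<phi>"
  shows "square_integrable \<phi>"
proof -
  obtain R where R: "\<And>x. norm x > R \<Longrightarrow> \<phi> x = 0" using test_function_support[OF assms] by blast
  show ?thesis by (rule square_integrable_compact_support[OF test_functionD(2)[OF assms] R])
qed

lemma test_function_partial:
  assumes "test_function \<phi>" "b \<in> Basis"
  shows "test_function (\<lambda>x. dir_deriv b \<phi> x)"
proof -
  obtain R where R: "\<And>x b. norm x > R \<Longrightarrow> dir_deriv b \<phi> x = 0"
    using test_function_support[OF assms(1)] by blast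
  have "C_k k (\<lambda>x. dir_deriv b \<phi> x)" for k
    using test_functionD(1)[OF assms(1), of "Suc k"] assms(2) by simp
  then show ?thesis by (rule test_functionI[where R = R]) (rule R)
qed

lemma test_function_cnj:
  assumes "test_function \<phi>"
  shows "test_function (\<lambda>x. cnj (\<phi> x))"
    "frechet_derivative (\<lambda>x. cnj (\<phi> x)) (at x) b = cnj (dir_deriv b \<phi> x)"
proof -
  obtain R where R: "\<And>x. norm x > R \<Longrightarrow> \<phi> x = 0" using test_function_support[OF assms] by blast
  show "test_function (\<lambda>x. cnj (\<phi> x))"
    by (rule test_functionI[where R = R], rule C_k_cnj[OF test_functionD(1)[OF assms]]) (simp add: R)
  show "frechet_derivative (\<lambda>x. cnj (\<phi> x)) (at x) b = cnj (dir_deriv b \<phi> x)"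
    using fun_cong[OF frechet_derivative_at[OF frechet_derivative_cnj[OF test_functionD(3)[OF assms]], of x], of b]
    by (rule sym)
qed

lemma test_function_translate:
  assumes "test_function \<phi>"
  shows "test_function (\<lambda>x. \<phi> (x + a))"
    "frechet_derivative (\<lambda>x. \<phi> (x + a)) (at x) = frechet_derivative \<phi> (at (x + a))"
proof -
  obtain R where R: "\<And>x. norm x > R \<Longrightarrow> \<phi> x = 0" using test_function_support[OF assms] by blast
  have "\<phi> (x + a) = 0" if "norm x > R + norm a" for x
    using norm_triangle_ineq4[of "x + a" a] that by (intro R) simp
  then show "test_function (\<lambda>x. \<phi> (x + a))"
    by (intro test_functionI[where R = "R + norm a"] C_k_translate[OF test_functionD(1)[OF assms]])
  show "frechet_derivative (\<lambda>x. \<phi> (x + a)) (at x) = frechet_derivative \<phi> (at (x + a))"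
    using frechet_derivative_at[OF frechet_derivative_translate[OF test_functionD(3)[OF assms]]] by simp
qed

lemma test_function_add:
  assumes "test_function \<phi>" "test_function \<psi>"
  shows "test_function (\<lambda>x. \<phi> x + \<psi> x)"
proof -
  obtain R S where "\<And>x. norm x > R \<Longrightarrow> \<phi> x = 0" "\<And>x. norm x > S \<Longrightarrow> \<psi> x = 0"
    using test_function_support[OF assms(1)] test_function_support[OF assms(2)] by blast
  then show ?thesis
    by (intro test_functionI[where R = "max R S"] C_k_add test_functionD(1)[OF assms(1)] test_functionD(1)[OF assms(2)]) simp
qed

lemma test_function_mult_const:
  assumes "test_function \<phi>"
  shows "test_function (\<lambda>x. c * \<phi> x)"
proof -
  obtain R where "\<And>x. norm x > R \<Longrightarrow> \<phi> x = 0" using test_function_support[OF assms] by blast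
  then show ?thesis
    by (intro test_functionI[where R = R] C_k_mult[OF C_k_const test_functionD(1)[OF assms]]) simp
qed

text \<open>As \<open>n\<close> grows these tend pointwise to the indicator of the open box, always
  staying below it. The product over coordinates keeps every factor a function of a single linear
  form.\<close>

definition box_bump :: "nat \<Rightarrow> 'a::euclidean_space \<Rightarrow> 'a \<Rightarrow> 'a \<Rightarrow> real" where
  "box_bump n a c x = (\<Prod>b\<in>Basis. flat 1 (real (Suc n) * ((x - a) \<bullet> b)) * flat 1 (real (Suc n) * ((c - x) \<bullet> b)))"

lemma box_bump_outside:
  assumes "x \<notin> box a c"
  shows "box_bump n a c x = 0"
proof -
  obtain b where b: "b \<in> Basis" "(x - a) \<bullet> b \<le> 0 \<or> (c - x) \<bullet> b \<le> 0"
    using assms by (auto simp: mem_box inner_diff_left not_less)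
  then have "real (Suc n) * ((x - a) \<bullet> b) \<le> 0 \<or> real (Suc n) * ((c - x) \<bullet> b) \<le> 0"
    by (auto intro: mult_nonneg_nonpos simp del: of_nat_Suc)
  then have "flat 1 (real (Suc n) * ((x - a) \<bullet> b)) * flat 1 (real (Suc n) * ((c - x) \<bullet> b)) = 0"
    by (auto simp: flat_1_bounds(3) simp del: of_nat_Suc)
  with b(1) show ?thesis unfolding box_bump_def by (intro prod_zero bexI[of _ b]) auto
qed

lemma box_bump_bounds: "0 \<le> box_bump n a c x" "box_bump n a c x \<le> indicator (box a c) x"
proof -
  show "0 \<le> box_bump n a c x"
    unfolding box_bump_def by (intro prod_nonneg mult_nonneg_nonneg flat_1_bounds)
  have "box_bump n a c x \<le> 1"
    unfolding box_bump_def by (intro prod_le_1 conjI mult_nonneg_nonneg flat_1_bounds mult_le_one)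
  then show "box_bump n a c x \<le> indicator (box a c) x"
    using box_bump_outside[of x a c n] by (cases "x \<in> box a c") auto
qed

lemma box_bump_tendsto: "(\<lambda>n. box_bump n a c x) \<longlonglongrightarrow> indicator (box a c) x"
proof (cases "x \<in> box a c")
  case True
  have "(\<lambda>n. box_bump n a c x) \<longlonglongrightarrow>
    (\<Prod>b\<in>Basis. (if (x - a) \<bullet> b > 0 then 1 else 0) * (if (c - x) \<bullet> b > 0 then 1 else 0))"
    unfolding box_bump_def by (intro tendsto_prod tendsto_mult flat_scaled_tendsto)
  also have "(\<Prod>b\<in>Basis. (if (x - a) \<bullet> b > 0 then 1 else 0) * (if (c - x) \<bullet> b > 0 then 1 else 0)) = (1::real)"
    using True by (intro prod.neutral) (auto simp: mem_box inner_diff_left)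
  finally show ?thesis using True by simp
qed (simp add: box_bump_outside)

lemma test_function_box_bump: "test_function (\<lambda>x. complex_of_real (box_bump n a c x))"
proof -
  have flat_arg: "real (Suc n) * ((x - a) \<bullet> b) = real (Suc n) * (x \<bullet> b) + - (real (Suc n) * (a \<bullet> b))"
    "real (Suc n) * ((c - x) \<bullet> b) = - real (Suc n) * (x \<bullet> b) + real (Suc n) * (c \<bullet> b)" for x b
    by (simp_all add: inner_diff_left algebra_simps)
  have C: "C_k k (\<lambda>x. complex_of_real (box_bump n a c x))" for k
    unfolding box_bump_def of_real_prod of_real_mult flat_arg by (intro C_k_prod C_k_mult C_k_flat)
  obtain R where R: "\<forall>x\<in>box a c. norm x \<le> R" using bounded_box bounded_iff by metis
  then have "complex_of_real (box_bump n a c x) = 0" if "norm x > R" for x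
  proof -
    have "x \<notin> box a c" using R that by (force simp: not_le[symmetric])
    then show ?thesis by (simp add: box_bump_outside)
  qed
  with C show ?thesis by (rule test_functionI)
qed

section \<open>The fundamental lemma of the calculus of variations\<close>

text \<open>Boxes form an intersection-stable generator of the Borel sets, so a Dynkin argument
  carries the vanishing to all of them; the total integral is what handles complements.\<close>

lemma AE_zero_of_box_integrals:
  fixes g :: "'a::euclidean_space \<Rightarrow> real"
  assumes g: "integrable lborel g" and tot: "(\<integral>x. g x \<partial>lborel) = 0"
    and box: "\<And>a c. (\<integral>x. indicator (box a c) x * g x \<partial>lborel) = 0"
  shows "AE x in lborel. g x = 0"
proof (rule density_unique_real[OF g])
  have si: "set_integrable lborel A g" if "A \<in> sets borel" for A
    unfolding set_integrable_def using integrable_mult_indicator[OF _ g, of A] that by simp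
  fix A assume "A \<in> sets (lborel :: 'a measure)"
  have B: "sets borel = sigma_sets UNIV (range (\<lambda>(a, b). box a b :: 'a set))"
    unfolding borel_eq_box by (rule sets_measure_of) simp
  have "Int_stable (range (\<lambda>(a, b). box a b :: 'a set))"
    by (auto simp: Int_stable_def box_Int_box)
  moreover have "range (\<lambda>(a, b). box a b :: 'a set) \<subseteq> Pow UNIV" by simp
  moreover have "A \<in> sigma_sets UNIV (range (\<lambda>(a, b). box a b))"
    using \<open>A \<in> sets lborel\<close> by (simp add: B)
  ultimately have "(\<integral>x\<in>A. g x \<partial>lborel) = 0"
  proof (induction rule: sigma_sets_induct_disjoint)
    case (basic A)
    then show "(\<integral>x\<in>A. g x \<partial>lborel) = 0" using box by (auto simp: set_lebesgue_integral_def)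
  next
    case empty
    show "(\<integral>x\<in>{}. g x \<partial>lborel) = 0" by (simp add: set_lebesgue_integral_def)
  next
    case A: (compl A)
    then have m: "A \<in> sets borel" by (simp add: B)
    have "(\<integral>x\<in>UNIV. g x \<partial>lborel) = (\<integral>x\<in>A. g x \<partial>lborel) + (\<integral>x\<in>UNIV - A. g x \<partial>lborel)"
      using set_integral_Un[of A "UNIV - A" lborel g] si m by simp
    then show "(\<integral>x\<in>UNIV - A. g x \<partial>lborel) = 0" using A(2) tot by (simp add: set_lebesgue_integral_def)
  next
    case A: (union A)
    then have m: "A i \<in> sets borel" for i by (auto simp: B)
    have "(\<integral>x\<in>(\<Union>i. A i). g x \<partial>lborel) = (\<Sum>i. \<integral>x\<in>A i. g x \<partial>lborel)"
      by (rule lebesgue_integral_countable_add) (use m A(1) si in \<open>auto simp: disjoint_family_on_def\<close>)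
    then show "(\<integral>x\<in>(\<Union>i. A i). g x \<partial>lborel) = 0" using A(3) by simp
  qed
  then show "(\<integral>x\<in>A. g x \<partial>lborel) = (\<integral>x\<in>A. 0 \<partial>lborel)" by (simp add: set_lebesgue_integral_def)
qed simp

text \<open>Bumps yield vanishing integrals over boxes by dominated convergence. As \<open>f\<close>
  is only locally integrable, the Dynkin argument is run on one box at a time, and the space is
  exhausted by boxes at the end.\<close>

lemma fundamental_lemma:
  fixes f :: "'a::euclidean_space \<Rightarrow> real"
  assumes meas: "f \<in> borel_measurable lebesgue"
    and loc: "\<And>a c. integrable lebesgue (\<lambda>x. indicator (box a c) x * f x)"
    and zero: "\<And>n a c. (\<integral>x. box_bump n a c x * f x \<partial>lebesgue) = 0"
  shows "AE x in lebesgue. f x = 0"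
proof -
  have box0: "(\<integral>x. indicator (box a c) x * f x \<partial>lebesgue) = 0" for a c
  proof -
    have "(\<lambda>n. \<integral>x. box_bump n a c x * f x \<partial>lebesgue) \<longlonglongrightarrow> (\<integral>x. indicator (box a c) x * f x \<partial>lebesgue)"
    proof (rule integral_dominated_convergence)
      have "continuous_on UNIV (\<lambda>x. Re (complex_of_real (box_bump n a c x)))" for n
        by (intro continuous_intros test_functionD(2)[OF test_function_box_bump])
      then have "box_bump n a c \<in> borel_measurable lebesgue" for n by (intro continuous_borel_lebesgue) simp
      then show "(\<lambda>x. box_bump n a c x * f x) \<in> borel_measurable lebesgue" for n using meas by measurable
      show "integrable lebesgue (\<lambda>x. norm (indicator (box a c) x * f x))" using loc by (rule integrable_norm)
      show "AE x in lebesgue. (\<lambda>n. box_bump n a c x * f x) \<longlonglongrightarrow> indicator (box a c) x * f x"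
        by (intro AE_I2 tendsto_mult box_bump_tendsto tendsto_const)
      show "AE x in lebesgue. norm (box_bump n a c x * f x) \<le> norm (indicator (box a c) x * f x)" for n
        using box_bump_bounds[of n a c] by (intro AE_I2) (auto simp: abs_mult intro!: mult_right_mono)
    qed (use loc[of a c] in auto)
    then show ?thesis by (simp add: zero LIMSEQ_const_iff)
  qed
  have loc0: "AE x in lebesgue. indicator (box a c) x * f x = 0" for a c
  proof -
    \<comment> \<open>\<open>f\<close> is merely Lebesgue measurable, while the Dynkin argument
      lives on Borel sets; hence the Borel representative \<open>g\<close>.\<close>
    obtain g where g: "g \<in> borel_measurable lborel" "AE x in lborel. indicator (box a c) x * f x = g x"
      using completion_ex_borel_measurable_real[OF borel_measurable_integrable[OF loc[of a c]]] by blast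
    have ae: "AE x in lebesgue. indicator (box a c) x * f x = g x" using g(2) by (rule AE_completion)
    have gl: "g \<in> borel_measurable lebesgue" using g(1) by (rule measurable_completion)
    have "integrable lebesgue g"
      by (rule integrable_cong_AE_imp[OF loc[of a c] gl]) (use ae in auto)
    then have gi: "integrable lborel g" using g(1) by (simp add: integrable_completion)
    have "(\<integral>x. indicator (box a' c') x * g x \<partial>lborel) = 0" for a' c'
    proof -
      have "(\<integral>x. indicator (box a' c') x * g x \<partial>lborel) = (\<integral>x. indicator (box a' c') x * g x \<partial>lebesgue)"
        using g(1) by (intro integral_completion[symmetric] borel_measurable_times borel_measurable_indicator) auto
      \<comment> \<open>The intersection of two boxes is a box, so the localized function still has
        vanishing box integrals.\<close>
      also have "\<dots> = (\<integral>x. indicator (box a' c' \<inter> box a c) x * f x \<partial>lebesgue)"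
        by (rule integral_cong_AE) (use meas gl ae in \<open>auto simp: indicator_inter_arith
            intro!: borel_measurable_times borel_measurable_indicator elim!: eventually_mono\<close>)
      also have "\<dots> = 0" unfolding box_Int_box by (rule box0)
      finally show ?thesis .
    qed
    moreover have "(\<integral>x. g x \<partial>lborel) = 0"
    proof -
      have "(\<integral>x. g x \<partial>lborel) = (\<integral>x. g x \<partial>lebesgue)" using g(1) by (rule integral_completion[symmetric])
      also have "\<dots> = (\<integral>x. indicator (box a c) x * f x \<partial>lebesgue)"
        by (rule integral_cong_AE)
          (use meas gl ae in \<open>auto intro!: borel_measurable_times borel_measurable_indicator\<close>)
      finally show ?thesis using box0 by simp
    qed
    ultimately have "AE x in lborel. g x = 0" using gi by (intro AE_zero_of_box_integrals)
    then have "AE x in lebesgue. g x = 0" by (rule AE_completion)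
    with ae show ?thesis by eventually_elim simp
  qed
  have "AE x in lebesgue. \<forall>n::nat. indicator (box (- (real n *\<^sub>R One)) (real n *\<^sub>R One)) x * f x = 0"
    unfolding AE_all_countable using loc0 by blast
  then show ?thesis
  proof eventually_elim
    case (elim x)
    have "x \<in> (\<Union>n::nat. box (- (real n *\<^sub>R One)) (real n *\<^sub>R One))" by (subst UN_box_eq_UNIV) simp
    then obtain n :: nat where "x \<in> box (- (real n *\<^sub>R One)) (real n *\<^sub>R One)" by blast
    with elim[rule_format, of n] show ?case by (simp only: indicator_simps mult_1)
  qed
qed

section \<open>Weak derivatives\<close>

lemma square_integrable_integrable_mult:
  assumes "square_integrable f" "square_integrable g"
  shows "integrable lebesgue (\<lambda>x. f x * g x)"
proof (rule Bochner_Integration.integrable_bound)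
  show "integrable lebesgue (\<lambda>x. (norm (f x))\<^sup>2 + (norm (g x))\<^sup>2)"
    using assms by (auto simp: square_integrable_def)
  show "(\<lambda>x. f x * g x) \<in> borel_measurable lebesgue"
    using assms by (auto simp: square_integrable_def)
  have "norm (f x * g x) \<le> (norm (f x))\<^sup>2 + (norm (g x))\<^sup>2" for x
    using sum_squares_bound[of "norm (f x)" "norm (g x)"] mult_nonneg_nonneg[OF norm_ge_zero norm_ge_zero, of "f x" "g x"]
    unfolding norm_mult by linarith
  then show "AE x in lebesgue. norm (f x * g x) \<le> norm ((norm (f x))\<^sup>2 + (norm (g x))\<^sup>2)" by simp
qed

lemma integrable_box_square_integrable:
  assumes "f \<in> borel_measurable lebesgue" "integrable lebesgue (\<lambda>x. (f x)\<^sup>2)"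
  shows "integrable lebesgue (\<lambda>x. indicator (box a c) x * f x :: real)"
proof (rule Bochner_Integration.integrable_bound)
  have "emeasure lborel (box a c) < top"
    by (simp add: emeasure_lborel_box_eq)
  then have "integrable lebesgue (indicator (box a c) :: 'a \<Rightarrow> real)"
    by (intro integrable_real_indicator) auto
  then show "integrable lebesgue (\<lambda>x. indicator (box a c) x + (f x)\<^sup>2)" using assms(2) by simp
  show "(\<lambda>x. indicator (box a c) x * f x) \<in> borel_measurable lebesgue"
    using assms(1) by (intro borel_measurable_times borel_measurable_indicator) auto
  have "\<bar>f x\<bar> \<le> 1 + (f x)\<^sup>2" for x using sum_squares_bound[of "\<bar>f x\<bar>" 1] abs_ge_zero[of "f x"] by (simp add: power2_eq_square)
  then show "AE x in lebesgue. norm (indicator (box a c) x * f x) \<le> norm (indicator (box a c) x + (f x)\<^sup>2)"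
    by (intro AE_I2) (auto simp: indicator_def)
qed

text \<open>The fundamental lemma is real-valued. The functional \<open>f\<close> in the proof
  stands for the real and the imaginary part at once; its third condition moves the real bump out of
  the complex product.\<close>

lemma orthogonal_to_test_functions:
  assumes zero: "\<And>\<phi>. test_function \<phi> \<Longrightarrow> (\<integral>x. rep_L2 w x * \<phi> x \<partial>lebesgue) = 0"
  shows "w = 0"
proof -
  have sq: "integrable lebesgue (\<lambda>x. (norm (rep_L2 w x))\<^sup>2)"
    using square_integrable_rep[of w] by (simp add: square_integrable_def)
  have ae: "AE x in lebesgue. f (rep_L2 w x) = 0"
    if f: "bounded_linear f" "\<And>z. \<bar>f z\<bar> \<le> norm z" "\<And>r z. f (z * complex_of_real r) = r * f z" for f :: "complex \<Rightarrow> real"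
  proof (rule fundamental_lemma)
    show m: "(\<lambda>x. f (rep_L2 w x)) \<in> borel_measurable lebesgue"
      using borel_measurable_continuous_onI[OF linear_continuous_on[OF f(1)]] measurable_compose[OF rep_L2_measurable] by blast
    have "integrable lebesgue (\<lambda>x. (f (rep_L2 w x))\<^sup>2)"
    proof (rule Bochner_Integration.integrable_bound[OF sq])
      show "(\<lambda>x. (f (rep_L2 w x))\<^sup>2) \<in> borel_measurable lebesgue" using m by measurable
      show "AE x in lebesgue. norm ((f (rep_L2 w x))\<^sup>2) \<le> norm ((norm (rep_L2 w x))\<^sup>2)"
        using f(2) by (intro AE_I2) (simp add: abs_le_square_iff[symmetric])
    qed
    then show "integrable lebesgue (\<lambda>x. indicator (box a c) x * f (rep_L2 w x))" for a c
      by (rule integrable_box_square_integrable[OF m])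
    show "(\<integral>x. box_bump n a c x * f (rep_L2 w x) \<partial>lebesgue) = 0" for n a c
    proof -
      have tf: "test_function (\<lambda>x. complex_of_real (box_bump n a c x))" by (rule test_function_box_bump)
      have "(\<integral>x. f (rep_L2 w x * complex_of_real (box_bump n a c x)) \<partial>lebesgue) = f 0"
        unfolding zero[OF tf, symmetric]
        by (rule integral_bounded_linear[OF f(1)] ) (intro square_integrable_integrable_mult square_integrable_rep square_integrable_test_function tf)
      then show ?thesis by (simp add: f(3) linear_0[OF bounded_linear.linear[OF f(1)]])
    qed
  qed
  have "AE x in lebesgue. Re (rep_L2 w x) = 0"
    by (rule ae) (auto simp: bounded_linear_Re abs_Re_le_cmod)
  moreover have "AE x in lebesgue. Im (rep_L2 w x) = 0"
    by (rule ae) (auto simp: bounded_linear_Im abs_Im_le_cmod)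
  ultimately have "AE x in lebesgue. rep_L2 w x = rep_L2 0 x"
    using rep_zero by eventually_elim (simp add: complex_eq_iff)
  then show ?thesis by (rule L2_eqI)
qed

lemma weak_partial_integrable:
  assumes "test_function \<phi>"
  shows "integrable lebesgue (\<lambda>x. rep_L2 u x * \<phi> x)"
    "b \<in> Basis \<Longrightarrow> integrable lebesgue (\<lambda>x. rep_L2 u x * dir_deriv b \<phi> x)"
  by (intro square_integrable_integrable_mult square_integrable_rep square_integrable_test_function assms test_function_partial)+

lemma has_weak_partial_unique:
  assumes "has_weak_partial b u v" "has_weak_partial b u v'"
  shows "v = v'"
proof -
  have "v - v' = 0"
  proof (rule orthogonal_to_test_functions)
    fix \<phi> :: "'a \<Rightarrow> complex" assume t: "test_function \<phi>"
    have "(\<integral>x. rep_L2 (v - v') x * \<phi> x \<partial>lebesgue) = (\<integral>x. rep_L2 v x * \<phi> x - rep_L2 v' x * \<phi> x \<partial>lebesgue)"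
      using rep_diff[of v v'] continuous_borel_lebesgue[OF test_functionD(2)[OF t]]
      by (intro integral_cong_AE) (auto simp: left_diff_distrib elim!: eventually_mono)
    also have "\<dots> = (\<integral>x. rep_L2 v x * \<phi> x \<partial>lebesgue) - (\<integral>x. rep_L2 v' x * \<phi> x \<partial>lebesgue)"
      by (intro Bochner_Integration.integral_diff weak_partial_integrable t)
    also have "\<dots> = 0" using assms t unfolding has_weak_partial_def by (simp add: minus_equation_iff[of "integral\<^sup>L _ _"])
    finally show "(\<integral>x. rep_L2 (v - v') x * \<phi> x \<partial>lebesgue) = 0" .
  qed
  then show ?thesis by simp
qed

lemma weak_partial_eq: "has_weak_partial b u v \<Longrightarrow> weak_partial b u = v"
  unfolding weak_partial_def by (rule the_equality) (auto intro: has_weak_partial_unique)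

lemma has_weak_partial_add:
  assumes b: "b \<in> Basis" and "has_weak_partial b u v" "has_weak_partial b u' v'"
  shows "has_weak_partial b (u + u') (v + v')"
  unfolding has_weak_partial_def
proof (intro allI impI)
  have add: "(\<integral>x. rep_L2 (w + w') x * \<psi> x \<partial>lebesgue) = (\<integral>x. rep_L2 w x * \<psi> x \<partial>lebesgue) + (\<integral>x. rep_L2 w' x * \<psi> x \<partial>lebesgue)"
    if t: "test_function \<psi>" for w w' :: "'a L2" and \<psi>
  proof -
    have "(\<integral>x. rep_L2 (w + w') x * \<psi> x \<partial>lebesgue) = (\<integral>x. rep_L2 w x * \<psi> x + rep_L2 w' x * \<psi> x \<partial>lebesgue)"
      using rep_add[of w w'] continuous_borel_lebesgue[OF test_functionD(2)[OF t]]
      by (intro integral_cong_AE) (auto simp: distrib_right elim!: eventually_mono)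
    then show ?thesis by (simp add: weak_partial_integrable t)
  qed
  fix \<phi> :: "'a \<Rightarrow> complex" assume t: "test_function \<phi>"
  show "(\<integral>x. rep_L2 (u + u') x * dir_deriv b \<phi> x \<partial>lebesgue) = - (\<integral>x. rep_L2 (v + v') x * \<phi> x \<partial>lebesgue)"
    using assms t by (simp add: add[OF t] add[OF test_function_partial[OF t b]] has_weak_partial_def)
qed

lemma has_weak_partial_scaleC:
  assumes b: "b \<in> Basis" and "has_weak_partial b u v"
  shows "has_weak_partial b (scaleC_L2 c u) (scaleC_L2 c v)"
  unfolding has_weak_partial_def
proof (intro allI impI)
  have sc: "(\<integral>x. rep_L2 (scaleC_L2 c w) x * \<psi> x \<partial>lebesgue) = c * (\<integral>x. rep_L2 w x * \<psi> x \<partial>lebesgue)"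
    if t: "test_function \<psi>" for w :: "'a L2" and \<psi>
  proof -
    have "(\<integral>x. rep_L2 (scaleC_L2 c w) x * \<psi> x \<partial>lebesgue) = (\<integral>x. c * (rep_L2 w x * \<psi> x) \<partial>lebesgue)"
      using rep_scaleC[of c w] continuous_borel_lebesgue[OF test_functionD(2)[OF t]]
      by (intro integral_cong_AE) (auto elim!: eventually_mono)
    then show ?thesis by simp
  qed
  fix \<phi> :: "'a \<Rightarrow> complex" assume t: "test_function \<phi>"
  show "(\<integral>x. rep_L2 (scaleC_L2 c u) x * dir_deriv b \<phi> x \<partial>lebesgue) = - (\<integral>x. rep_L2 (scaleC_L2 c v) x * \<phi> x \<partial>lebesgue)"
    using assms t by (simp add: sc[OF t] sc[OF test_function_partial[OF t b]] has_weak_partial_def)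
qed

lemma has_weak_partial_cnj:
  assumes b: "b \<in> Basis" and w: "has_weak_partial b u v"
  shows "has_weak_partial b (cnj_L2 u) (cnj_L2 v)"
  unfolding has_weak_partial_def
proof (intro allI impI)
  have cn: "(\<integral>x. rep_L2 (cnj_L2 w) x * \<psi> x \<partial>lebesgue) = cnj (\<integral>x. rep_L2 w x * cnj (\<psi> x) \<partial>lebesgue)"
    if t: "test_function \<psi>" for w :: "'a L2" and \<psi>
  proof -
    have "(\<integral>x. rep_L2 (cnj_L2 w) x * \<psi> x \<partial>lebesgue) = (\<integral>x. cnj (rep_L2 w x * cnj (\<psi> x)) \<partial>lebesgue)"
      using rep_cnj[of w] continuous_borel_lebesgue[OF test_functionD(2)[OF t]]
      by (intro integral_cong_AE) (auto elim!: eventually_mono)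
    then show ?thesis
      using integral_bounded_linear[OF bounded_linear_cnj weak_partial_integrable(1)[OF test_function_cnj(1)[OF t]], of w]
      by simp
  qed
  fix \<phi> :: "'a \<Rightarrow> complex" assume t: "test_function \<phi>"
  have "(\<integral>x. rep_L2 u x * cnj (dir_deriv b \<phi> x) \<partial>lebesgue) = - (\<integral>x. rep_L2 v x * cnj (\<phi> x) \<partial>lebesgue)"
    using w[unfolded has_weak_partial_def, rule_format, OF test_function_cnj(1)[OF t]]
    by (simp add: test_function_cnj(2)[OF t])
  then show "(\<integral>x. rep_L2 (cnj_L2 u) x * dir_deriv b \<phi> x \<partial>lebesgue) = - (\<integral>x. rep_L2 (cnj_L2 v) x * \<phi> x \<partial>lebesgue)"
    by (simp add: cn[OF t] cn[OF test_function_partial[OF t b]])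
qed

lemma has_line_derivative:
  assumes "(f has_derivative f') (at (x + s *\<^sub>R b))"
  shows "((\<lambda>t. f (x + t *\<^sub>R b)) has_vector_derivative f' b) (at s)"
proof -
  have "((\<lambda>t. x + t *\<^sub>R b) has_derivative (\<lambda>h. h *\<^sub>R b)) (at s)" by (auto intro!: derivative_eq_intros)
  from has_derivative_compose[OF this assms] 
  show ?thesis by (simp add: has_vector_derivative_def linear_scale[OF has_derivative_linear[OF assms]])
qed

text \<open>The derivative of \<open>f \<phi>\<close> in the direction \<open>b\<close> has integral
  0. Besides differentiability only the \<open>b\<close>-derivative is asked to be continuous, so
  compactly supported functions of class \<open>C^2\<close> reach \<open>sobolev_H2\<close> without
  smoothing.\<close>

lemma has_weak_partial_classical:
  fixes f :: "'a::euclidean_space \<Rightarrow> complex"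
  assumes b: "b \<in> Basis" and der: "\<And>x. (f has_derivative f' x) (at x)"
    and cont: "continuous_on UNIV (\<lambda>x. f' x b)"
    and supp: "\<And>x. norm x > R \<Longrightarrow> f x = 0" "\<And>x. norm x > R \<Longrightarrow> f' x b = 0"
  shows "has_weak_partial b (abs_L2 f) (abs_L2 (\<lambda>x. f' x b))"
  unfolding has_weak_partial_def
proof (intro allI impI)
  fix \<phi> :: "'a \<Rightarrow> complex" assume t: "test_function \<phi>"
  have cf: "continuous_on UNIV f"
    using der has_derivative_continuous by (blast intro: continuous_at_imp_continuous_on)
  have sq: "square_integrable f" "square_integrable (\<lambda>x. f' x b)"
    by (rule square_integrable_compact_support[OF cf supp(1)] square_integrable_compact_support[OF cont supp(2)]; assumption)+
  have cphi: "continuous_on UNIV \<phi>" by (rule test_functionD(2)[OF t])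
  have cdphi: "continuous_on UNIV (\<lambda>x. dir_deriv b \<phi> x)" by (rule test_functionD(2)[OF test_function_partial[OF t b]])
  have "(\<integral>x. f x * dir_deriv b \<phi> x + f' x b * \<phi> x \<partial>lebesgue) = 0"
  proof (rule integral_line_derivative_eq_0[where f = "\<lambda>x. f x * \<phi> x" and b = b and R = R])
    show "((\<lambda>t. f (x + t *\<^sub>R b) * \<phi> (x + t *\<^sub>R b)) has_vector_derivative
        f x * dir_deriv b \<phi> x + f' x b * \<phi> x) (at 0)" for x
      by (rule has_line_derivative[where s = 0, simplified, OF has_derivative_mult[OF der test_functionD(4)[OF t]]])
  qed (auto intro!: continuous_intros cf cphi cdphi cont simp: supp)
  then have "(\<integral>x. f x * dir_deriv b \<phi> x \<partial>lebesgue) = - (\<integral>x. f' x b * \<phi> x \<partial>lebesgue)"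
    by (subst (asm) Bochner_Integration.integral_add)
       (auto intro!: square_integrable_integrable_mult sq square_integrable_test_function test_function_partial t b simp: eq_neg_iff_add_eq_0)
  moreover have "(\<integral>x. rep_L2 (abs_L2 f) x * dir_deriv b \<phi> x \<partial>lebesgue) = (\<integral>x. f x * dir_deriv b \<phi> x \<partial>lebesgue)"
    using rep_abs_L2[OF sq(1)] sq continuous_borel_lebesgue[OF cdphi]
    by (intro integral_cong_AE) (auto simp: square_integrable_def elim!: eventually_mono)
  moreover have "(\<integral>x. rep_L2 (abs_L2 (\<lambda>x. f' x b)) x * \<phi> x \<partial>lebesgue) = (\<integral>x. f' x b * \<phi> x \<partial>lebesgue)"
    using rep_abs_L2[OF sq(2)] sq continuous_borel_lebesgue[OF cphi]
    by (intro integral_cong_AE) (auto simp: square_integrable_def elim!: eventually_mono)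
  ultimately show "(\<integral>x. rep_L2 (abs_L2 f) x * dir_deriv b \<phi> x \<partial>lebesgue)
      = - (\<integral>x. rep_L2 (abs_L2 (\<lambda>x. f' x b)) x * \<phi> x \<partial>lebesgue)" by simp
qed

section \<open>Skew-adjointness of weak derivatives\<close>

lemma subspace_closure:
  fixes S :: "'a::real_normed_vector set"
  assumes S: "subspace S"
  shows "subspace (closure S)"
  unfolding subspace_def
proof (intro conjI ballI allI)
  show "0 \<in> closure S" using subspace_0[OF S] closure_subset by blast
  fix x y assume "x \<in> closure S" "y \<in> closure S"
  then obtain f g where *: "\<And>n::nat. f n \<in> S" "f \<longlonglongrightarrow> x" "\<And>n::nat. g n \<in> S" "g \<longlonglongrightarrow> y"
    unfolding closure_sequential by metis
  have "(\<lambda>n. f n + g n) \<longlonglongrightarrow> x + y" "\<And>n. f n + g n \<in> S"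
    using * by (auto intro: tendsto_add subspace_add[OF S])
  then show "x + y \<in> closure S" unfolding closure_sequential by (intro exI[of _ "\<lambda>n. f n + g n"]) auto
next
  fix c x assume "x \<in> closure S"
  then obtain f where *: "\<And>n::nat. f n \<in> S" "f \<longlonglongrightarrow> x" unfolding closure_sequential by metis
  have "(\<lambda>n. c *\<^sub>R f n) \<longlonglongrightarrow> c *\<^sub>R x" "\<And>n. c *\<^sub>R f n \<in> S"
    using * by (auto intro: tendsto_scaleR subspace_scale[OF S])
  then show "c *\<^sub>R x \<in> closure S" unfolding closure_sequential by (intro exI[of _ "\<lambda>n. c *\<^sub>R f n"]) auto
qed

lemma closure_test_functions: "closure {abs_L2 \<phi> | \<phi>. test_function \<phi>} = (UNIV :: 'a::euclidean_space L2 set)"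
proof (rule closed_subspace_eq_UNIV)
  let ?S = "{abs_L2 \<phi> | \<phi>. test_function \<phi>} :: 'a L2 set"
  have "subspace ?S"
    unfolding subspace_def
  proof (intro conjI ballI allI)
    have "test_function (\<lambda>x::'a. 0)" using test_functionI[of "\<lambda>x::'a. 0" 0] C_k_const by blast
    then show "0 \<in> ?S" unfolding zero_L2_def by (intro CollectI exI[of _ "\<lambda>x. 0"]) auto
    fix u v assume "u \<in> ?S" "v \<in> ?S"
    then obtain \<phi> \<psi> where *: "u = abs_L2 \<phi>" "test_function \<phi>" "v = abs_L2 \<psi>" "test_function \<psi>" by blast
    then show "u + v \<in> ?S" by (auto simp: abs_add square_integrable_test_function intro!: exI[of _ "\<lambda>x. \<phi> x + \<psi> x"] test_function_add)
  next
    fix c u assume "u \<in> ?S"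
    then obtain \<phi> where *: "u = abs_L2 \<phi>" "test_function \<phi>" by blast
    then show "c *\<^sub>R u \<in> ?S"
      by (auto simp: abs_scaleR scaleR_conv_of_real square_integrable_test_function
          intro!: exI[of _ "\<lambda>x. of_real c * \<phi> x"] test_function_mult_const)
  qed
  then show "subspace (closure ?S)" by (rule subspace_closure)
  show "closed (closure ?S)" by simp
  fix w assume w: "\<And>s. s \<in> closure ?S \<Longrightarrow> w \<bullet> s = 0"
  show "w = 0"
  proof (rule orthogonal_to_test_functions)
    have re: "Re (\<integral>x. rep_L2 w x * \<phi> x \<partial>lebesgue) = 0" if t: "test_function \<phi>" for \<phi>
    proof -
      have "abs_L2 (\<lambda>x. cnj (\<phi> x)) \<in> closure ?S" using test_function_cnj(1)[OF t] closure_subset by fastforce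
      then have "w \<bullet> abs_L2 (\<lambda>x. cnj (\<phi> x)) = 0" by (rule w)
      then have "(\<integral>x. rep_L2 w x \<bullet> cnj (\<phi> x) \<partial>lebesgue) = 0"
        using inner_abs[OF square_integrable_rep[of w] square_integrable_test_function[OF test_function_cnj(1)[OF t]]] by simp
      moreover have "rep_L2 w x \<bullet> cnj (\<phi> x) = Re (rep_L2 w x * \<phi> x)" for x by (simp add: inner_complex_def)
      ultimately show ?thesis
        using integral_bounded_linear[OF bounded_linear_Re weak_partial_integrable(1)[OF t, of w]] by simp
    qed
    fix \<phi> :: "'a \<Rightarrow> complex" assume t: "test_function \<phi>"
    \<comment> \<open>The real inner product controls only real parts; up to sign, the imaginary
      part is the real part for the test function \<open>\<i> \<phi>\<close>.\<close>
    have "Im (\<integral>x. rep_L2 w x * \<phi> x \<partial>lebesgue) = - Re (\<i> * (\<integral>x. rep_L2 w x * \<phi> x \<partial>lebesgue))" by simp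
    also have "\<i> * (\<integral>x. rep_L2 w x * \<phi> x \<partial>lebesgue) = (\<integral>x. rep_L2 w x * (\<i> * \<phi> x) \<partial>lebesgue)"
      by (subst integral_mult_right_zero[symmetric]) (simp add: mult_ac)
    also have "Re \<dots> = 0" by (rule re[OF test_function_mult_const[OF t]])
    finally show "(\<integral>x. rep_L2 w x * \<phi> x \<partial>lebesgue) = 0" using re[OF t] by (simp add: complex_eq_iff)
  qed
qed

text \<open>Uniform boundedness lets weak convergence be checked on a dense set only, which reduces
  the study of difference quotients to test functions.\<close>

lemma weak_limit_on_dense:
  fixes D :: "nat \<Rightarrow> 'a::real_inner"
  assumes bd: "\<And>n. norm (D n) \<le> C" and dense: "closure S = UNIV"
    and lim: "\<And>s. s \<in> S \<Longrightarrow> (\<lambda>n. D n \<bullet> s) \<longlonglongrightarrow> v \<bullet> s"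
  shows "(\<lambda>n. D n \<bullet> w) \<longlonglongrightarrow> v \<bullet> w"
proof (rule LIMSEQ_I)
  fix e :: real assume e: "e > 0"
  define K where "K = \<bar>C\<bar> + norm v + 1"
  have K: "K > 0" by (simp add: K_def add_nonneg_pos)
  have "w \<in> closure S" using dense by simp
  then obtain s where s: "s \<in> S" "dist s w < e / (2 * K)"
    unfolding closure_approachable using e K by (metis divide_pos_pos mult_pos_pos zero_less_numeral)
  obtain N where N: "\<And>n. n \<ge> N \<Longrightarrow> norm (D n \<bullet> s - v \<bullet> s) < e / 2"
    using LIMSEQ_D[OF lim[OF s(1)], of "e / 2"] e by auto
  have "norm (D n \<bullet> w - v \<bullet> w) < e" if n: "n \<ge> N" for n
  proof -
    have "D n \<bullet> w - v \<bullet> w = (D n - v) \<bullet> (w - s) + (D n \<bullet> s - v \<bullet> s)"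
      by (simp add: inner_diff_left inner_diff_right)
    then have "\<bar>D n \<bullet> w - v \<bullet> w\<bar> \<le> \<bar>(D n - v) \<bullet> (w - s)\<bar> + \<bar>D n \<bullet> s - v \<bullet> s\<bar>" by simp
    moreover have "\<bar>(D n - v) \<bullet> (w - s)\<bar> \<le> norm (D n - v) * norm (w - s)" by (rule Cauchy_Schwarz_ineq2)
    moreover have "norm (D n - v) * norm (w - s) \<le> K * (e / (2 * K))"
    proof (rule mult_mono)
      show "norm (D n - v) \<le> K" using norm_triangle_ineq4[of "D n" v] bd[of n] abs_ge_self[of C] unfolding K_def by linarith
      show "norm (w - s) \<le> e / (2 * K)" using s(2) by (simp add: dist_norm norm_minus_commute)
    qed (use K in auto)
    moreover have "K * (e / (2 * K)) = e / 2" using K by simp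
    ultimately show ?thesis using N[OF n] by simp
  qed
  then show "\<exists>no. \<forall>n\<ge>no. norm (D n \<bullet> w - v \<bullet> w) < e" by blast
qed

section \<open>Translations in \<open>L^2\<close> and difference quotients\<close>

definition shift_L2 :: "'a::euclidean_space \<Rightarrow> 'a L2 \<Rightarrow> 'a L2" where
  "shift_L2 a u = abs_L2 (\<lambda>x. rep_L2 u (x + a))"

lemma square_integrable_translate:
  assumes "square_integrable f"
  shows "square_integrable (\<lambda>x. f (x + a))"
  using assms measurable_lebesgue_translate[of f a] integrable_lebesgue_translate[of "\<lambda>x. (norm (f x))\<^sup>2" a]
  by (simp add: square_integrable_def)

lemma shift_abs:
  assumes "square_integrable f"
  shows "shift_L2 a (abs_L2 f) = abs_L2 (\<lambda>x. f (x + a))"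
  unfolding shift_L2_def
  by (subst abs_L2_eq_iff)
    (simp_all add: square_integrable_translate[OF square_integrable_rep] square_integrable_translate[OF assms]
      AE_lebesgue_translate[OF rep_abs_L2[OF assms]])

lemma inner_shift: "shift_L2 a u \<bullet> v = u \<bullet> shift_L2 (- a) v"
proof -
  have sq: "square_integrable (\<lambda>x. rep_L2 u (x + a))" "square_integrable (\<lambda>x. rep_L2 v (x + - a))"
    by (rule square_integrable_translate[OF square_integrable_rep])+
  have "shift_L2 a u \<bullet> v = (\<integral>x. rep_L2 u (x + a) \<bullet> rep_L2 v x \<partial>lebesgue)"
    unfolding shift_L2_def using inner_abs[OF sq(1) square_integrable_rep[of v]] by simp
  also have "\<dots> = (\<integral>x. rep_L2 u (x + a) \<bullet> rep_L2 v ((x + a) + - a) \<partial>lebesgue)" by simp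
  also have "\<dots> = (\<integral>x. rep_L2 u x \<bullet> rep_L2 v (x + - a) \<partial>lebesgue)"
    by (rule integral_lebesgue_translate)
       (intro borel_measurable_inner rep_L2_measurable measurable_lebesgue_translate[OF rep_L2_measurable])
  also have "\<dots> = u \<bullet> shift_L2 (- a) v"
    unfolding shift_L2_def using inner_abs[OF square_integrable_rep[of u] sq(2)] by simp
  finally show ?thesis .
qed

lemma norm_shift: "norm (shift_L2 a u) = norm u"
proof -
  have "shift_L2 (- a) (shift_L2 a u) = u"
    unfolding shift_L2_def[of a] by (subst shift_abs) (simp_all add: square_integrable_translate[OF square_integrable_rep])
  then have "shift_L2 a u \<bullet> shift_L2 a u = u \<bullet> u" by (simp add: inner_shift[of a u "shift_L2 a u"])
  then show ?thesis by (simp add: norm_eq_sqrt_inner)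
qed

text \<open>A crude estimate, sup norm against volume, which serves both the Taylor remainder of
  test functions and the error of the quasimodes.\<close>

lemma norm_abs_L2_le_cball:
  fixes f :: "'a::euclidean_space \<Rightarrow> complex"
  assumes f: "square_integrable f" and bd: "\<And>x. norm (f x) \<le> K" and supp: "\<And>x. norm x > r \<Longrightarrow> f x = 0"
    and K: "K \<ge> 0"
  shows "norm (abs_L2 f) \<le> K * sqrt (measure lebesgue (cball (0::'a) r))"
proof -
  have fin: "emeasure lebesgue (cball (0::'a) r) \<noteq> \<infinity>" using emeasure_lborel_cball_finite[of "0::'a" r] by simp
  have "(norm (abs_L2 f))\<^sup>2 = (\<integral>x. (norm (f x))\<^sup>2 \<partial>lebesgue)" by (rule norm_abs_sq[OF f])
  also have "\<dots> \<le> (\<integral>x. K\<^sup>2 * indicator (cball (0::'a) r) x \<partial>lebesgue)"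
  proof (rule integral_mono)
    show "integrable lebesgue (\<lambda>x. (norm (f x))\<^sup>2)" using f by (simp add: square_integrable_def)
    show "integrable lebesgue (\<lambda>x. K\<^sup>2 * indicator (cball (0::'a) r) x)"
      using fin by (intro integrable_mult_right integrable_real_indicator) (auto simp: less_top)
    show "(norm (f x))\<^sup>2 \<le> K\<^sup>2 * indicator (cball (0::'a) r) x" for x
      using bd[of x] supp[of x] by (cases "norm x \<le> r") (auto intro: power_mono)
  qed
  also have "\<dots> = K\<^sup>2 * measure lebesgue (cball (0::'a) r)" by simp
  also have "\<dots> = (K * sqrt (measure lebesgue (cball (0::'a) r)))\<^sup>2" by (simp add: power_mult_distrib)
  finally show ?thesis by (rule power2_le_imp_le) (simp add: K)
qed

text \<open>The pointwise second-order Taylor bound becomes a bound in \<open>L^2\<close> because,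
  for \<open>h\<close> between -1 and 1, all functions involved vanish outside the ball of radius
  \<open>R + 1\<close>.\<close>

lemma test_function_taylor:
  fixes \<phi> :: "'a::euclidean_space \<Rightarrow> complex"
  assumes t: "test_function \<phi>" and b: "b \<in> Basis"
  shows "\<exists>C\<ge>0. \<forall>h. \<bar>h\<bar> \<le> 1 \<longrightarrow> norm (abs_L2 (\<lambda>x. \<phi> (x + h *\<^sub>R b)) - abs_L2 \<phi>
    - h *\<^sub>R abs_L2 (\<lambda>x. dir_deriv b \<phi> x)) \<le> C * h\<^sup>2"
proof -
  define \<psi> where "\<psi> x = dir_deriv b \<phi> x" for x
  have t1: "test_function \<psi>" unfolding \<psi>_def[abs_def] by (rule test_function_partial[OF t b])
  have t2: "test_function (\<lambda>x. dir_deriv b \<psi> x)" by (rule test_function_partial[OF t1 b])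
  obtain R where R: "R \<ge> 0" "\<And>x. norm x > R \<Longrightarrow> \<phi> x = 0" "\<And>x. norm x > R \<Longrightarrow> \<psi> x = 0"
    using test_function_support[OF t] by (auto simp: \<psi>_def)
  obtain R2 where R2: "\<And>x. norm x > R2 \<Longrightarrow> dir_deriv b \<psi> x = 0"
    using test_function_support[OF t1] by blast
  obtain M where M: "M \<ge> 0" "\<And>x. norm (dir_deriv b \<psi> x) \<le> M"
    using bounded_compact_support[OF test_functionD(2)[OF t2] R2] by blast
  have nb: "norm b = 1" using b by simp
  define E where "E h x = \<phi> (x + h *\<^sub>R b) - \<phi> x - h *\<^sub>R \<psi> x" for h x
  have E: "norm (E h x) \<le> M * h\<^sup>2" for h x
  proof -
    \<comment> \<open>Mean value inequality for \<open>\<phi> (x + s b) - s \<psi> x\<close>, whose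
      derivative in \<open>s\<close> is \<open>\<psi> (x + s b) - \<psi> x\<close> and hence at most
      \<open>M |h|\<close> in norm.\<close>
    have "norm ((\<phi> (x + h *\<^sub>R b) - h *\<^sub>R \<psi> x) - (\<phi> (x + 0 *\<^sub>R b) - 0 *\<^sub>R \<psi> x)) \<le> (M * \<bar>h\<bar>) * norm (h - 0)"
    proof (rule differentiable_bound[where S = "{-\<bar>h\<bar>..\<bar>h\<bar>}" and f' = "\<lambda>s k. k *\<^sub>R (\<psi> (x + s *\<^sub>R b) - \<psi> x)"])
      fix s assume s: "s \<in> {-\<bar>h\<bar>..\<bar>h\<bar>}"
      have "((\<lambda>s. \<phi> (x + s *\<^sub>R b)) has_derivative (\<lambda>k. k *\<^sub>R \<psi> (x + s *\<^sub>R b))) (at s)"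
        using has_line_derivative[of \<phi> "frechet_derivative \<phi> (at (x + s *\<^sub>R b))" x s b, OF test_functionD(4)[OF t]] by (simp add: has_vector_derivative_def \<psi>_def)
      then have "((\<lambda>s. \<phi> (x + s *\<^sub>R b) - s *\<^sub>R \<psi> x) has_derivative (\<lambda>k. k *\<^sub>R \<psi> (x + s *\<^sub>R b) - k *\<^sub>R \<psi> x)) (at s)"
        by (intro has_derivative_diff) (auto intro!: derivative_eq_intros)
      then show "((\<lambda>s. \<phi> (x + s *\<^sub>R b) - s *\<^sub>R \<psi> x) has_derivative (\<lambda>k. k *\<^sub>R (\<psi> (x + s *\<^sub>R b) - \<psi> x))) (at s within {-\<bar>h\<bar>..\<bar>h\<bar>})"
        by (simp add: scaleR_diff_right has_derivative_at_withinI)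
      have "norm (\<psi> (x + s *\<^sub>R b) - \<psi> x) \<le> M * \<bar>s\<bar>"
        by (rule norm_diff_le_of_line_derivative[where f = \<psi> and f' = "\<lambda>x. dir_deriv b \<psi> x"])
           (use has_line_derivative[where s = 0, simplified, OF test_functionD(4)[OF t1]] M(2) in auto)
      also have "\<dots> \<le> M * \<bar>h\<bar>" using s M(1) by (intro mult_left_mono) auto
      finally show "onorm (\<lambda>k. k *\<^sub>R (\<psi> (x + s *\<^sub>R b) - \<psi> x)) \<le> M * \<bar>h\<bar>"
        by (intro onorm_le) (simp add: mult.commute[of "M * \<bar>h\<bar>"] mult_left_mono)
    qed auto
    then show ?thesis by (simp add: E_def power2_eq_square algebra_simps)
  qed
  have sq: "square_integrable \<phi>" "square_integrable \<psi>" "square_integrable (\<lambda>x. \<phi> (x + h *\<^sub>R b))" for h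
    by (rule square_integrable_test_function[OF t] square_integrable_test_function[OF t1]
        square_integrable_translate[OF square_integrable_test_function[OF t]])+
  have "norm (abs_L2 (\<lambda>x. \<phi> (x + h *\<^sub>R b)) - abs_L2 \<phi> - h *\<^sub>R abs_L2 \<psi>)
      \<le> (M * sqrt (measure lebesgue (cball (0::'a) (R + 1)))) * h\<^sup>2" if h: "\<bar>h\<bar> \<le> 1" for h
  proof -
    have "abs_L2 (\<lambda>x. \<phi> (x + h *\<^sub>R b)) - abs_L2 \<phi> - h *\<^sub>R abs_L2 \<psi> = abs_L2 (E h)"
      unfolding E_def[abs_def]
      by (simp add: abs_diff abs_scaleR sq square_integrable_diff square_integrable_scaleR)
    also have "norm \<dots> \<le> (M * h\<^sup>2) * sqrt (measure lebesgue (cball (0::'a) (R + 1)))"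
    proof (rule norm_abs_L2_le_cball)
      show "square_integrable (E h)" unfolding E_def[abs_def]
        by (intro square_integrable_diff square_integrable_scaleR sq)
      show "norm (E h x) \<le> M * h\<^sup>2" for x by (rule E)
      show "E h x = 0" if x: "norm x > R + 1" for x
      proof -
        have "norm (x + h *\<^sub>R b) > R" using norm_triangle_ineq4[of "x + h *\<^sub>R b" "h *\<^sub>R b"] x h nb by simp
        then show ?thesis using R x by (simp add: E_def)
      qed
      show "0 \<le> M * h\<^sup>2" using M(1) by simp
    qed
    finally show ?thesis by (simp add: mult_ac)
  qed
  then show ?thesis using M(1) unfolding \<psi>_def by (intro exI[of _ "M * sqrt (measure lebesgue (cball (0::'a) (R + 1)))"]) simp
qed

lemma test_function_path_derivative:
  fixes \<phi> :: "'a::euclidean_space \<Rightarrow> complex"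
  assumes t: "test_function \<phi>" and b: "b \<in> Basis"
  shows "((\<lambda>s. abs_L2 (\<lambda>x. \<phi> (x + s *\<^sub>R b))) has_vector_derivative
    abs_L2 (\<lambda>x. dir_deriv b \<phi> (x + s *\<^sub>R b))) (at s)"
proof -
  define \<psi> where "\<psi> x = \<phi> (x + s *\<^sub>R b)" for x
  have t': "test_function \<psi>" unfolding \<psi>_def[abs_def] by (rule test_function_translate(1)[OF t])
  have d: "dir_deriv b \<psi> x = dir_deriv b \<phi> (x + s *\<^sub>R b)" for x
    unfolding \<psi>_def[abs_def] by (simp add: test_function_translate(2)[OF t])
  obtain C where C: "C \<ge> 0" "\<And>h. \<bar>h\<bar> \<le> 1 \<Longrightarrow> norm (abs_L2 (\<lambda>x. \<psi> (x + h *\<^sub>R b)) - abs_L2 \<psi>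
    - h *\<^sub>R abs_L2 (\<lambda>x. dir_deriv b \<psi> x)) \<le> C * h\<^sup>2"
    using test_function_taylor[OF t' b] by blast
  let ?E = "\<lambda>h. norm (abs_L2 (\<lambda>x. \<phi> (x + (s + h) *\<^sub>R b)) - abs_L2 (\<lambda>x. \<phi> (x + s *\<^sub>R b))
      - h *\<^sub>R abs_L2 (\<lambda>x. dir_deriv b \<phi> (x + s *\<^sub>R b))) / norm h"
  have "(?E \<longlongrightarrow> 0) (at 0)"
  proof (rule tendsto_sandwich[of "\<lambda>_. 0" _ _ "\<lambda>h. C * \<bar>h\<bar>"])
    show "((\<lambda>h. C * \<bar>h\<bar>) \<longlongrightarrow> 0) (at 0)" by (auto intro!: tendsto_eq_intros)
    have "?E h \<le> C * \<bar>h\<bar>" if "h \<noteq> 0" "\<bar>h\<bar> < 1" for h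
    proof -
      have "(\<lambda>x. \<phi> (x + (s + h) *\<^sub>R b)) = (\<lambda>x. \<psi> (x + h *\<^sub>R b))" by (simp add: \<psi>_def algebra_simps)
      then show ?thesis
        using C(2)[of h] that by (simp add: d \<psi>_def[symmetric] pos_divide_le_eq power2_eq_square mult.assoc)
    qed
    then show "\<forall>\<^sub>F h in at 0. ?E h \<le> C * \<bar>h\<bar>"
      unfolding eventually_at by (intro exI[of _ 1]) auto
  qed (auto intro!: always_eventually)
  then show ?thesis
    unfolding has_vector_derivative_def has_derivative_at by (intro conjI bounded_linear_scaleR_left)
qed

text \<open>\<open>has_weak_partial\<close> pairs functions without conjugation, whereas the inner
  product conjugates its second argument; testing with the conjugate of \<open>\<phi>\<close>
  reconciles the two.\<close>

lemma weak_partial_inner: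
  assumes w: "has_weak_partial b u v" and b: "b \<in> Basis" and t: "test_function \<phi>"
  shows "u \<bullet> abs_L2 (\<lambda>x. dir_deriv b \<phi> x) = - (v \<bullet> abs_L2 \<phi>)"
proof -
  have inner: "w \<bullet> abs_L2 \<psi> = Re (\<integral>x. rep_L2 w x * cnj (\<psi> x) \<partial>lebesgue)" if t: "test_function \<psi>" for w :: "'a L2" and \<psi>
  proof -
    have "w \<bullet> abs_L2 \<psi> = (\<integral>x. rep_L2 w x \<bullet> \<psi> x \<partial>lebesgue)"
      using inner_abs[OF square_integrable_rep[of w] square_integrable_test_function[OF t]] by simp
    also have "\<dots> = (\<integral>x. Re (rep_L2 w x * cnj (\<psi> x)) \<partial>lebesgue)" by (simp add: inner_complex_def)
    also have "\<dots> = Re (\<integral>x. rep_L2 w x * cnj (\<psi> x) \<partial>lebesgue)"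
      by (rule integral_bounded_linear[OF bounded_linear_Re weak_partial_integrable(1)[OF test_function_cnj(1)[OF t]]])
    finally show ?thesis .
  qed
  have "(\<integral>x. rep_L2 u x * cnj (dir_deriv b \<phi> x) \<partial>lebesgue) = - (\<integral>x. rep_L2 v x * cnj (\<phi> x) \<partial>lebesgue)"
    using w[unfolded has_weak_partial_def, rule_format, OF test_function_cnj(1)[OF t]]
    by (simp add: test_function_cnj(2)[OF t])
  then show ?thesis by (simp add: inner[OF t] inner[OF test_function_partial[OF t b]])
qed

lemma inner_path_derivative:
  assumes w: "has_weak_partial b u v" and b: "b \<in> Basis" and t: "test_function \<phi>"
  shows "((\<lambda>s. u \<bullet> abs_L2 (\<lambda>x. \<phi> (x + s *\<^sub>R b))) has_real_derivative - (v \<bullet> abs_L2 (\<lambda>x. \<phi> (x + s *\<^sub>R b)))) (at s)"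
proof -
  have "((\<lambda>s. u \<bullet> abs_L2 (\<lambda>x. \<phi> (x + s *\<^sub>R b))) has_vector_derivative
    u \<bullet> abs_L2 (\<lambda>x. dir_deriv b \<phi> (x + s *\<^sub>R b))) (at s)"
    by (rule bounded_linear.has_vector_derivative[OF bounded_linear_inner_right test_function_path_derivative[OF t b]])
  moreover have "u \<bullet> abs_L2 (\<lambda>x. dir_deriv b \<phi> (x + s *\<^sub>R b)) = - (v \<bullet> abs_L2 (\<lambda>x. \<phi> (x + s *\<^sub>R b)))"
    using weak_partial_inner[OF w b test_function_translate(1)[OF t, of "s *\<^sub>R b"]]
    by (simp add: test_function_translate(2)[OF t])
  ultimately show ?thesis by (simp add: has_real_derivative_iff_has_vector_derivative)
qed

lemma shift_diff_inner_test:
  assumes "test_function \<phi>"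
  shows "(shift_L2 (h *\<^sub>R b) u - u) \<bullet> abs_L2 \<phi> = u \<bullet> abs_L2 (\<lambda>x. \<phi> (x + (- h) *\<^sub>R b)) - u \<bullet> abs_L2 (\<lambda>x. \<phi> (x + 0 *\<^sub>R b))"
  by (simp add: inner_diff_left inner_shift shift_abs square_integrable_test_function assms)

text \<open>Against a test function the shift can be moved to the other side, where
  \<open>inner_path_derivative\<close> bounds the rate of change by \<open>norm v\<close> times the
  norm of the test function. Density then lets the difference be tested against itself.\<close>

lemma norm_shift_diff_le:
  assumes w: "has_weak_partial b u v" and b: "b \<in> Basis"
  shows "norm (shift_L2 (h *\<^sub>R b) u - u) \<le> \<bar>h\<bar> * norm v"
proof -
  define D where "D = shift_L2 (h *\<^sub>R b) u - u"
  have test: "D \<bullet> abs_L2 \<phi> \<le> \<bar>h\<bar> * norm v * norm (abs_L2 \<phi>)" if t: "test_function \<phi>" for \<phi>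
  proof -
    let ?g = "\<lambda>s. u \<bullet> abs_L2 (\<lambda>x. \<phi> (x + s *\<^sub>R b))"
    have "norm (?g (- h) - ?g 0) \<le> (norm v * norm (abs_L2 \<phi>)) * norm (- h - 0)"
    proof (rule field_differentiable_bound[where S = UNIV])
      show "(?g has_real_derivative - (v \<bullet> abs_L2 (\<lambda>x. \<phi> (x + s *\<^sub>R b)))) (at s within UNIV)" for s
        using inner_path_derivative[OF w b t] by simp
      show "norm (- (v \<bullet> abs_L2 (\<lambda>x. \<phi> (x + s *\<^sub>R b)))) \<le> norm v * norm (abs_L2 \<phi>)" for s
        using Cauchy_Schwarz_ineq2[of v "abs_L2 (\<lambda>x. \<phi> (x + s *\<^sub>R b))"] norm_shift[of "s *\<^sub>R b" "abs_L2 \<phi>"]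
        by (simp add: shift_abs square_integrable_test_function t)
    qed auto
    then show ?thesis unfolding D_def shift_diff_inner_test[OF t] by (simp add: mult_ac)
  qed
  have "closed {y. D \<bullet> y \<le> \<bar>h\<bar> * norm v * norm y}" by (intro closed_Collect_le continuous_intros)
  then have "closure {abs_L2 \<phi> | \<phi>. test_function \<phi>} \<subseteq> {y. D \<bullet> y \<le> \<bar>h\<bar> * norm v * norm y}"
    using test by (intro closure_minimal) auto
  then have "D \<bullet> D \<le> \<bar>h\<bar> * norm v * norm D" unfolding closure_test_functions by blast
  then have "norm D * norm D \<le> \<bar>h\<bar> * norm v * norm D" by (simp add: power2_norm_eq_inner flip: power2_eq_square)
  then have "norm D \<le> \<bar>h\<bar> * norm v" by (cases "norm D = 0") (auto simp: mult_le_cancel_right)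
  then show ?thesis by (simp add: D_def)
qed

text \<open>On test functions this is the derivative of the translated path at 0; the uniform bound
  \<open>norm v\<close> on the quotients extends the limit to every \<open>y\<close>.\<close>

lemma weak_difference_quotient:
  fixes b :: "'a::euclidean_space"
  assumes w: "has_weak_partial b u v" and b: "b \<in> Basis" and h: "h \<longlonglongrightarrow> 0" "\<And>n::nat. h n \<noteq> 0"
  shows "(\<lambda>n. ((shift_L2 (h n *\<^sub>R b) u - u) /\<^sub>R h n) \<bullet> y) \<longlonglongrightarrow> v \<bullet> y"
proof (rule weak_limit_on_dense[OF _ closure_test_functions])
  show "norm ((shift_L2 (h n *\<^sub>R b) u - u) /\<^sub>R h n) \<le> norm v" for n
    using norm_shift_diff_le[OF w b, of "h n"] h(2)[of n]
    by (simp add: divide_inverse[symmetric] mult.commute[of "inverse \<bar>h n\<bar>"] pos_divide_le_eq mult.commute[of "norm v"])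
  fix s :: "'a L2" assume "s \<in> {abs_L2 \<phi> | \<phi>. test_function \<phi>}"
  then obtain \<phi> where s: "s = abs_L2 \<phi>" and t: "test_function \<phi>" by blast
  let ?g = "\<lambda>s. u \<bullet> abs_L2 (\<lambda>x. \<phi> (x + s *\<^sub>R b))"
  have "((\<lambda>k. (?g (0 + k) - ?g 0) / k) \<longlongrightarrow> - (v \<bullet> s)) (at 0)"
    using inner_path_derivative[OF w b t, of 0] unfolding DERIV_def by (simp add: s)
  \<comment> \<open>Moving the shift to the test function reverses its direction, hence the sequence
    \<open>- h n\<close>.\<close>
  moreover have "filterlim (\<lambda>n. - h n) (at 0) sequentially"
    unfolding filterlim_at using h tendsto_minus[OF h(1)] by auto
  ultimately have "(\<lambda>n. (?g (0 + - h n) - ?g 0) / - h n) \<longlonglongrightarrow> - (v \<bullet> s)" by (rule filterlim_compose)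
  then have "(\<lambda>n. - ((?g (0 + - h n) - ?g 0) / - h n)) \<longlonglongrightarrow> - (- (v \<bullet> s))" by (rule tendsto_minus)
  moreover have "((shift_L2 (h n *\<^sub>R b) u - u) /\<^sub>R h n) \<bullet> s = - ((?g (0 + - h n) - ?g 0) / - h n)" for n
    unfolding s inner_scaleR_left shift_diff_inner_test[OF t] by (simp add: divide_inverse mult.commute)
  ultimately show "(\<lambda>n. ((shift_L2 (h n *\<^sub>R b) u - u) /\<^sub>R h n) \<bullet> s) \<longlonglongrightarrow> v \<bullet> s" by simp
qed

text \<open>Translations are orthogonal and the adjoint of a shift is the opposite shift, so
  difference quotients are skew to each other before the limit. Neither vector has to be
  approximated by smooth ones in a Sobolev norm.\<close>

lemma weak_partial_skew:
  assumes u: "has_weak_partial b u u'" and w: "has_weak_partial b w w'" and b: "b \<in> Basis"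
  shows "u' \<bullet> w = - (u \<bullet> w')"
proof -
  define h where "h n = inverse (real (Suc n))" for n
  have h: "h \<longlonglongrightarrow> 0" "h n \<noteq> 0" for n unfolding h_def using LIMSEQ_inverse_real_of_nat by auto
  have mh: "(\<lambda>n. - h n) \<longlonglongrightarrow> 0" "- h n \<noteq> 0" for n using tendsto_minus[OF h(1)] h(2) by auto
  have 1: "(\<lambda>n. ((shift_L2 (h n *\<^sub>R b) u - u) /\<^sub>R h n) \<bullet> w) \<longlonglongrightarrow> u' \<bullet> w"
    by (rule weak_difference_quotient[OF u b h])
  have 2: "((shift_L2 (h n *\<^sub>R b) u - u) /\<^sub>R h n) \<bullet> w = - (((shift_L2 ((- h n) *\<^sub>R b) w - w) /\<^sub>R (- h n)) \<bullet> u)" for n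
    using inner_shift[of "h n *\<^sub>R b" u w] inner_commute[of "shift_L2 (- (h n *\<^sub>R b)) w" u] inner_commute[of w u]
    by (simp add: inner_diff_left)
  have "(\<lambda>n. - (((shift_L2 ((- h n) *\<^sub>R b) w - w) /\<^sub>R (- h n)) \<bullet> u)) \<longlonglongrightarrow> - (w' \<bullet> u)"
    by (intro tendsto_minus weak_difference_quotient[OF w b mh])
  then have "u' \<bullet> w = - (w' \<bullet> u)" unfolding 2[symmetric] by (rule LIMSEQ_unique[OF 1])
  then show ?thesis by (simp add: inner_commute)
qed

section \<open>The free operator\<close>

lemma sobolev_H2D:
  assumes "u \<in> sobolev_H2" "b \<in> Basis"
  shows "has_weak_partial b u (weak_partial b u)"
    "c \<in> Basis \<Longrightarrow> has_weak_partial c (weak_partial b u) (weak_partial c (weak_partial b u))"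
proof -
  obtain v where v: "has_weak_partial b u v" "\<And>c. c \<in> Basis \<Longrightarrow> \<exists>w. has_weak_partial c v w"
    using assms unfolding sobolev_H2_def by blast
  have e: "weak_partial b u = v" by (rule weak_partial_eq[OF v(1)])
  show "has_weak_partial b u (weak_partial b u)" using v(1) e by simp
  assume "c \<in> Basis"
  then obtain w where "has_weak_partial c v w" using v(2) by blast
  then show "has_weak_partial c (weak_partial b u) (weak_partial c (weak_partial b u))"
    using weak_partial_eq e by metis
qed

lemma sobolev_H2I:
  assumes "\<And>b. b \<in> Basis \<Longrightarrow> has_weak_partial b u (v b)"
    "\<And>b c. b \<in> Basis \<Longrightarrow> c \<in> Basis \<Longrightarrow> has_weak_partial c (v b) (w b c)"
  shows "u \<in> sobolev_H2" "laplacian u = (\<Sum>b\<in>Basis. w b b)"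
proof -
  show "u \<in> sobolev_H2" using assms unfolding sobolev_H2_def by blast
  show "laplacian u = (\<Sum>b\<in>Basis. w b b)"
    unfolding laplacian_def
  proof (rule sum.cong[OF refl])
    fix b :: 'a assume b: "b \<in> Basis"
    show "weak_partial b (weak_partial b u) = w b b"
      unfolding weak_partial_eq[OF assms(1)[OF b]] by (rule weak_partial_eq[OF assms(2)[OF b b]])
  qed
qed

lemma sobolev_H2_add:
  assumes "u \<in> sobolev_H2" "v \<in> sobolev_H2"
  shows "u + v \<in> sobolev_H2" "laplacian (u + v) = laplacian u + laplacian v"
proof -
  note u = sobolev_H2D[OF assms(1)] and v = sobolev_H2D[OF assms(2)]
  note * = sobolev_H2I[where u = "u + v" and v = "\<lambda>b. weak_partial b u + weak_partial b v"
      and w = "\<lambda>b c. weak_partial c (weak_partial b u) + weak_partial c (weak_partial b v)",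
      OF has_weak_partial_add[OF _ u(1) v(1)] has_weak_partial_add[OF _ u(2) v(2)]]
  show "u + v \<in> sobolev_H2" by (rule *)
  show "laplacian (u + v) = laplacian u + laplacian v" using *(2) by (simp add: laplacian_def sum.distrib)
qed

lemma scaleC_sum: "scaleC_L2 c (sum f S) = (\<Sum>i\<in>S. scaleC_L2 c (f i))"
  by (induction S rule: infinite_finite_induct) (auto simp: scaleC_add_right)

lemma sobolev_H2_scaleC:
  assumes "u \<in> sobolev_H2"
  shows "scaleC_L2 c u \<in> sobolev_H2" "laplacian (scaleC_L2 c u) = scaleC_L2 c (laplacian u)"
proof -
  note u = sobolev_H2D[OF assms]
  note * = sobolev_H2I[where u = "scaleC_L2 c u" and v = "\<lambda>b. scaleC_L2 c (weak_partial b u)"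
      and w = "\<lambda>b d. scaleC_L2 c (weak_partial d (weak_partial b u))",
      OF has_weak_partial_scaleC[OF _ u(1)] has_weak_partial_scaleC[OF _ u(2)]]
  show "scaleC_L2 c u \<in> sobolev_H2" by (rule *)
  show "laplacian (scaleC_L2 c u) = scaleC_L2 c (laplacian u)" using *(2) by (simp add: laplacian_def scaleC_sum)
qed

lemma sobolev_H2_cnj:
  assumes "u \<in> sobolev_H2"
  shows "cnj_L2 u \<in> sobolev_H2" "laplacian (cnj_L2 u) = cnj_L2 (laplacian u)"
proof -
  note u = sobolev_H2D[OF assms]
  note * = sobolev_H2I[where u = "cnj_L2 u" and v = "\<lambda>b. cnj_L2 (weak_partial b u)"
      and w = "\<lambda>b d. cnj_L2 (weak_partial d (weak_partial b u))",
      OF has_weak_partial_cnj[OF _ u(1)] has_weak_partial_cnj[OF _ u(2)]]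
  show "cnj_L2 u \<in> sobolev_H2" by (rule *)
  show "laplacian (cnj_L2 u) = cnj_L2 (laplacian u)" using *(2) by (simp add: laplacian_def cnj_L2_sum)
qed

lemma laplacian_symmetric:
  assumes "u \<in> sobolev_H2" "v \<in> sobolev_H2"
  shows "laplacian u \<bullet> v = u \<bullet> laplacian v"
  unfolding laplacian_def inner_sum_left inner_sum_right
proof (rule sum.cong[OF refl])
  fix b :: 'a assume b: "b \<in> Basis"
  note u = sobolev_H2D[OF assms(1) b] and v = sobolev_H2D[OF assms(2) b]
  have "weak_partial b (weak_partial b u) \<bullet> v = - (weak_partial b u \<bullet> weak_partial b v)"
    by (rule weak_partial_skew[OF u(2)[OF b] v(1) b])
  moreover have "weak_partial b u \<bullet> weak_partial b v = - (u \<bullet> weak_partial b (weak_partial b v))"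
    by (rule weak_partial_skew[OF u(1) v(2)[OF b] b])
  ultimately show "weak_partial b (weak_partial b u) \<bullet> v = u \<bullet> weak_partial b (weak_partial b v)" by simp
qed

abbreviation weight_domain :: "'a::euclidean_space L2 set" where
  "weight_domain \<equiv> Domain (mult_operator (\<lambda>x. (jbracket x)\<^sup>2))"

definition laplacian_rel :: "'a::euclidean_space operator" where
  "laplacian_rel = {(u, - laplacian u) | u. u \<in> sobolev_H2 \<and> u \<in> weight_domain}"

text \<open>A relational sum lets linearity, symmetry and conjugation invariance be checked on each
  summand; the weight condition travels with the Laplacian.\<close>

lemma H_pre_eq: "(H_pre \<alpha> :: 'a::euclidean_space operator) = op_plus laplacian_rel (mult_operator (\<lambda>x. - (jbracket x powr \<alpha>)))"
proof -
  have neg: "(u, - w) \<in> mult_operator (\<lambda>x. - V x) \<longleftrightarrow> (u, w) \<in> mult_operator V" for u w :: "'a L2" and V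
  proof -
    have "(AE x in lebesgue. rep_L2 (- w) x = - of_real (V x) * rep_L2 u x)
      \<longleftrightarrow> (AE x in lebesgue. rep_L2 w x = of_real (V x) * rep_L2 u x)"
      by (rule eventually_cong[OF rep_uminus[of w]]) simp
    then show ?thesis by (simp add: mult_operator_def)
  qed
  show ?thesis
  proof (intro equalityI subsetI)
    fix p assume "p \<in> (H_pre \<alpha> :: 'a operator)"
    then obtain u w where p: "p = (u, - laplacian u - w)" "u \<in> sobolev_H2" "u \<in> weight_domain"
      "(u, w) \<in> mult_operator (\<lambda>x. jbracket x powr \<alpha>)" unfolding H_pre_def by blast
    have "(u, - laplacian u) \<in> laplacian_rel" using p unfolding laplacian_rel_def by blast
    moreover have "(u, - w) \<in> mult_operator (\<lambda>x. - (jbracket x powr \<alpha>))" by (simp only: neg p(4))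
    ultimately have "(u, - laplacian u + - w) \<in> op_plus laplacian_rel (mult_operator (\<lambda>x. - (jbracket x powr \<alpha>)))"
      unfolding op_plus_def by blast
    then show "p \<in> op_plus laplacian_rel (mult_operator (\<lambda>x. - (jbracket x powr \<alpha>)))" by (simp add: p(1))
  next
    fix p assume "p \<in> op_plus laplacian_rel (mult_operator (\<lambda>x. - (jbracket x powr \<alpha>)) :: 'a operator)"
    then obtain u w where p: "p = (u, - laplacian u + w)" "u \<in> sobolev_H2" "u \<in> weight_domain"
      "(u, w) \<in> mult_operator (\<lambda>x. - (jbracket x powr \<alpha>))" unfolding op_plus_def laplacian_rel_def by blast
    have "(u, - w) \<in> mult_operator (\<lambda>x. jbracket x powr \<alpha>)" using p(4) neg[of u "- w"] by simp
    moreover have "p = (u, - laplacian u - - w)" using p(1) by simp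
    ultimately show "p \<in> H_pre \<alpha>" unfolding H_pre_def using p(2,3) by blast
  qed
qed

lemma linear_rel_laplacian_rel: "linear_rel laplacian_rel"
  unfolding linear_rel_def
proof (intro conjI allI impI)
  note M = linear_relD[OF linear_rel_mult_operator]
  have scale: "(scaleC_L2 c u, scaleC_L2 c v) \<in> laplacian_rel" if "(u, v) \<in> laplacian_rel" for c and u v :: "'a L2"
  proof -
    have u: "u \<in> sobolev_H2" "u \<in> weight_domain" "v = - laplacian u"
      using that by (auto simp: laplacian_rel_def)
    then obtain w where "(u, w) \<in> mult_operator (\<lambda>x. (jbracket x)\<^sup>2)" by blast
    then have "scaleC_L2 c u \<in> weight_domain" by (rule DomainI[OF M(3)])
    then show ?thesis using sobolev_H2_scaleC[OF u(1), of c] u(3)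
      unfolding laplacian_rel_def by (auto simp: scaleC_minus_right)
  qed
  then show "(u, v) \<in> laplacian_rel \<Longrightarrow> (scaleC_L2 c u, scaleC_L2 c v) \<in> laplacian_rel" for c and u v :: "'a L2" .
  have ex: "(0, 0) \<in> (laplacian_rel :: 'a operator)"
  proof -
    have "has_weak_partial b 0 (0 :: 'a L2)" for b :: 'a
    proof -
      have "(\<integral>x. rep_L2 (0 :: 'a L2) x * g x \<partial>lebesgue) = 0" for g
        by (rule integral_eq_zero_AE) (use rep_zero in \<open>auto elim!: eventually_mono\<close>)
      then show ?thesis by (simp add: has_weak_partial_def)
    qed
    then have "(0 :: 'a L2) \<in> sobolev_H2" "laplacian (0 :: 'a L2) = 0"
      using sobolev_H2I[of "0 :: 'a L2" "\<lambda>_. 0" "\<lambda>_ _. 0"] by auto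
    moreover have "(0 :: 'a L2) \<in> weight_domain" using M(1) by (rule DomainI)
    ultimately show ?thesis unfolding laplacian_rel_def by force
  qed
  then show "(0, 0) \<in> (laplacian_rel :: 'a operator)" .
  fix u v u' v' :: "'a L2"
  assume "(u, v) \<in> laplacian_rel" "(u', v') \<in> laplacian_rel"
  then have u: "u \<in> sobolev_H2" "u \<in> weight_domain" "v = - laplacian u"
      "u' \<in> sobolev_H2" "u' \<in> weight_domain" "v' = - laplacian u'"
    by (auto simp: laplacian_rel_def)
  then obtain w w' where "(u, w) \<in> mult_operator (\<lambda>x. (jbracket x)\<^sup>2)" "(u', w') \<in> mult_operator (\<lambda>x. (jbracket x)\<^sup>2)"
    by blast
  then have "u + u' \<in> weight_domain" by (rule DomainI[OF M(2)])
  then show "(u + u', v + v') \<in> laplacian_rel" using sobolev_H2_add[OF u(1,4)] u(3,6)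
    unfolding laplacian_rel_def by auto
qed

lemma symmetric_rel_laplacian_rel: "symmetric_rel laplacian_rel"
  unfolding symmetric_rel_def laplacian_rel_def by (auto simp: laplacian_symmetric)

lemma cnj_invariant_laplacian_rel: "cnj_invariant laplacian_rel"
  unfolding cnj_invariant_def
proof (intro allI impI)
  fix u v :: "'a L2" assume "(u, v) \<in> laplacian_rel"
  then have u: "u \<in> sobolev_H2" "u \<in> weight_domain" "v = - laplacian u"
    by (auto simp: laplacian_rel_def)
  then have "cnj_L2 u \<in> weight_domain"
    using cnj_invariant_mult_operator unfolding cnj_invariant_def by (metis DomainE DomainI)
  then show "(cnj_L2 u, cnj_L2 v) \<in> laplacian_rel" using sobolev_H2_cnj[OF u(1)] u(3)
    unfolding laplacian_rel_def by (auto simp: cnj_L2_uminus)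
qed

lemma H_free_properties:
  "linear_rel (H_free \<alpha>)" "symmetric_rel (H_free \<alpha>)" "cnj_invariant (H_free \<alpha>)"
  unfolding H_free_def H_pre_eq
  by (intro linear_rel_closure symmetric_rel_closure cnj_invariant_closure linear_rel_op_plus
      symmetric_rel_op_plus cnj_invariant_op_plus linear_rel_mult_operator symmetric_rel_mult_operator
      cnj_invariant_mult_operator linear_rel_laplacian_rel symmetric_rel_laplacian_rel cnj_invariant_laplacian_rel)+

section \<open>Radial functions\<close>

lemma mult_operator_abs_L2:
  fixes f :: "'a::euclidean_space \<Rightarrow> complex"
  assumes "square_integrable f" "square_integrable (\<lambda>x. complex_of_real (m x) * f x)"
  shows "(abs_L2 f, abs_L2 (\<lambda>x. complex_of_real (m x) * f x)) \<in> mult_operator m"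
  unfolding mult_operator_def mem_Collect_eq prod.case
  using rep_abs_L2[OF assms(1)] rep_abs_L2[OF assms(2)] by eventually_elim simp

lemma jbracket_sq: "(jbracket x)\<^sup>2 = 1 + x \<bullet> x"
  by (simp add: jbracket_def powr_half_sqrt power2_norm_eq_inner)

lemma jbracket_powr: "jbracket x powr \<alpha> = (1 + x \<bullet> x) powr (\<alpha> / 2)"
  by (simp add: jbracket_def powr_powr power2_norm_eq_inner)

text \<open>The variable is \<open>s = 1 + x \<bullet> x\<close>, so radial functions stay
  differentiable at the origin and the potential becomes a power of \<open>s\<close>; only
  \<open>s \<ge> 1\<close> is reached. The parameter \<open>tp\<close> fixes the space on which the
  radial function lives, hence the dimension.\<close>

locale radial_profile =
  fixes g g1 g2 :: "real \<Rightarrow> complex" and S :: real and tp :: "'a::euclidean_space itself"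
  assumes g: "\<And>s. s \<ge> 1 \<Longrightarrow> (g has_vector_derivative g1 s) (at s)"
    and g1: "\<And>s. s \<ge> 1 \<Longrightarrow> (g1 has_vector_derivative g2 s) (at s)"
    and g2: "continuous_on {1..} g2"
    and vanish: "\<And>s. s > S \<Longrightarrow> g s = 0" "\<And>s. s > S \<Longrightarrow> g1 s = 0" "\<And>s. s > S \<Longrightarrow> g2 s = 0"
begin

definition f :: "'a \<Rightarrow> complex" where "f x = g (1 + x \<bullet> x)"
definition f1 :: "'a \<Rightarrow> 'a \<Rightarrow> complex" where "f1 b x = (2 * (x \<bullet> b)) *\<^sub>R g1 (1 + x \<bullet> x)"
definition f2 :: "'a \<Rightarrow> 'a \<Rightarrow> 'a \<Rightarrow> complex" where
  "f2 b c x = (2 * (c \<bullet> b)) *\<^sub>R g1 (1 + x \<bullet> x) + (2 * (x \<bullet> b)) *\<^sub>R ((2 * (x \<bullet> c)) *\<^sub>R g2 (1 + x \<bullet> x))"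

lemma der_radial:
  assumes "\<And>s. s \<ge> 1 \<Longrightarrow> (k has_vector_derivative k' s) (at s)"
  shows "((\<lambda>x::'a. k (1 + x \<bullet> x)) has_derivative (\<lambda>h. (2 * (x \<bullet> h)) *\<^sub>R k' (1 + x \<bullet> x))) (at x)"
proof -
  have "(k has_derivative (\<lambda>h. h *\<^sub>R k' (1 + x \<bullet> x))) (at (1 + x \<bullet> x))"
    using assms[of "1 + x \<bullet> x"] by (simp add: has_vector_derivative_def)
  moreover have "((\<lambda>x. 1 + x \<bullet> x) has_derivative (\<lambda>h. 2 * (x \<bullet> h))) (at x)"
    by (auto intro!: derivative_eq_intros simp: inner_commute)
  ultimately show ?thesis
    using has_derivative_compose[of "\<lambda>x. 1 + x \<bullet> x" "\<lambda>h. 2 * (x \<bullet> h)" x UNIV k] by blast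
qed

lemma der_f: "(f has_derivative (\<lambda>h. f1 h x)) (at x)"
  using der_radial[OF g] by (simp add: f_def[abs_def] f1_def)

lemma der_f1: "(f1 b has_derivative (\<lambda>h. f2 b h x)) (at x)"
proof -
  have "((\<lambda>x. (2 * (x \<bullet> b)) *\<^sub>R g1 (1 + x \<bullet> x)) has_derivative
    (\<lambda>h. (2 * (x \<bullet> b)) *\<^sub>R ((2 * (x \<bullet> h)) *\<^sub>R g2 (1 + x \<bullet> x)) + (2 * (h \<bullet> b)) *\<^sub>R g1 (1 + x \<bullet> x))) (at x)"
    by (rule has_derivative_scaleR[OF _ der_radial[OF g1]]) (auto intro!: derivative_eq_intros)
  then show ?thesis by (simp add: f1_def[abs_def] f2_def add.commute)
qed

lemma continuous_radial:
  assumes "continuous_on {1..} k"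
  shows "continuous_on UNIV (\<lambda>x::'a. k (1 + x \<bullet> x))"
  by (rule continuous_on_compose2[OF assms]) (auto intro!: continuous_intros)

lemma continuous_profile: "continuous_on {1..} g" "continuous_on {1..} g1"
  using g g1 by (auto intro!: continuous_at_imp_continuous_on has_vector_derivative_continuous)

lemma continuous_f: "continuous_on UNIV f" "continuous_on UNIV (f1 b)" "continuous_on UNIV (f2 b c)"
  unfolding f_def[abs_def] f1_def[abs_def] f2_def[abs_def]
  by (intro continuous_intros continuous_radial continuous_profile g2)+

lemma large_norm: "norm x > \<bar>S\<bar> + 1 \<Longrightarrow> 1 + x \<bullet> x > S" for x :: 'a
proof -
  assume "norm x > \<bar>S\<bar> + 1"
  then have "norm x * 1 \<le> norm x * norm x" by (intro mult_left_mono) auto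
  then show ?thesis using \<open>norm x > \<bar>S\<bar> + 1\<close> by (simp add: power2_norm_eq_inner[symmetric] power2_eq_square)
qed

lemma f_support: 
  assumes "norm x > \<bar>S\<bar> + 1"
  shows "f x = 0" "f1 b x = 0" "f2 b c x = 0"
  using large_norm[OF assms] by (simp_all add: f_def f1_def f2_def vanish)

lemma square_integrable_times_f:
  assumes "continuous_on UNIV m"
  shows "square_integrable (\<lambda>x. m x * f x)"
  by (rule square_integrable_compact_support[where R = "\<bar>S\<bar> + 1"])
     (auto intro!: continuous_intros continuous_f assms simp: f_support)

lemma square_integrable_f: "square_integrable f" "square_integrable (f2 b c)"
  by (rule square_integrable_compact_support[where R = "\<bar>S\<bar> + 1"]; simp add: continuous_f f_support)+

lemma sobolev: "abs_L2 f \<in> sobolev_H2" and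
  lap: "laplacian (abs_L2 f) = (\<Sum>b\<in>Basis. abs_L2 (f2 b b))"
proof -
  have 1: "has_weak_partial b (abs_L2 f) (abs_L2 (f1 b))" if "b \<in> Basis" for b
    by (rule has_weak_partial_classical[OF that der_f _ f_support(1,2)]) (simp_all add: continuous_f)
  have 2: "has_weak_partial c (abs_L2 (f1 b)) (abs_L2 (f2 b c))" if "c \<in> Basis" for b c
    by (rule has_weak_partial_classical[OF that der_f1 _ f_support(2,3)]) (simp_all add: continuous_f)
  note * = sobolev_H2I[of "abs_L2 f" "\<lambda>b. abs_L2 (f1 b)" "\<lambda>b c. abs_L2 (f2 b c)", OF 1 2]
  show "abs_L2 f \<in> sobolev_H2" "laplacian (abs_L2 f) = (\<Sum>b\<in>Basis. abs_L2 (f2 b b))" by (rule *; assumption)+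
qed

lemma laplacian_f:
  "laplacian (abs_L2 f) = abs_L2 (\<lambda>x. of_nat (2 * DIM('a)) * g1 (1 + x \<bullet> x) + of_real (4 * (x \<bullet> x)) * g2 (1 + x \<bullet> x))"
proof -
  have sum: "finite B \<Longrightarrow> (\<Sum>b\<in>B. abs_L2 (F b)) = abs_L2 (\<lambda>x. \<Sum>b\<in>B. F b x) \<and> square_integrable (\<lambda>x. \<Sum>b\<in>B. F b x)"
    if "\<And>b. square_integrable (F b)" for B :: "'a set" and F :: "'a \<Rightarrow> 'a \<Rightarrow> complex"
    by (induction B rule: finite_induct)
       (auto simp: zero_L2_def square_integrable_zero abs_add that intro: square_integrable_add)
  have "(\<Sum>b\<in>Basis. f2 b b x) = of_nat (2 * DIM('a)) * g1 (1 + x \<bullet> x) + of_real (4 * (x \<bullet> x)) * g2 (1 + x \<bullet> x)" for x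
  proof -
    have "(\<Sum>b\<in>Basis. f2 b b x) = (\<Sum>b\<in>Basis. 2 * g1 (1 + x \<bullet> x) + of_real (4 * ((x \<bullet> b) * (x \<bullet> b))) * g2 (1 + x \<bullet> x))"
      by (rule sum.cong[OF refl]) (simp add: f2_def scaleR_conv_of_real inner_Basis)
    also have "\<dots> = of_nat (2 * DIM('a)) * g1 (1 + x \<bullet> x) + of_real (\<Sum>b\<in>Basis. 4 * ((x \<bullet> b) * (x \<bullet> b))) * g2 (1 + x \<bullet> x)"
      by (simp add: sum.distrib sum_distrib_right)
    also have "(\<Sum>b\<in>Basis. 4 * ((x \<bullet> b) * (x \<bullet> b))) = 4 * (x \<bullet> x)"
      unfolding euclidean_inner[of x x] by (simp add: sum_distrib_left)
    finally show ?thesis .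
  qed
  then show ?thesis unfolding lap using sum[of "\<lambda>b. f2 b b" Basis] square_integrable_f by simp
qed

lemma H_pre_f:
  "(abs_L2 f, abs_L2 (\<lambda>x. - (of_nat (2 * DIM('a)) * g1 (1 + x \<bullet> x) + of_real (4 * (x \<bullet> x)) * g2 (1 + x \<bullet> x))
    - of_real ((1 + x \<bullet> x) powr (\<alpha> / 2) + lam) * f x)) \<in> op_shift (H_pre \<alpha>) (- of_real lam)"
proof -
  let ?l = "\<lambda>x::'a. of_nat (2 * DIM('a)) * g1 (1 + x \<bullet> x) + of_real (4 * (x \<bullet> x)) * g2 (1 + x \<bullet> x)"
  let ?v = "\<lambda>x::'a. complex_of_real (jbracket x powr \<alpha>) * f x"
  have cl: "continuous_on UNIV ?l"
    by (intro continuous_intros continuous_radial continuous_profile g2)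
  have sl: "square_integrable ?l"
    by (rule square_integrable_compact_support[OF cl, of "\<bar>S\<bar> + 1"]) (simp add: large_norm vanish)
  have pos: "1 + x \<bullet> x \<noteq> 0" for x :: 'a using inner_ge_zero[of x] by linarith
  have sv: "square_integrable ?v" unfolding jbracket_powr
    by (rule square_integrable_times_f) (auto intro!: continuous_intros simp: pos)
  have s2: "square_integrable (\<lambda>x. complex_of_real ((jbracket x)\<^sup>2) * f x)" unfolding jbracket_sq
    by (rule square_integrable_times_f) (auto intro!: continuous_intros)
  have "(abs_L2 f, - laplacian (abs_L2 f) - abs_L2 ?v) \<in> H_pre \<alpha>"
    unfolding H_pre_def using sobolev mult_operator_abs_L2[OF square_integrable_f(1) sv]
      mult_operator_abs_L2[OF square_integrable_f(1) s2] by blast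
  then have "(abs_L2 f, - laplacian (abs_L2 f) - abs_L2 ?v - scaleC_L2 (of_real lam) (abs_L2 f)) \<in> op_shift (H_pre \<alpha>) (- of_real lam)"
    by (simp add: op_shift_iff scaleC_minus_left)
  also have "- laplacian (abs_L2 f) - abs_L2 ?v - scaleC_L2 (of_real lam) (abs_L2 f)
    = abs_L2 (\<lambda>x. - ?l x - ?v x - of_real lam * f x)"
  proof -
    have "- laplacian (abs_L2 f) = abs_L2 (\<lambda>x. - ?l x)"
      unfolding laplacian_f using abs_scaleR[OF sl, of "-1"] by simp
    then show ?thesis
      by (simp only: abs_diff abs_scaleC square_integrable_f(1) sv square_integrable_uminus[OF sl]
          square_integrable_diff square_integrable_mult)
  qed
  also have "(\<lambda>x. - ?l x - ?v x - of_real lam * f x) = (\<lambda>x. - ?l x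
    - of_real ((1 + x \<bullet> x) powr (\<alpha> / 2) + lam) * f x)"
    by (auto simp: jbracket_powr algebra_simps)
  finally show ?thesis .
qed

end

section \<open>Phase and cutoff\<close>

lemma cutoff_exists:
  obtains k0 k1 k2 :: "real \<Rightarrow> real" and C c :: real
  where "\<And>s. (k0 has_real_derivative k1 s) (at s)" "\<And>s. (k1 has_real_derivative k2 s) (at s)"
    "continuous_on UNIV k2" "C > 0" "\<And>s. \<bar>k0 s\<bar> \<le> C" "\<And>s. \<bar>k1 s\<bar> \<le> C" "\<And>s. \<bar>k2 s\<bar> \<le> C"
    "\<And>s. s \<notin> {1<..<4} \<Longrightarrow> k0 s = 0 \<and> k1 s = 0 \<and> k2 s = 0"
    "c > 0" "\<And>s. s \<in> {2..3} \<Longrightarrow> k0 s \<ge> c"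
proof -
  define D :: "real poly \<Rightarrow> real poly" where "D p = pCons 0 (pCons 0 (p - pderiv p))" for p
  \<comment> \<open>\<open>q\<close> is positive exactly on the interval from 1 to 4 and at least 1
    on \<open>{2..3}\<close>, where the cutoff is therefore at least \<open>exp (- 1)\<close>; the
    factor \<open>5 - 2 * s\<close> below is its derivative.\<close>
  define q :: "real \<Rightarrow> real" where "q s = (s - 1) * (4 - s)" for s
  define k0 where "k0 s = flat 1 (q s)" for s
  define k1 where "k1 s = flat (D 1) (q s) * (5 - 2 * s)" for s
  define k2 where "k2 s = flat (D (D 1)) (q s) * (5 - 2 * s) * (5 - 2 * s) + flat (D 1) (q s) * (- 2)" for s
  have fl: "(flat p has_real_derivative flat (D p) t) (at t)" for p t unfolding D_def by (rule flat_deriv)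
  have q: "(q has_real_derivative (5 - 2 * s)) (at s)" for s
    unfolding q_def[abs_def] by (auto intro!: derivative_eq_intros)
  have flq: "((\<lambda>s. flat p (q s)) has_real_derivative flat (D p) (q s) * (5 - 2 * s)) (at s)" for p s
    using DERIV_chain2[OF fl q] .
  have d0: "(k0 has_real_derivative k1 s) (at s)" for s unfolding k0_def[abs_def] k1_def by (rule flq)
  have d1: "(k1 has_real_derivative k2 s) (at s)" for s
    unfolding k1_def[abs_def] k2_def by (rule derivative_eq_intros flq refl | simp)+
  have cflat: "continuous_on UNIV (\<lambda>s. flat p (q s))" for p
    using flq DERIV_isCont by (blast intro: continuous_at_imp_continuous_on)
  have c2: "continuous_on UNIV k2" unfolding k2_def[abs_def] by (intro continuous_intros cflat)
  have c1: "continuous_on UNIV k1" unfolding k1_def[abs_def] by (intro continuous_intros cflat)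
  have c0: "continuous_on UNIV k0" unfolding k0_def[abs_def] by (intro cflat)
  have z: "k0 s = 0 \<and> k1 s = 0 \<and> k2 s = 0" if "s \<notin> {1<..<4}" for s
  proof -
    have "s \<le> 1 \<or> s \<ge> 4" using that by auto
    then have "q s \<le> 0" unfolding q_def by (auto simp: mult_le_0_iff)
    then have "flat p (q s) = 0" for p by (simp add: flat_def)
    then show ?thesis by (simp add: k0_def k1_def k2_def)
  qed
  have sup: "\<And>s. norm s > 4 \<Longrightarrow> k0 s = 0" "\<And>s. norm s > 4 \<Longrightarrow> k1 s = 0" "\<And>s. norm s > 4 \<Longrightarrow> k2 s = 0"
    using z by (auto simp: abs_if split: if_splits)
  obtain C0 where C0: "C0 \<ge> 0" "\<And>s. norm (k0 s) \<le> C0" using bounded_compact_support[OF c0 sup(1)] by blast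
  obtain C1 where C1: "C1 \<ge> 0" "\<And>s. norm (k1 s) \<le> C1" using bounded_compact_support[OF c1 sup(2)] by blast
  obtain C2 where C2: "C2 \<ge> 0" "\<And>s. norm (k2 s) \<le> C2" using bounded_compact_support[OF c2 sup(3)] by blast
  have low: "k0 s \<ge> exp (- 1)" if "s \<in> {2..3}" for s
  proof -
    have "(s - 1) * (4 - s) \<ge> 1 * 1" using that by (intro mult_mono) auto
    then have "q s \<ge> 1" by (simp add: q_def)
    then show ?thesis by (simp add: k0_def flat_1)
  qed
  show thesis
  proof (rule that[OF d0 d1 c2 _ _ _ _ z _ low])
    show "C0 + C1 + C2 + 1 > 0" using C0(1) C1(1) C2(1) by linarith
    show "\<bar>k0 s\<bar> \<le> C0 + C1 + C2 + 1" for s using C0(1) C0(2)[of s] C1(1) C2(1) by simp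
    show "\<bar>k1 s\<bar> \<le> C0 + C1 + C2 + 1" for s using C0(1) C1(2)[of s] C1(1) C2(1) by simp
    show "\<bar>k2 s\<bar> \<le> C0 + C1 + C2 + 1" for s using C0(1) C2(2)[of s] C1(1) C2(1) by simp
  qed auto
qed

text \<open>In the variable \<open>s = 1 + |x|\<^sup>2\<close> the eikonal equation reads
  \<open>4 (s - 1) \<Phi>'\<^sup>2 = s powr (\<alpha> / 2) + lam\<close>. It is solved up to an error tending to \<open>0\<close> by expanding
  the square root, which is where \<open>\<alpha> < 2\<close> enters.\<close>

lemma phase_exists:
  fixes \<alpha> lam :: real
  assumes \<alpha>: "0 < \<alpha>" "\<alpha> < 2"
  obtains \<Phi> \<Phi>1 \<Phi>2 :: "real \<Rightarrow> real"
  where "\<And>s. s > 0 \<Longrightarrow> (\<Phi> has_real_derivative \<Phi>1 s) (at s)"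
    "\<And>s. s > 0 \<Longrightarrow> (\<Phi>1 has_real_derivative \<Phi>2 s) (at s)" "continuous_on {0<..} \<Phi>2"
    "(\<Phi>1 \<longlongrightarrow> 0) at_top" "((\<lambda>s. s * \<Phi>2 s) \<longlongrightarrow> 0) at_top"
    "((\<lambda>s. 4 * (s - 1) * (\<Phi>1 s)\<^sup>2 - s powr (\<alpha> / 2) - lam) \<longlongrightarrow> 0) at_top"
proof -
  \<comment> \<open>The first two terms in the expansion of
    \<open>sqrt ((s powr (\<alpha> / 2) + lam) / (4 * s))\<close> carry the exponents
    \<open>p\<close> and \<open>q\<close> and the coefficients \<open>1 / 2\<close> and
    \<open>lam / 4\<close>. Both exponents lie strictly between -1 and 0, so the antiderivatives are
    powers as well, and \<open>p + q = - 1\<close>.\<close>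
  define p where "p = \<alpha> / 4 - 1 / 2"
  define q where "q = - \<alpha> / 4 - 1 / 2"
  have pq: "p < 0" "q < 0" "p \<noteq> -1" "q \<noteq> -1" using \<alpha> by (auto simp: p_def q_def)
  define \<Phi> where "\<Phi> s = 1 / 2 * (s powr (p + 1) / (p + 1)) + lam / 4 * (s powr (q + 1) / (q + 1))" for s :: real
  define \<Phi>1 where "\<Phi>1 s = 1 / 2 * s powr p + lam / 4 * s powr q" for s :: real
  define \<Phi>2 where "\<Phi>2 s = 1 / 2 * p * s powr (p - 1) + lam / 4 * q * s powr (q - 1)" for s :: real
  have powr: "((\<lambda>s. s powr r) has_real_derivative r * s powr (r - 1)) (at s)" if "s > 0" for r s :: real
    using has_real_derivative_powr[OF that, of r] .
  have d0: "(\<Phi> has_real_derivative \<Phi>1 s) (at s)" if "s > 0" for s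
  proof -
    have "p + 1 \<noteq> 0" "q + 1 \<noteq> 0" using pq by auto
    then have "((\<lambda>s. s powr (r + 1) / (r + 1)) has_real_derivative s powr r) (at s)" if "r \<in> {p, q}" for r
      using DERIV_cdivide[OF powr[OF \<open>s > 0\<close>, of "r + 1"], of "r + 1"] that by auto
    then show ?thesis unfolding \<Phi>_def[abs_def] \<Phi>1_def by (intro DERIV_add DERIV_cmult) auto
  qed
  have d1: "(\<Phi>1 has_real_derivative \<Phi>2 s) (at s)" if "s > 0" for s
    unfolding \<Phi>1_def[abs_def] \<Phi>2_def mult.assoc by (intro DERIV_add DERIV_cmult powr that)
  have c2: "continuous_on {0<..} \<Phi>2" unfolding \<Phi>2_def[abs_def] by (auto intro!: continuous_intros)
  have tp: "((\<lambda>s::real. s powr r) \<longlongrightarrow> 0) at_top" if "r < 0" for r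
    using that by (rule tendsto_neg_powr) (rule filterlim_ident)
  have "(\<Phi>1 \<longlongrightarrow> 1 / 2 * 0 + lam / 4 * 0) at_top" unfolding \<Phi>1_def[abs_def]
    by (intro tendsto_add tendsto_mult tendsto_const tp pq)
  then have l1: "(\<Phi>1 \<longlongrightarrow> 0) at_top" by simp
  have "((\<lambda>s. 1 / 2 * p * s powr p + lam / 4 * q * s powr q) \<longlongrightarrow> 1 / 2 * p * 0 + lam / 4 * q * 0) at_top"
    by (intro tendsto_add tendsto_mult tendsto_const tp pq)
  then have "((\<lambda>s. 1 / 2 * p * s powr p + lam / 4 * q * s powr q) \<longlongrightarrow> 0) at_top" by simp
  then have l2: "((\<lambda>s. s * \<Phi>2 s) \<longlongrightarrow> 0) at_top"
  proof (rule Lim_transform_eventually)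
    show "\<forall>\<^sub>F s in at_top. 1 / 2 * p * s powr p + lam / 4 * q * s powr q = s * \<Phi>2 s"
      using eventually_gt_at_top[of 0]
      by eventually_elim (simp add: \<Phi>2_def powr_diff field_simps)
  qed
  \<comment> \<open>The exact error: the square of the second term of the expansion, which decays
    since \<open>\<alpha> > 0\<close>, minus what replacing \<open>s - 1\<close> by \<open>s\<close>
    costs, which decays since \<open>\<alpha> < 2\<close>.\<close>
  have "((\<lambda>s. lam\<^sup>2 / 4 * s powr (- \<alpha> / 2) - 4 * (\<Phi>1 s)\<^sup>2) \<longlongrightarrow> lam\<^sup>2 / 4 * 0 - 4 * 0\<^sup>2) at_top"
    using \<alpha> by (intro tendsto_intros tp l1) simp
  then have "((\<lambda>s. lam\<^sup>2 / 4 * s powr (- \<alpha> / 2) - 4 * (\<Phi>1 s)\<^sup>2) \<longlongrightarrow> 0) at_top" by simp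
  then have l3: "((\<lambda>s. 4 * (s - 1) * (\<Phi>1 s)\<^sup>2 - s powr (\<alpha> / 2) - lam) \<longlongrightarrow> 0) at_top"
  proof (rule Lim_transform_eventually)
    show "\<forall>\<^sub>F s in at_top. lam\<^sup>2 / 4 * s powr (- \<alpha> / 2) - 4 * (\<Phi>1 s)\<^sup>2
      = 4 * (s - 1) * (\<Phi>1 s)\<^sup>2 - s powr (\<alpha> / 2) - lam"
      using eventually_gt_at_top[of 0]
    proof eventually_elim
      case (elim s)
      have pp: "s * (s powr p * s powr p) = s powr (\<alpha> / 2)" "s * (s powr p * s powr q) = 1"
        "s * (s powr q * s powr q) = s powr (- \<alpha> / 2)"
        using elim powr_add[of s 1 "p + p"] powr_add[of s 1 "p + q"] powr_add[of s 1 "q + q"]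
        by (simp_all add: powr_add[symmetric] p_def q_def)
      have "4 * s * (\<Phi>1 s)\<^sup>2 = s * (s powr p * s powr p) + lam * (s * (s powr p * s powr q)) + lam\<^sup>2 / 4 * (s * (s powr q * s powr q))"
        by (simp add: \<Phi>1_def power2_eq_square algebra_simps)
      also have "\<dots> = s powr (\<alpha> / 2) + lam + lam\<^sup>2 / 4 * s powr (- \<alpha> / 2)" unfolding pp by simp
      finally show ?case by (simp add: algebra_simps)
    qed
  qed
  show thesis by (rule that[OF d0 d1 c2 l1 l2 l3])
qed

section \<open>Singular sequences\<close>

text \<open>\<open>h\<close> is the image of \<open>f\<close> under the free operator minus
  \<open>lam\<close>, and \<open>\<delta>\<close> bounds its relative size; no normalization is
  imposed yet. A function \<open>f\<close> is kept rather than only its class, so that disjointness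
  of supports can be read off pointwise.\<close>

definition quasimode :: "real \<Rightarrow> real \<Rightarrow> real \<Rightarrow> real \<Rightarrow> ('a::euclidean_space \<Rightarrow> complex) \<Rightarrow> 'a L2 \<Rightarrow> bool" where
  "quasimode \<alpha> lam \<delta> \<rho> f h \<longleftrightarrow> square_integrable f \<and> (abs_L2 f, h) \<in> op_shift (H_pre \<alpha>) (- of_real lam)
    \<and> (\<forall>x. f x \<noteq> 0 \<longrightarrow> \<rho> < 1 + x \<bullet> x \<and> 1 + x \<bullet> x < 4 * \<rho>)
    \<and> abs_L2 f \<noteq> 0 \<and> norm h \<le> \<delta> * norm (abs_L2 f)"

text \<open>The error is at most \<open>\<epsilon>\<close> pointwise and lives on a ball of radius
  \<open>2 * sqrt \<rho>\<close>, while \<open>|f|\<close> is at least \<open>c\<close> on a ball of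
  radius \<open>sqrt \<rho> / 10\<close>. The ratio of the volumes does not depend on
  \<open>\<rho>\<close>, hence neither does \<open>K\<close>.\<close>

lemma quasimode_exists:
  fixes \<alpha> lam :: real
  assumes \<alpha>: "0 < \<alpha>" "\<alpha> < 2"
  shows "\<exists>K>0. \<forall>\<epsilon>>0. \<exists>\<rho>0. \<forall>\<rho>\<ge>\<rho>0. \<exists>(f :: 'a::euclidean_space \<Rightarrow> complex) h. quasimode \<alpha> lam (\<epsilon> * K) \<rho> f h"
proof -
  obtain k0 k1 k2 :: "real \<Rightarrow> real" and C c :: real
    where k0: "\<And>s. (k0 has_real_derivative k1 s) (at s)" "\<And>s. (k1 has_real_derivative k2 s) (at s)"
    "continuous_on UNIV k2" and C: "C > 0" "\<And>s. \<bar>k0 s\<bar> \<le> C" "\<And>s. \<bar>k1 s\<bar> \<le> C" "\<And>s. \<bar>k2 s\<bar> \<le> C"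
    and z: "\<And>s. s \<notin> {1<..<4} \<Longrightarrow> k0 s = 0 \<and> k1 s = 0 \<and> k2 s = 0"
    and c: "c > 0" "\<And>s. s \<in> {2..3} \<Longrightarrow> k0 s \<ge> c"
    by (rule cutoff_exists, rule that)
  obtain \<Phi> \<Phi>1 \<Phi>2 :: "real \<Rightarrow> real"
    where \<Phi>: "\<And>s. s > 0 \<Longrightarrow> (\<Phi> has_real_derivative \<Phi>1 s) (at s)"
    "\<And>s. s > 0 \<Longrightarrow> (\<Phi>1 has_real_derivative \<Phi>2 s) (at s)" "continuous_on {0<..} \<Phi>2"
    and lim: "(\<Phi>1 \<longlongrightarrow> 0) at_top" "((\<lambda>s. s * \<Phi>2 s) \<longlongrightarrow> 0) at_top"
    "((\<lambda>s. 4 * (s - 1) * (\<Phi>1 s)\<^sup>2 - s powr (\<alpha> / 2) - lam) \<longlongrightarrow> 0) at_top"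
    by (rule phase_exists[OF \<alpha>, of lam], rule that)
  define n where "n = real DIM('a)"
  \<comment> \<open>\<open>B\<close> collects the bounds of all error terms. Since
    \<open>s < 4 * \<rho>\<close> on the shell, \<open>1 / \<rho>\<close> is at most
    \<open>4 / s\<close> and \<open>(s - 1) / \<rho>\<close> at most 4, which turns the factors of
    the Laplacian into 64 and 32.\<close>
  define B where "B s = C * (2 * n * (4 * inverse s + \<bar>\<Phi>1 s\<bar>) + 64 * inverse s + 32 * \<bar>\<Phi>1 s\<bar> + 4 * \<bar>s * \<Phi>2 s\<bar>
    + \<bar>4 * (s - 1) * (\<Phi>1 s)\<^sup>2 - s powr (\<alpha> / 2) - lam\<bar>)" for s
  have "(B \<longlongrightarrow> C * (2 * n * (4 * 0 + \<bar>0\<bar>) + 64 * 0 + 32 * \<bar>0\<bar> + 4 * \<bar>0\<bar> + \<bar>0\<bar>)) at_top"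
    unfolding B_def[abs_def] by (intro tendsto_intros lim tendsto_inverse_0_at_top filterlim_ident)
  then have B0: "(B \<longlongrightarrow> 0) at_top" by simp
  \<comment> \<open>The square root of the volume ratio of two balls whose radii have quotient 20,
    divided by the lower bound of the cutoff.\<close>
  define K where "K = sqrt (20 ^ DIM('a)) / c"
  have K: "K > 0" using c(1) by (simp add: K_def)
  show ?thesis
  proof (rule exI[of _ K], intro conjI K allI impI)
    fix \<epsilon> :: real assume \<epsilon>: "\<epsilon> > 0"
    have "\<forall>\<^sub>F s in at_top. B s < \<epsilon>" by (rule order_tendstoD(2)[OF B0 \<epsilon>])
    then obtain s0 where s0: "\<And>s. s \<ge> s0 \<Longrightarrow> B s < \<epsilon>" by (auto simp: eventually_at_top_linorder)
    show "\<exists>\<rho>0. \<forall>\<rho>\<ge>\<rho>0. \<exists>(f :: 'a \<Rightarrow> complex) h. quasimode \<alpha> lam (\<epsilon> * K) \<rho> f h"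
    \<comment> \<open>The bound 10 absorbs the 1 in \<open>1 + x \<bullet> x\<close>: from
      \<open>x \<bullet> x \<le> 289 / 100 * \<rho>\<close> it must follow that
      \<open>1 + x \<bullet> x \<le> 3 * \<rho>\<close>.\<close>
    proof (intro exI[of _ "max s0 10"] allI impI)
      fix \<rho> assume "\<rho> \<ge> max s0 10"
      then have \<rho>: "\<rho> \<ge> s0" "\<rho> \<ge> 10" by auto
      define g where "g s = complex_of_real (k0 (s / \<rho>)) * cis (\<Phi> s)" for s
      define g1 where "g1 s = (complex_of_real (k1 (s / \<rho>) / \<rho>) + \<i> * complex_of_real (\<Phi>1 s * k0 (s / \<rho>))) * cis (\<Phi> s)" for s
      define g2 where "g2 s = (complex_of_real (k2 (s / \<rho>) / \<rho>\<^sup>2 - (\<Phi>1 s)\<^sup>2 * k0 (s / \<rho>))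
        + \<i> * complex_of_real (2 * \<Phi>1 s * k1 (s / \<rho>) / \<rho> + \<Phi>2 s * k0 (s / \<rho>))) * cis (\<Phi> s)" for s
      have dchi: "((\<lambda>s. k0 (s / \<rho>)) has_real_derivative k1 (s / \<rho>) / \<rho>) (at s)"
        "((\<lambda>s. k1 (s / \<rho>)) has_real_derivative k2 (s / \<rho>) / \<rho>) (at s)" for s
      proof -
        have "((\<lambda>s. s / \<rho>) has_real_derivative 1 / \<rho>) (at s)" by (rule DERIV_cdivide[OF DERIV_ident])
        from DERIV_chain2[OF k0(1) this] DERIV_chain2[OF k0(2) this]
        show "((\<lambda>s. k0 (s / \<rho>)) has_real_derivative k1 (s / \<rho>) / \<rho>) (at s)"
          "((\<lambda>s. k1 (s / \<rho>)) has_real_derivative k2 (s / \<rho>) / \<rho>) (at s)" by simp_all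
      qed
      have ofr: "((\<lambda>s. complex_of_real (k s)) has_vector_derivative complex_of_real k') (at s)"
        if "(k has_real_derivative k') (at s)" for k k' s
        using that by (intro has_vector_derivative_of_real) (simp add: has_real_derivative_iff_has_vector_derivative)
      have dcis: "((\<lambda>s. cis (\<Phi> s)) has_vector_derivative \<i> * complex_of_real (\<Phi>1 s) * cis (\<Phi> s)) (at s)" if "s > 0" for s
      proof -
        have "((\<lambda>s. complex_of_real (cos (\<Phi> s)) + \<i> * complex_of_real (sin (\<Phi> s))) has_vector_derivative
          complex_of_real (- sin (\<Phi> s) * \<Phi>1 s) + \<i> * complex_of_real (cos (\<Phi> s) * \<Phi>1 s)) (at s)"
          by (intro has_vector_derivative_add has_vector_derivative_mult_right ofr DERIV_fun_cos DERIV_fun_sin \<Phi>(1) that)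
        moreover have "(\<lambda>s. complex_of_real (cos (\<Phi> s)) + \<i> * complex_of_real (sin (\<Phi> s))) = (\<lambda>s. cis (\<Phi> s))"
          by (simp add: fun_eq_iff complex_eq_iff)
        moreover have "complex_of_real (- sin (\<Phi> s) * \<Phi>1 s) + \<i> * complex_of_real (cos (\<Phi> s) * \<Phi>1 s)
          = \<i> * complex_of_real (\<Phi>1 s) * cis (\<Phi> s)"
          by (simp add: complex_eq_iff)
        ultimately show ?thesis by simp
      qed
      interpret radial_profile g g1 g2 "4 * \<rho>" "TYPE('a)"
      proof
        fix s :: real
        show "(g has_vector_derivative g1 s) (at s)" if "s \<ge> 1"
        proof -
          have s: "s > 0" using that by simp
          have "(g has_vector_derivative (complex_of_real (k0 (s / \<rho>)) * (\<i> * complex_of_real (\<Phi>1 s) * cis (\<Phi> s))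
            + complex_of_real (k1 (s / \<rho>) / \<rho>) * cis (\<Phi> s))) (at s)"
            unfolding g_def[abs_def] by (rule has_vector_derivative_mult[OF ofr[OF dchi(1)] dcis[OF s]])
          then show ?thesis by (rule has_vector_derivative_eq_rhs) (simp add: g1_def algebra_simps)
        qed
        show "(g1 has_vector_derivative g2 s) (at s)" if "s \<ge> 1"
        proof -
          have s: "s > 0" using that by simp
          have a: "((\<lambda>s. k1 (s / \<rho>) / \<rho>) has_real_derivative k2 (s / \<rho>) / \<rho> / \<rho>) (at s)"
            by (intro DERIV_cdivide dchi(2))
          have b: "((\<lambda>s. \<Phi>1 s * k0 (s / \<rho>)) has_real_derivative \<Phi>1 s * (k1 (s / \<rho>) / \<rho>) + \<Phi>2 s * k0 (s / \<rho>)) (at s)"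
            using DERIV_mult[OF \<Phi>(2)[OF s] dchi(1)] by (simp add: add.commute mult.commute)
          have "(g1 has_vector_derivative ((complex_of_real (k1 (s / \<rho>) / \<rho>) + \<i> * complex_of_real (\<Phi>1 s * k0 (s / \<rho>))) * (\<i> * complex_of_real (\<Phi>1 s) * cis (\<Phi> s))
            + (complex_of_real (k2 (s / \<rho>) / \<rho> / \<rho>) + \<i> * complex_of_real (\<Phi>1 s * (k1 (s / \<rho>) / \<rho>) + \<Phi>2 s * k0 (s / \<rho>))) * cis (\<Phi> s))) (at s)"
            unfolding g1_def[abs_def]
            by (intro has_vector_derivative_mult has_vector_derivative_add has_vector_derivative_mult_right ofr a b dcis s)
          then show ?thesis
            by (rule has_vector_derivative_eq_rhs) (simp add: g2_def algebra_simps power2_eq_square)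
        qed
        show "g s = 0" "g1 s = 0" "g2 s = 0" if "s > 4 * \<rho>"
        proof -
          have "s / \<rho> \<notin> {1<..<4}" using that \<rho> by (simp add: field_simps)
          from z[OF this] show "g s = 0" "g1 s = 0" "g2 s = 0" by (simp_all add: g_def g1_def g2_def)
        qed
        have cder: "continuous_on {1..} k" if "\<And>s. s > 0 \<Longrightarrow> (k has_real_derivative k' s) (at s)" for k k' :: "real \<Rightarrow> real"
          by (intro continuous_at_imp_continuous_on ballI DERIV_isCont[OF that]) simp
        have cPhi: "continuous_on {1..} \<Phi>1" "continuous_on {1..} \<Phi>2"
          by (rule cder[OF \<Phi>(2)] continuous_on_subset[OF \<Phi>(3)]; force)+
        have ccis: "continuous_on {1..} (\<lambda>s. cis (\<Phi> s))"
          by (intro continuous_intros cder[OF \<Phi>(1)])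
        have cchi: "continuous_on {1..} (\<lambda>s. k0 (s / \<rho>))" "continuous_on {1..} (\<lambda>s. k1 (s / \<rho>))"
          by (rule cder[OF dchi(1)] cder[OF dchi(2)])+
        have cchi2: "continuous_on {1..} (\<lambda>s. k2 (s / \<rho>))"
          by (rule continuous_on_compose2[OF k0(3)]) (use \<rho> in \<open>auto intro!: continuous_intros\<close>)
        show "continuous_on {1..} g2"
          unfolding g2_def[abs_def] using \<rho> by (intro continuous_intros cPhi ccis cchi cchi2) auto
      qed
      define e where "e x = - (of_nat (2 * DIM('a)) * g1 (1 + x \<bullet> x) + of_real (4 * (x \<bullet> x)) * g2 (1 + x \<bullet> x))
        - of_real ((1 + x \<bullet> x) powr (\<alpha> / 2) + lam) * f x" for x :: 'a
      have supp: "g s = 0" "g1 s = 0" "g2 s = 0" if "\<not> (\<rho> < s \<and> s < 4 * \<rho>)" for s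
      proof -
        have "s / \<rho> \<notin> {1<..<4}" using that \<rho> by (simp add: field_simps)
        from z[OF this] show "g s = 0" "g1 s = 0" "g2 s = 0" by (simp_all add: g_def g1_def g2_def)
      qed
      have e_bound: "norm (e x) \<le> \<epsilon>" for x
      proof (cases "\<rho> < 1 + x \<bullet> x \<and> 1 + x \<bullet> x < 4 * \<rho>")
        case False
        then show ?thesis using supp[OF False] \<epsilon> by (simp add: e_def f_def)
      next
        case True
        define s where "s = 1 + x \<bullet> x"
        have s: "\<rho> < s" "s < 4 * \<rho>" "s \<ge> 1" "s > 0" using True by (auto simp: s_def)
        define a where "a = k0 (s / \<rho>)"
        define a1 where "a1 = k1 (s / \<rho>)"
        define a2 where "a2 = k2 (s / \<rho>)"
        have A: "\<bar>a\<bar> \<le> C" "\<bar>a1\<bar> \<le> C" "\<bar>a2\<bar> \<le> C" by (auto simp: a_def a1_def a2_def C)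
        define E where "E = 4 * (s - 1) * (\<Phi>1 s)\<^sup>2 - s powr (\<alpha> / 2) - lam"
        \<comment> \<open>Real and imaginary parts of the error once the phase factor is removed:
          \<open>u\<close> holds the eikonal error \<open>E\<close> and the pure cutoff derivatives,
          \<open>v\<close> the transport terms, each containing \<open>\<Phi>1\<close> or
          \<open>\<Phi>2\<close>.\<close>
        define u where "u = - (2 * n * (a1 / \<rho>)) - 4 * (s - 1) * (a2 / \<rho>\<^sup>2) + E * a"
        define v where "v = - (2 * n * (\<Phi>1 s * a)) - 8 * (s - 1) * (\<Phi>1 s * (a1 / \<rho>)) - 4 * (s - 1) * (\<Phi>2 s * a)"
        have "e x = (complex_of_real u + \<i> * complex_of_real v) * cis (\<Phi> s)"
        proof -
          have "e x = - (complex_of_real (2 * n) * g1 s + complex_of_real (4 * (s - 1)) * g2 s)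
            - complex_of_real (s powr (\<alpha> / 2) + lam) * g s"
            by (simp add: e_def f_def s_def n_def)
          also have "\<dots> = (complex_of_real u + \<i> * complex_of_real v) * cis (\<Phi> s)"
            unfolding g_def g1_def g2_def a_def[symmetric] a1_def[symmetric] a2_def[symmetric] u_def v_def E_def
            by (simp add: algebra_simps diff_divide_distrib add_divide_distrib)
          finally show ?thesis .
        qed
        then have "norm (e x) = norm (complex_of_real u + \<i> * complex_of_real v)" by (simp add: norm_mult)
        also have "\<dots> \<le> \<bar>u\<bar> + \<bar>v\<bar>"
          using norm_triangle_ineq[of "complex_of_real u" "\<i> * complex_of_real v"] by (simp add: norm_mult)
        also have "\<dots> \<le> B s"
        proof -
          have i1: "inverse \<rho> \<le> 4 * inverse s" using s \<rho> by (simp add: field_simps)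
          have i0: "0 \<le> inverse \<rho>" using \<rho> by simp
          have n0: "n \<ge> 0" by (simp add: n_def)
          have si: "(s - 1) * inverse \<rho> \<le> 4" "0 \<le> (s - 1) * inverse \<rho>" using s \<rho> by (auto simp: field_simps)
          have p: "\<bar>a1 / \<rho>\<bar> \<le> C * (4 * inverse s)"
            unfolding divide_inverse abs_mult using A(2) i1 i0 C(1) by (intro mult_mono) auto
          have t1: "\<bar>2 * n * (a1 / \<rho>)\<bar> \<le> C * (2 * n * (4 * inverse s))"
            using mult_left_mono[OF p, of "2 * n"] n0 by (simp add: abs_mult mult_ac)
          have t2: "\<bar>4 * (s - 1) * (a2 / \<rho>\<^sup>2)\<bar> \<le> C * (64 * inverse s)"
          proof -
            have "\<bar>4 * (s - 1) * (a2 / \<rho>\<^sup>2)\<bar> = 4 * (((s - 1) * inverse \<rho>) * (\<bar>a2\<bar> * inverse \<rho>))"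
              using s \<rho> by (simp add: abs_mult divide_inverse power2_eq_square)
            also have "\<dots> \<le> 4 * (4 * (C * (4 * inverse s)))"
              using si A(3) i1 i0 C(1) s by (intro mult_left_mono mult_mono) auto
            finally show ?thesis by simp
          qed
          have t3: "\<bar>E * a\<bar> \<le> C * \<bar>E\<bar>"
            unfolding abs_mult using mult_left_mono[OF A(1), of "\<bar>E\<bar>"] by (simp add: mult.commute)
          have t4: "\<bar>2 * n * (\<Phi>1 s * a)\<bar> \<le> C * (2 * n * \<bar>\<Phi>1 s\<bar>)"
            using mult_left_mono[OF A(1), of "2 * n * \<bar>\<Phi>1 s\<bar>"] n0 by (simp add: abs_mult mult_ac)
          have t5: "\<bar>8 * (s - 1) * (\<Phi>1 s * (a1 / \<rho>))\<bar> \<le> C * (32 * \<bar>\<Phi>1 s\<bar>)"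
          proof -
            have "\<bar>8 * (s - 1) * (\<Phi>1 s * (a1 / \<rho>))\<bar> = 8 * (((s - 1) * inverse \<rho>) * (\<bar>a1\<bar> * \<bar>\<Phi>1 s\<bar>))"
              using s \<rho> by (simp add: abs_mult divide_inverse)
            also have "\<dots> \<le> 8 * (4 * (C * \<bar>\<Phi>1 s\<bar>))"
              using si A(2) C(1) by (intro mult_left_mono mult_mono) auto
            finally show ?thesis by simp
          qed
          have t6: "\<bar>4 * (s - 1) * (\<Phi>2 s * a)\<bar> \<le> C * (4 * \<bar>s * \<Phi>2 s\<bar>)"
          proof -
            have "\<bar>4 * (s - 1) * (\<Phi>2 s * a)\<bar> = 4 * ((s - 1) * (\<bar>\<Phi>2 s\<bar> * \<bar>a\<bar>))" using s by (simp add: abs_mult)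
            also have "\<dots> \<le> 4 * (s * (\<bar>\<Phi>2 s\<bar> * C))"
              using A(1) s by (intro mult_left_mono mult_mono) auto
            finally show ?thesis using s by (simp add: abs_mult mult_ac)
          qed
          have tri: "\<bar>- x - y + z\<bar> \<le> \<bar>x\<bar> + \<bar>y\<bar> + \<bar>z\<bar>" "\<bar>- x - y - z\<bar> \<le> \<bar>x\<bar> + \<bar>y\<bar> + \<bar>z\<bar>"
            for x y z :: real by linarith+
          have "\<bar>u\<bar> + \<bar>v\<bar> \<le> \<bar>2 * n * (a1 / \<rho>)\<bar> + \<bar>4 * (s - 1) * (a2 / \<rho>\<^sup>2)\<bar> + \<bar>E * a\<bar>
            + (\<bar>2 * n * (\<Phi>1 s * a)\<bar> + \<bar>8 * (s - 1) * (\<Phi>1 s * (a1 / \<rho>))\<bar> + \<bar>4 * (s - 1) * (\<Phi>2 s * a)\<bar>)"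
            unfolding u_def v_def by (intro add_mono tri)
          also have "\<dots> \<le> C * (2 * n * (4 * inverse s)) + C * (64 * inverse s) + C * \<bar>E\<bar>
            + (C * (2 * n * \<bar>\<Phi>1 s\<bar>) + C * (32 * \<bar>\<Phi>1 s\<bar>) + C * (4 * \<bar>s * \<Phi>2 s\<bar>))"
            by (intro add_mono t1 t2 t3 t4 t5 t6)
          also have "\<dots> = B s" unfolding B_def E_def[symmetric] by (simp add: algebra_simps)
          finally show ?thesis .
        qed
        also have "\<dots> \<le> \<epsilon>" using s0[of s] s \<rho> by simp
        finally show ?thesis .
      qed
      have e_supp: "e x = 0" if "norm x > 2 * sqrt \<rho>" for x
      proof -
        have "4 * \<rho> < (norm x)\<^sup>2" using power_strict_mono[OF that, of 2] \<rho> by (simp add: power_mult_distrib)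
        then have "\<not> (\<rho> < 1 + x \<bullet> x \<and> 1 + x \<bullet> x < 4 * \<rho>)" by (simp add: power2_norm_eq_inner)
        from supp[OF this] show ?thesis by (simp add: e_def f_def)
      qed
      have e_cont: "continuous_on UNIV e"
      proof -
        have pos: "1 + x \<bullet> x \<noteq> 0" for x :: 'a using inner_ge_zero[of x] by linarith
        show ?thesis unfolding e_def[abs_def]
          by (intro continuous_intros continuous_radial continuous_profile g2 continuous_f) (auto simp: pos)
      qed
      have e_sq: "square_integrable e" by (rule square_integrable_compact_support[OF e_cont e_supp])
      have e_norm: "norm (abs_L2 e) \<le> \<epsilon> * sqrt (measure lebesgue (cball (0::'a) (2 * sqrt \<rho>)))"
        by (rule norm_abs_L2_le_cball[OF e_sq e_bound e_supp]) (use \<epsilon> in auto)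
      obtain b :: 'a where b: "b \<in> Basis" by (meson nonempty_Basis ex_in_conv)
      have nb: "norm b = 1" using b by simp
      \<comment> \<open>On this ball \<open>norm x / sqrt \<rho>\<close> lies between 3/2 and 17/10,
        so \<open>x \<bullet> x / \<rho>\<close> lies between 2.25 and 2.89, inside the range
        \<open>{2..3}\<close> where the cutoff is bounded below.\<close>
      let ?A = "ball ((8 / 5 * sqrt \<rho>) *\<^sub>R b) (sqrt \<rho> / 10) :: 'a set"
      have f_low: "norm (f x) \<ge> c" if "x \<in> ?A" for x
      proof -
        have d: "norm (x - (8 / 5 * sqrt \<rho>) *\<^sub>R b) < sqrt \<rho> / 10" using that by (simp add: dist_norm norm_minus_commute)
        have nn: "norm ((8 / 5 * sqrt \<rho>) *\<^sub>R b) = 8 / 5 * sqrt \<rho>" using \<rho> nb by simp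
        have up: "norm x \<le> 17 / 10 * sqrt \<rho>" and lo: "norm x \<ge> 3 / 2 * sqrt \<rho>"
          using norm_triangle_ineq2[of x "(8 / 5 * sqrt \<rho>) *\<^sub>R b"] norm_triangle_ineq3[of x "(8 / 5 * sqrt \<rho>) *\<^sub>R b"] d nn by linarith+
        have "(norm x)\<^sup>2 \<le> (17 / 10 * sqrt \<rho>)\<^sup>2" using up by (intro power_mono) auto
        then have u2: "x \<bullet> x \<le> 289 / 100 * \<rho>" using \<rho> by (simp add: power_mult_distrib power2_norm_eq_inner power_divide)
        have "(3 / 2 * sqrt \<rho>)\<^sup>2 \<le> (norm x)\<^sup>2" using lo \<rho> by (intro power_mono) auto
        then have l2: "x \<bullet> x \<ge> 9 / 4 * \<rho>" using \<rho> by (simp add: power_mult_distrib power2_norm_eq_inner power_divide)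
        have "(1 + x \<bullet> x) / \<rho> \<in> {2..3}" using u2 l2 \<rho> by (simp add: field_simps)
        from c(2)[OF this] c(1) show ?thesis by (simp add: f_def g_def norm_mult)
      qed
      have f_norm: "(norm (abs_L2 f))\<^sup>2 \<ge> c\<^sup>2 * measure lebesgue ?A"
      proof -
        have "c\<^sup>2 * measure lebesgue ?A = (\<integral>x. c\<^sup>2 * indicator ?A x \<partial>lebesgue)" by simp
        also have "\<dots> \<le> (\<integral>x. (norm (f x))\<^sup>2 \<partial>lebesgue)"
        proof (rule integral_mono)
          have "emeasure lborel ?A < \<infinity>" by (rule emeasure_lborel_ball_finite)
          then show "integrable lebesgue (\<lambda>x. c\<^sup>2 * indicator ?A x :: real)"
            by (intro integrable_mult_right integrable_real_indicator) auto
          show "integrable lebesgue (\<lambda>x. (norm (f x))\<^sup>2)" using square_integrable_f(1) by (simp add: square_integrable_def)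
          show "c\<^sup>2 * indicator ?A x \<le> (norm (f x))\<^sup>2" for x
            using f_low[of x] c(1) by (cases "x \<in> ?A") (auto intro: power_mono)
        qed
        also have "\<dots> = (norm (abs_L2 f))\<^sup>2" by (rule norm_abs_sq[OF square_integrable_f(1), symmetric])
        finally show ?thesis .
      qed
      have vol: "measure lebesgue (cball (0::'a) (2 * sqrt \<rho>)) = 20 ^ DIM('a) * measure lebesgue ?A" "measure lebesgue ?A > 0"
      proof -
        have "measure lebesgue (cball (0::'a) (2 * sqrt \<rho>)) = unit_ball_vol n * (2 * sqrt \<rho>) ^ DIM('a)"
          using content_cball[of "2 * sqrt \<rho>" "0::'a"] \<rho> by (simp add: n_def)
        also have "2 * sqrt \<rho> = 20 * (sqrt \<rho> / 10)" by simp
        also have "unit_ball_vol n * (20 * (sqrt \<rho> / 10)) ^ DIM('a) = 20 ^ DIM('a) * (unit_ball_vol n * (sqrt \<rho> / 10) ^ DIM('a))"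
          unfolding power_mult_distrib by simp
        also have "unit_ball_vol n * (sqrt \<rho> / 10) ^ DIM('a) = measure lebesgue ?A"
          using content_ball[of "sqrt \<rho> / 10" "(8 / 5 * sqrt \<rho>) *\<^sub>R b"] \<rho> by (simp add: n_def)
        finally show "measure lebesgue (cball (0::'a) (2 * sqrt \<rho>)) = 20 ^ DIM('a) * measure lebesgue ?A" by simp
        show "measure lebesgue ?A > 0" using content_ball_pos[of "sqrt \<rho> / 10"] \<rho> by simp
      qed
      define \<mu> where "\<mu> = measure lebesgue ?A"
      have \<mu>: "\<mu> > 0" unfolding \<mu>_def by (rule vol(2))
      have "(c * sqrt \<mu>)\<^sup>2 = c\<^sup>2 * \<mu>" using \<mu> by (simp add: power_mult_distrib)
      also have "\<dots> \<le> (norm (abs_L2 f))\<^sup>2" unfolding \<mu>_def by (rule f_norm)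
      finally have f_norm': "c * sqrt \<mu> \<le> norm (abs_L2 f)" by (rule power2_le_imp_le) simp
      have "norm (abs_L2 e) \<le> \<epsilon> * (sqrt (20 ^ DIM('a)) * sqrt \<mu>)"
        using e_norm unfolding vol(1) real_sqrt_mult \<mu>_def .
      also have "\<dots> = \<epsilon> * K * (c * sqrt \<mu>)" using c(1) by (simp add: K_def)
      also have "\<dots> \<le> \<epsilon> * K * norm (abs_L2 f)"
        using \<epsilon> K by (intro mult_left_mono[OF f_norm']) simp
      finally have le: "norm (abs_L2 e) \<le> \<epsilon> * K * norm (abs_L2 f)" .
      have "0 < c * sqrt \<mu>" using c(1) \<mu> by simp
      then have "abs_L2 f \<noteq> 0" using f_norm' by auto
      moreover have "(abs_L2 f, abs_L2 e) \<in> op_shift (H_pre \<alpha>) (- of_real lam)"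
        unfolding e_def[abs_def] by (rule H_pre_f)
      moreover have "\<forall>x. f x \<noteq> 0 \<longrightarrow> \<rho> < 1 + x \<bullet> x \<and> 1 + x \<bullet> x < 4 * \<rho>" using supp(1) unfolding f_def by blast
      ultimately show "\<exists>(f :: 'a \<Rightarrow> complex) h. quasimode \<alpha> lam (\<epsilon> * K) \<rho> f h"
        using le square_integrable_f(1) unfolding quasimode_def by blast
    qed
  qed
qed

lemma singular_sequence_exists:
  fixes \<alpha> lam :: real
  assumes \<alpha>: "0 < \<alpha>" "\<alpha> < 2"
  obtains e h :: "nat \<Rightarrow> 'a::euclidean_space L2"
  where "\<And>n. norm (e n) = 1" "\<And>i j. i \<noteq> j \<Longrightarrow> e i \<bullet> e j = 0"
    "\<And>n. (e n, h n) \<in> op_shift (H_pre \<alpha>) (- of_real lam)" "h \<longlonglongrightarrow> 0"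
proof -
  obtain K where K: "K > 0" "\<And>\<epsilon>. \<epsilon> > 0 \<Longrightarrow> \<exists>\<rho>0. \<forall>\<rho>\<ge>\<rho>0. \<exists>(f :: 'a \<Rightarrow> complex) h. quasimode \<alpha> lam (\<epsilon> * K) \<rho> f h"
    using quasimode_exists[OF \<alpha>, of lam] by metis
  have "\<exists>\<rho>0. \<forall>\<rho>\<ge>\<rho>0. \<exists>(f :: 'a \<Rightarrow> complex) h. quasimode \<alpha> lam (inverse (real (Suc k))) \<rho> f h" for k
    using K(2)[of "inverse (real (Suc k)) / K"] K(1) by simp
  then obtain r where r: "\<And>k \<rho>. \<rho> \<ge> r k \<Longrightarrow> \<exists>(f :: 'a \<Rightarrow> complex) h. quasimode \<alpha> lam (inverse (real (Suc k))) \<rho> f h" by metis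
  \<comment> \<open>Each radius exceeds the threshold for its own accuracy, and growth by a factor
    of at least 4 makes the shells disjoint.\<close>
  define \<rho> where "\<rho> = rec_nat (max 1 (r 0)) (\<lambda>k x. max (4 * x) (r (Suc k)))"
  have \<rho>_simps: "\<rho> 0 = max 1 (r 0)" "\<rho> (Suc k) = max (4 * \<rho> k) (r (Suc k))" for k by (simp_all add: \<rho>_def)
  have \<rho>r: "\<rho> k \<ge> r k" for k by (cases k) (auto simp: \<rho>_simps)
  have \<rho>1: "\<rho> k \<ge> 1" for k by (induction k) (auto simp: \<rho>_simps)
  have inc: "\<rho> k \<le> \<rho> (Suc k)" for k using \<rho>1[of k] by (simp add: \<rho>_simps)
  have \<rho>4: "4 * \<rho> i \<le> \<rho> j" if "i < j" for i j
  proof -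
    have "4 * \<rho> i \<le> \<rho> (Suc i)" by (simp add: \<rho>_simps)
    also have "\<dots> \<le> \<rho> j" using that by (intro lift_Suc_mono_le[of \<rho>, OF inc]) simp
    finally show ?thesis .
  qed
  obtain f :: "nat \<Rightarrow> 'a \<Rightarrow> complex" and h where fh: "\<And>k. quasimode \<alpha> lam (inverse (real (Suc k))) (\<rho> k) (f k) (h k)" using r[OF \<rho>r] by metis
  define m where "m k = norm (abs_L2 (f k))" for k
  have m: "m k > 0" for k using fh[of k] by (simp add: quasimode_def m_def)
  have orth: "abs_L2 (f i) \<bullet> abs_L2 (f j) = 0" if "i \<noteq> j" for i j
  proof -
    have "f i x \<bullet> f j x = 0" for x
    proof (rule ccontr)
      assume "f i x \<bullet> f j x \<noteq> 0"
      then have "f i x \<noteq> 0" "f j x \<noteq> 0" by auto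
      then have "\<rho> i < 1 + x \<bullet> x" "1 + x \<bullet> x < 4 * \<rho> i" "\<rho> j < 1 + x \<bullet> x" "1 + x \<bullet> x < 4 * \<rho> j"
        using fh[of i] fh[of j] unfolding quasimode_def by blast+
      then show False using \<rho>4[of i j] \<rho>4[of j i] that by linarith
    qed
    then show ?thesis using inner_abs[of "f i" "f j"] fh[of i] fh[of j] by (simp add: quasimode_def)
  qed
  show thesis
  proof (rule that[of "\<lambda>k. abs_L2 (f k) /\<^sub>R m k" "\<lambda>k. h k /\<^sub>R m k"])
    show "norm (abs_L2 (f k) /\<^sub>R m k) = 1" for k using m[of k] by (simp add: m_def)
    show "(abs_L2 (f i) /\<^sub>R m i) \<bullet> (abs_L2 (f j) /\<^sub>R m j) = 0" if "i \<noteq> j" for i j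
      using orth[OF that] by simp
    have lin: "linear_rel (op_shift (H_pre \<alpha> :: 'a operator) (- of_real lam))"
      unfolding H_pre_eq by (intro linear_rel_op_shift linear_rel_op_plus linear_rel_laplacian_rel linear_rel_mult_operator)
    show "(abs_L2 (f k) /\<^sub>R m k, h k /\<^sub>R m k) \<in> op_shift (H_pre \<alpha>) (- of_real lam)" for k
      unfolding scaleC_of_real[symmetric] using fh[of k] by (intro linear_relD(3)[OF lin]) (simp add: quasimode_def)
    show "(\<lambda>k. h k /\<^sub>R m k) \<longlonglongrightarrow> 0"
    proof (rule Lim_null_comparison[OF _ LIMSEQ_inverse_real_of_nat], rule always_eventually, rule allI)
      fix k
      have "norm (h k) \<le> inverse (real (Suc k)) * m k" using fh[of k] by (simp add: quasimode_def m_def)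
      then show "norm (h k /\<^sub>R m k) \<le> inverse (real (Suc k))"
        using m[of k] by (simp add: divide_inverse[symmetric] mult.commute[of "inverse (m k)"] pos_divide_le_eq)
    qed
  qed
qed

section \<open>The spectrum of the full operator\<close>

theorem proposition2p6:
  fixes \<alpha> :: real and V :: "real ^ 'n \<Rightarrow> real"
  assumes "0 < \<alpha>" and "\<alpha> < 2"
    and "V \<in> borel_measurable lebesgue"
    and "H_free_compact \<alpha> V"
  shows "spectrum (H_full \<alpha> V) = \<real>"
proof -
  obtain K where K: "converse (op_shift (H_free \<alpha>) \<i>) O mult_operator V = graph_of K" "bounded_clinear K"
      "compact (closure (K ` cball 0 1))"
    using assms(4) unfolding H_free_compact_def compact_operator_def by blast
  have full: "linear_rel (H_full \<alpha> V)" "symmetric_rel (H_full \<alpha> V)" "cnj_invariant (H_full \<alpha> V)"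
    unfolding H_full_def
    by (intro linear_rel_op_plus symmetric_rel_op_plus cnj_invariant_op_plus H_free_properties
        linear_rel_mult_operator symmetric_rel_mult_operator cnj_invariant_mult_operator)+
  have onto: "onto_at (H_full \<alpha> V) (- \<i>)"
    unfolding H_full_def by (rule onto_at_relatively_compact[OF H_free_properties(1,2) K])
  show ?thesis
  proof (intro equalityI subsetI)
    fix z assume "z \<in> spectrum (H_full \<alpha> V)"
    then have "Im z = 0"
      using nonreal_in_resolvent_set[OF full onto, of z] unfolding spectrum_def by blast
    then show "z \<in> \<real>" by (simp add: complex_is_Real_iff)
  next
    fix z :: complex assume "z \<in> \<real>"
    then obtain lam where z: "z = of_real lam" by (auto elim: Reals_cases)
    obtain e h :: "nat \<Rightarrow> (real ^ 'n) L2"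
      where e: "\<And>n. norm (e n) = 1" "\<And>i j. i \<noteq> j \<Longrightarrow> e i \<bullet> e j = 0"
        and h: "\<And>n. (e n, h n) \<in> op_shift (H_pre \<alpha>) (- of_real lam)" "h \<longlonglongrightarrow> 0"
      by (rule singular_sequence_exists[OF assms(1,2), of lam], rule that)
    \<comment> \<open>The singular sequence consists of elements of \<open>H_pre\<close>; passing to
      the closure only enlarges the graph.\<close>
    have h': "(e n, h n) \<in> op_shift (H_free \<alpha>) (- of_real lam)" for n
      using h(1)[of n] closure_subset[of "H_pre \<alpha>"] unfolding op_shift_iff H_free_def by blast
    show "z \<in> spectrum (H_full \<alpha> V)"
      unfolding z H_full_def by (rule singular_sequence_in_spectrum[OF H_free_properties(1,2) K e h' h(2)])
  qed
qed

end
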